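(* Let $X$ be a complete $RN$ module over $K$ with base $(\Omega,\mathcal F,P)$. (a) Let $C\in B(X)$ be injective and let $\{V(s):s\ge0\}$ be a locally a.s. bounded $C$-semigroup on $X$ with generator $(A,D(A))$. Then $\{V(s):s\ge0\}$ is a strong $C$-existence family for $(A,D(A))$. (b) Let $A:D(A)\to X$ be a module homomorphism with $D(A)\subseteq X$. If, for some injective $C\in B(X)$, there is a locally a.s. bounded $C$-semigroup on $X$ whose generator is an extension of $(A,D(A))$, then all solutions and mild solutions satisfying the locally $L^0$-Lipschitz condition of the abstract Cauchy problem $$\frac{dW(s,z)}{ds}=AW(s,z)\ \ (s>0),\qquad W(0,z)=z,$$ are unique; that is, for each $z\in X$ there is at most one solution which is a locally $L^0$-Lipschitz function from $[0,\infty)$ to $X$, and at most one mild solution which is a locally $L^0$-Lipschitz function from $[0,\infty)$ to $X$.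
   Context: $(\Omega,\mathcal F,P)$ is a probability space, $K=\mathbb R$ or $\mathbb C$, $L^0(\mathcal F,K)$ is the algebra of equivalence classes (a.s. equality) of $K$-valued $\mathcal F$-measurable random variables, $\bar L^0(\mathcal F,R)$ the complete lattice of equivalence classes of extended real-valued random variables under a.s. order, and $L^0_+(\mathcal F)=\{\xi\in L^0(\mathcal F,R):\xi\ge 0\}$. $\bigvee$ and $\bigwedge$ denote supremum and infimum in $\bar L^0(\mathcal F,R)$. An $RN$ module over $K$ with base $(\Omega,\mathcal F,P)$ is an $L^0(\mathcal F,K)$-module $X$ with a map $\|\cdot\|:X\to L^0_+(\mathcal F)$ (the $L^0$-norm) such that $\|\xi x\|=|\xi|\|x\|$ for all $\xi\in L^0(\mathcal F,K)$, $x\in X$; $\|x+y\|\le\|x\|+\|y\|$; and $\|x\|=0$ implies $x=0$. It carries the $(\varepsilon,\lambda)$-topology, the metrizable linear topology with local base at $0$ given by $\{z: P(\|z\|<\varepsilon)>\lambda\}$, $\varepsilon>0$, $0<\lambda<1$; so $z_n\to z$ iff $\|z_n-z\|\to0$ in probability. Completeness, limits, continuity, derivatives (one-sided at endpoints) and Riemann integrals (limits of Riemann sums) are in this topology. A linear operator $T:X_1\to X_2$ between $RN$ modules is a.s. bounded if there is $\eta\in L^0_+(\mathcal F)$ with $\|Tz\|\le\eta\|z\|$ for all $z$; $B(X_1,X_2)$ is the set of these (equivalently, the continuous module homomorphisms), $B(X)=B(X,X)$, and $\|T\|=\bigwedge\{\eta\in L^0_+(\mathcal F):\|Tz\|\le\eta\|z\|\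 \forall z\}$. A module homomorphism is an $L^0(\mathcal F,K)$-linear map. $R(C)$ is the range of $C$. A family $\{V(s):s\ge0\}$ of continuous module homomorphisms is locally a.s. bounded if $\bigvee_{s\in[0,l]}\|V(s)\|\in L^0_+(\mathcal F)$ for every $l>0$. $C$-semigroup on $X$ ($C\in B(X)$ injective): a family $\{V(s):s\ge0\}\subset B(X)$ such that $s\mapsto V(s)z$ is continuous from $[0,\infty)$ to $X$ for every $z\in X$; $V(0)=C$; and $CV(s+t)=V(s)V(t)$ for all $s,t\ge0$. Its generator $(A,D(A))$ is given by $D(A)=\{z\in X:\lim_{s\downarrow0}\frac{V(s)z-Cz}{s}\text{ exists and belongs to }R(C)\}$ and $Az=C^{-1}\lim_{s\downarrow0}\frac{V(s)z-Cz}{s}$ for $z\in D(A)$. $[D(A)]$ is the $RN$ module $D(A)$ with the graph $L^0$-norm $\|z\|_{[D(A)]}=\|z\|+\|Az\|$. Mild $C$-existence family for $A$: a locally a.s. bounded family $\{V(s):s\ge0\}\subseteq B(X)$ such that (1) $s\mapsto V(s)z$ is continuous from $[0,\infty)$ to $X$ for every $z\in X$; (2) for every $z\in X$, $s\ge0$, $\int_0^sV(u)z\,du\in D(A)$ and $A\int_0^sV(u)z\,du=V(s)z-Cz$. $C$-existence family for $A$: a locally a.s. bounded (with respect to the operator $L^0$-norm of $B([D(A)])$) family $\{V(s):s\ge0\}\subseteq B([D(A)])$ such that (1) $s\mapsto V(s)z$ is continuous from $[0,\infty)$ to $[D(A)]$ for every $z\in D(A)$; (2) for every $z\in D(A)$,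 $s\ge0$, $\int_0^sAV(u)z\,du=V(s)z-Cz$. Strong $C$-existence family for $A$: a mild $C$-existence family $\{V(s):s\ge0\}$ for $A$ such that the restrictions $\{V(s)|_{[D(A)]}:s\ge0\}$ form a $C$-existence family for $A$. A function $g:[0,\infty)\to X$ is locally $L^0$-Lipschitz if for every $l>0$ there is $\xi_l\in L^0_+(\mathcal F)$ with $\|g(s_1)-g(s_2)\|\le\xi_l|s_1-s_2|$ for all $s_1,s_2\in[0,l]$. A solution of the abstract Cauchy problem with initial data $z$ is a map $s\mapsto W(s,z)$ in $C([0,\infty),[D(A)])\cap C^1([0,\infty),X)$ satisfying it. A mild solution is a map $s\mapsto W(s,z)$ in $C([0,\infty),X)$ with $\bigvee_{u\in[0,s]}\|W(u,z)\|\in L^0_+(\mathcal F)$ for each $s\ge0$, such that for every $s\ge0$, $\int_0^sW(u,z)\,du\in D(A)$ and $W(s,z)=A\int_0^sW(u,z)\,du+z$. *)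

theory Defs
  imports
    "HOL-Probability.Probability"
    "HOL-Algebra.Module"
    "HOL-Algebra.Complete_Lattice"
begin

section \<open>Equivalence classes of random variables\<close>

definition ae_eq :: "'w measure \<Rightarrow> (('w \<Rightarrow> 'b::topological_space) \<times> ('w \<Rightarrow> 'b)) set" where
  "ae_eq M = {(f, g). f \<in> borel_measurable M \<and> g \<in> borel_measurable M \<and> (AE w in M. f w = g w)}"

definition L0_set :: "'w measure \<Rightarrow> ('w \<Rightarrow> 'b::topological_space) set set" where
  "L0_set M = borel_measurable M // ae_eq M"

definition cls :: "'w measure \<Rightarrow> ('w \<Rightarrow> 'b::topological_space) \<Rightarrow> ('w \<Rightarrow> 'b) set" where
  "cls M f = ae_eq M `` {f}"

text \<open>A chosen representative of a class. All operations below are compatible with a.e. equality,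
  so none of them depends on the choice.\<close>

definition rep :: "('w \<Rightarrow> 'b) set \<Rightarrow> 'w \<Rightarrow> 'b" where
  "rep a = (SOME f. f \<in> a)"

text \<open>The algebra \<open>L\<^sup>0(F,K)\<close>. The scalar field \<open>K\<close> is a type of class
  \<open>{real_normed_field, second_countable_topology}\<close>. Both \<open>real\<close> and \<open>complex\<close> are instances and,
  by the theorems of Gelfand, Mazur and Ostrowski, they are the only ones up to isomorphism.\<close>

definition L0 :: "'w measure \<Rightarrow> ('w \<Rightarrow> 'k::{real_normed_field,second_countable_topology}) set ring"
  where
  "L0 M = \<lparr>carrier = L0_set M,
           monoid.mult = (\<lambda>a b. cls M (\<lambda>w. rep a w * rep b w)),
           one = cls M (\<lambda>_. 1),
           zero = cls M (\<lambda>_. 0),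
           add = (\<lambda>a b. cls M (\<lambda>w. rep a w + rep b w))\<rparr>"

definition L0_const :: "'w measure \<Rightarrow> 'k::{real_normed_field,second_countable_topology} \<Rightarrow> ('w \<Rightarrow> 'k) set"
  where "L0_const M c = cls M (\<lambda>_. c)"

definition L0_abs ::
  "'w measure \<Rightarrow> ('w \<Rightarrow> 'k::{real_normed_field,second_countable_topology}) set \<Rightarrow> ('w \<Rightarrow> real) set" where
  "L0_abs M a = cls M (\<lambda>w. norm (rep a w))"

definition L0_le :: "'w measure \<Rightarrow> ('w \<Rightarrow> real) set \<Rightarrow> ('w \<Rightarrow> real) set \<Rightarrow> bool" where
  "L0_le M a b \<longleftrightarrow> (AE w in M. rep a w \<le> rep b w)"

definition L0_plus :: "'w measure \<Rightarrow> ('w \<Rightarrow> real) set set" where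
  "L0_plus M = {a \<in> L0_set M. L0_le M (L0_const M 0) a}"

text \<open>The complete lattice of classes of extended real valued random variables; its suprema and
  infima are those of \<^theory>\<open>HOL-Algebra.Lattice\<close>.\<close>

definition L0bar :: "'w measure \<Rightarrow> ('w \<Rightarrow> ereal) set gorder" where
  "L0bar M = \<lparr>carrier = L0_set M, eq = (=), le = (\<lambda>a b. AE w in M. rep a w \<le> rep b w)\<rparr>"

definition to_L0bar :: "'w measure \<Rightarrow> ('w \<Rightarrow> real) set \<Rightarrow> ('w \<Rightarrow> ereal) set" where
  "to_L0bar M a = cls M (\<lambda>w. ereal (rep a w))"


section \<open>Random normed modules\<close>

record ('w, 'k, 'x) rn_module = "(('w \<Rightarrow> 'k) set, 'x) module" +
  lnorm :: "'x \<Rightarrow> ('w \<Rightarrow> real) set"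

locale RN_module =
  prob_space M + module "L0 M" X
  for M :: "'w measure"
    and X :: "('w, 'k::{real_normed_field,second_countable_topology}, 'x) rn_module" +
  assumes lnorm_closed: "x \<in> carrier X \<Longrightarrow> lnorm X x \<in> L0_plus M"
    and lnorm_smult: "a \<in> carrier (L0 M) \<Longrightarrow> x \<in> carrier X \<Longrightarrow>
      lnorm X (a \<odot>\<^bsub>X\<^esub> x) = L0_abs M a \<otimes>\<^bsub>L0 M\<^esub> lnorm X x"
    and lnorm_triangle: "x \<in> carrier X \<Longrightarrow> y \<in> carrier X \<Longrightarrow>
      L0_le M (lnorm X (x \<oplus>\<^bsub>X\<^esub> y)) (lnorm X x \<oplus>\<^bsub>L0 M\<^esub> lnorm X y)"
    and lnorm_zero_imp: "x \<in> carrier X \<Longrightarrow> lnorm X x = \<zero>\<^bsub>L0 M\<^esub> \<Longrightarrow> x = \<zero>\<^bsub>X\<^esub>"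

definition el_nbhd :: "'w measure \<Rightarrow> ('w, 'k, 'x) rn_module \<Rightarrow> real \<Rightarrow> real \<Rightarrow> 'x set" where
  "el_nbhd M X e l = {z \<in> carrier X. l < measure M {w \<in> space M. rep (lnorm X z) w < e}}"

definition el_open :: "'w measure \<Rightarrow> ('w, 'k, 'x) rn_module \<Rightarrow> 'x set \<Rightarrow> bool" where
  "el_open M X U \<longleftrightarrow> U \<subseteq> carrier X \<and>
     (\<forall>x\<in>U. \<exists>e>0. \<exists>l. 0 < l \<and> l < 1 \<and> (\<forall>y\<in>carrier X. y \<ominus>\<^bsub>X\<^esub> x \<in> el_nbhd M X e l \<longrightarrow> y \<in> U))"

definition el_topology :: "'w measure \<Rightarrow> ('w, 'k, 'x) rn_module \<Rightarrow> 'x topology" where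
  "el_topology M X = topology (el_open M X)"

text \<open>The topology is metrizable, so completeness is completeness for sequences.\<close>

definition el_complete :: "'w measure \<Rightarrow> ('w, 'k, 'x) rn_module \<Rightarrow> bool" where
  "el_complete M X \<longleftrightarrow>
     (\<forall>z::nat \<Rightarrow> 'x. range z \<subseteq> carrier X \<longrightarrow>
        (\<forall>e>0. \<forall>l. 0 < l \<and> l < 1 \<longrightarrow> (\<exists>N. \<forall>m\<ge>N. \<forall>n\<ge>N. z m \<ominus>\<^bsub>X\<^esub> z n \<in> el_nbhd M X e l)) \<longrightarrow>
        (\<exists>x. limitin (el_topology M X) z x sequentially))"


section \<open>Calculus in the \<open>(\<epsilon>,\<lambda>)\<close>-topology\<close>

definition rscale ::
  "'w measure \<Rightarrow> ('w, 'k::{real_normed_field,second_countable_topology}, 'x) rn_module \<Rightarrow> real \<Rightarrow> 'x \<Rightarrow> 'x"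
  where "rscale M X r x = L0_const M (of_real r) \<odot>\<^bsub>X\<^esub> x"

definition continuous_on_halfline :: "'w measure \<Rightarrow> ('w, 'k, 'x) rn_module \<Rightarrow> (real \<Rightarrow> 'x) \<Rightarrow> bool" where
  "continuous_on_halfline M X g \<longleftrightarrow> continuous_map (top_of_set {0..}) (el_topology M X) g"

text \<open>Derivative of a function on \<open>[0,\<infinity>)\<close>, one-sided at \<open>0\<close>.\<close>

definition has_derivative_halfline ::
  "'w measure \<Rightarrow> ('w, 'k::{real_normed_field,second_countable_topology}, 'x) rn_module \<Rightarrow>
   (real \<Rightarrow> 'x) \<Rightarrow> 'x \<Rightarrow> real \<Rightarrow> bool" where
  "has_derivative_halfline M X g d s \<longleftrightarrow>
     limitin (el_topology M X) (\<lambda>t. rscale M X (1 / (t - s)) (g t \<ominus>\<^bsub>X\<^esub> g s)) d (at s within {0..})"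

definition C1_halfline ::
  "'w measure \<Rightarrow> ('w, 'k::{real_normed_field,second_countable_topology}, 'x) rn_module \<Rightarrow>
   (real \<Rightarrow> 'x) \<Rightarrow> bool" where
  "C1_halfline M X g \<longleftrightarrow> g \<in> {0..} \<rightarrow> carrier X \<and>
     (\<exists>g'. (\<forall>s\<ge>0. has_derivative_halfline M X g (g' s) s) \<and> continuous_on_halfline M X g')"

text \<open>Tagged partitions of \<open>[a,b]\<close> as the mesh tends to \<open>0\<close>; \<open>measure lborel K\<close> is the length of the
  interval \<open>K\<close>. In contrast to \<^const>\<open>has_integral\<close> the mesh bound does not depend on the tags.\<close>

definition riemann_filter :: "real \<Rightarrow> real \<Rightarrow> (real \<times> real set) set filter" where
  "riemann_filter a b =
     (INF d\<in>{0<..}. principal {p. p tagged_division_of {a..b} \<and> (\<forall>(t, K)\<in>p. measure lborel K < d)})"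

definition has_riemann_integral ::
  "'w measure \<Rightarrow> ('w, 'k::{real_normed_field,second_countable_topology}, 'x) rn_module \<Rightarrow>
   (real \<Rightarrow> 'x) \<Rightarrow> 'x \<Rightarrow> real \<Rightarrow> real \<Rightarrow> bool" where
  "has_riemann_integral M X g I a b \<longleftrightarrow>
     limitin (el_topology M X)
       (\<lambda>p. \<Oplus>\<^bsub>X\<^esub>tK\<in>p. rscale M X (measure lborel (snd tK)) (g (fst tK))) I (riemann_filter a b)"

definition locally_L0_lipschitz :: "'w measure \<Rightarrow> ('w, 'k, 'x) rn_module \<Rightarrow> (real \<Rightarrow> 'x) \<Rightarrow> bool" where
  "locally_L0_lipschitz M X g \<longleftrightarrow> g \<in> {0..} \<rightarrow> carrier X \<and>
     (\<forall>l>0. \<exists>\<xi>\<in>L0_plus M. \<forall>s1\<in>{0..l}. \<forall>s2\<in>{0..l}.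
        L0_le M (lnorm X (g s1 \<ominus>\<^bsub>X\<^esub> g s2)) (\<xi> \<otimes>\<^bsub>L0 M\<^esub> L0_const M \<bar>s1 - s2\<bar>))"


section \<open>Almost surely bounded operators\<close>

text \<open>Operators are total functions of which only the values on the carrier matter.
  Linearity is over the scalar field \<open>K\<close>, embedded in \<open>L\<^sup>0\<close> as the constants; for a.s.
  bounded operators it already implies linearity over \<open>L\<^sup>0\<close>.\<close>

definition linear_op ::
  "'w measure \<Rightarrow> ('w, 'k::{real_normed_field,second_countable_topology}, 'x) rn_module \<Rightarrow>
   ('w, 'k, 'y) rn_module \<Rightarrow> ('x \<Rightarrow> 'y) \<Rightarrow> bool" where
  "linear_op M X Y T \<longleftrightarrow> T \<in> carrier X \<rightarrow> carrier Y \<and>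
     (\<forall>x\<in>carrier X. \<forall>y\<in>carrier X. T (x \<oplus>\<^bsub>X\<^esub> y) = T x \<oplus>\<^bsub>Y\<^esub> T y) \<and>
     (\<forall>c. \<forall>x\<in>carrier X. T (L0_const M c \<odot>\<^bsub>X\<^esub> x) = L0_const M c \<odot>\<^bsub>Y\<^esub> T x)"

definition L0_bounds ::
  "'w measure \<Rightarrow> ('w, 'k, 'x) rn_module \<Rightarrow> ('w, 'k, 'y) rn_module \<Rightarrow> ('x \<Rightarrow> 'y) \<Rightarrow> ('w \<Rightarrow> real) set set" where
  "L0_bounds M X Y T = {\<eta> \<in> L0_plus M. \<forall>z\<in>carrier X. L0_le M (lnorm Y (T z)) (\<eta> \<otimes>\<^bsub>L0 M\<^esub> lnorm X z)}"

definition bounded_ops ::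
  "'w measure \<Rightarrow> ('w, 'k::{real_normed_field,second_countable_topology}, 'x) rn_module \<Rightarrow>
   ('w, 'k, 'y) rn_module \<Rightarrow> ('x \<Rightarrow> 'y) set" where
  "bounded_ops M X Y = {T. linear_op M X Y T \<and> L0_bounds M X Y T \<noteq> {}}"

definition opnorm ::
  "'w measure \<Rightarrow> ('w, 'k, 'x) rn_module \<Rightarrow> ('w, 'k, 'y) rn_module \<Rightarrow> ('x \<Rightarrow> 'y) \<Rightarrow> ('w \<Rightarrow> ereal) set" where
  "opnorm M X Y T = \<Sqinter>\<^bsub>L0bar M\<^esub>(to_L0bar M ` L0_bounds M X Y T)"

definition module_hom_on ::
  "'w measure \<Rightarrow> ('w, 'k::{real_normed_field,second_countable_topology}, 'x) rn_module \<Rightarrow>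
   'x set \<Rightarrow> ('x \<Rightarrow> 'x) \<Rightarrow> bool" where
  "module_hom_on M X D A \<longleftrightarrow> submodule D (L0 M) X \<and> A \<in> D \<rightarrow> carrier X \<and>
     (\<forall>x\<in>D. \<forall>y\<in>D. A (x \<oplus>\<^bsub>X\<^esub> y) = A x \<oplus>\<^bsub>X\<^esub> A y) \<and>
     (\<forall>a\<in>carrier (L0 M). \<forall>x\<in>D. A (a \<odot>\<^bsub>X\<^esub> x) = a \<odot>\<^bsub>X\<^esub> A x)"

definition locally_as_bounded ::
  "'w measure \<Rightarrow> ('w, 'k::{real_normed_field,second_countable_topology}, 'x) rn_module \<Rightarrow>
   (real \<Rightarrow> 'x \<Rightarrow> 'x) \<Rightarrow> bool" where
  "locally_as_bounded M X V \<longleftrightarrow> (\<forall>s\<ge>0. V s \<in> bounded_ops M X X) \<and>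
     (\<forall>l>0. \<Squnion>\<^bsub>L0bar M\<^esub>((\<lambda>s. opnorm M X X (V s)) ` {0..l}) \<in> to_L0bar M ` L0_plus M)"


section \<open>\<open>C\<close>-semigroups and existence families\<close>

definition C_semigroup ::
  "'w measure \<Rightarrow> ('w, 'k::{real_normed_field,second_countable_topology}, 'x) rn_module \<Rightarrow>
   ('x \<Rightarrow> 'x) \<Rightarrow> (real \<Rightarrow> 'x \<Rightarrow> 'x) \<Rightarrow> bool" where
  "C_semigroup M X C V \<longleftrightarrow>
     C \<in> bounded_ops M X X \<and> inj_on C (carrier X) \<and>
     (\<forall>s\<ge>0. V s \<in> bounded_ops M X X) \<and>
     (\<forall>z\<in>carrier X. continuous_on_halfline M X (\<lambda>s. V s z)) \<and>
     (\<forall>z\<in>carrier X. V 0 z = C z) \<and>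
     (\<forall>s\<ge>0. \<forall>t\<ge>0. \<forall>z\<in>carrier X. C (V (s + t) z) = V s (V t z))"

definition generator_limit ::
  "'w measure \<Rightarrow> ('w, 'k::{real_normed_field,second_countable_topology}, 'x) rn_module \<Rightarrow>
   ('x \<Rightarrow> 'x) \<Rightarrow> (real \<Rightarrow> 'x \<Rightarrow> 'x) \<Rightarrow> 'x \<Rightarrow> 'x \<Rightarrow> bool" where
  "generator_limit M X C V z y \<longleftrightarrow>
     limitin (el_topology M X) (\<lambda>s. rscale M X (1 / s) (V s z \<ominus>\<^bsub>X\<^esub> C z)) y (at_right 0)"

definition generator_dom ::
  "'w measure \<Rightarrow> ('w, 'k::{real_normed_field,second_countable_topology}, 'x) rn_module \<Rightarrow>
   ('x \<Rightarrow> 'x) \<Rightarrow> (real \<Rightarrow> 'x \<Rightarrow> 'x) \<Rightarrow> 'x set" where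
  "generator_dom M X C V = {z \<in> carrier X. \<exists>y. generator_limit M X C V z y \<and> y \<in> C ` carrier X}"

definition generator ::
  "'w measure \<Rightarrow> ('w, 'k::{real_normed_field,second_countable_topology}, 'x) rn_module \<Rightarrow>
   ('x \<Rightarrow> 'x) \<Rightarrow> (real \<Rightarrow> 'x \<Rightarrow> 'x) \<Rightarrow> 'x \<Rightarrow> 'x" where
  "generator M X C V z = the_inv_into (carrier X) C (THE y. generator_limit M X C V z y)"

text \<open>\<open>[D(A)]\<close>\<close>

definition graph_module ::
  "'w measure \<Rightarrow> ('w, 'k, 'x) rn_module \<Rightarrow> ('x \<Rightarrow> 'x) \<Rightarrow> 'x set \<Rightarrow> ('w, 'k, 'x) rn_module" where
  "graph_module M X A D =
     X\<lparr>carrier := D, lnorm := (\<lambda>z. lnorm X z \<oplus>\<^bsub>L0 M\<^esub> lnorm X (A z))\<rparr>"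

text \<open>Here and in \<open>mild_solution\<close>, membership of an integral in \<open>D(A)\<close> includes its existence.\<close>

definition mild_C_existence_family ::
  "'w measure \<Rightarrow> ('w, 'k::{real_normed_field,second_countable_topology}, 'x) rn_module \<Rightarrow>
   ('x \<Rightarrow> 'x) \<Rightarrow> ('x \<Rightarrow> 'x) \<Rightarrow> 'x set \<Rightarrow> (real \<Rightarrow> 'x \<Rightarrow> 'x) \<Rightarrow> bool" where
  "mild_C_existence_family M X C A D V \<longleftrightarrow>
     locally_as_bounded M X V \<and>
     (\<forall>z\<in>carrier X. continuous_on_halfline M X (\<lambda>s. V s z)) \<and>
     (\<forall>z\<in>carrier X. \<forall>s\<ge>0. \<exists>I. has_riemann_integral M X (\<lambda>u. V u z) I 0 s \<and>
        I \<in> D \<and> A I = V s z \<ominus>\<^bsub>X\<^esub> C z)"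

definition C_existence_family ::
  "'w measure \<Rightarrow> ('w, 'k::{real_normed_field,second_countable_topology}, 'x) rn_module \<Rightarrow>
   ('x \<Rightarrow> 'x) \<Rightarrow> ('x \<Rightarrow> 'x) \<Rightarrow> 'x set \<Rightarrow> (real \<Rightarrow> 'x \<Rightarrow> 'x) \<Rightarrow> bool" where
  "C_existence_family M X C A D V \<longleftrightarrow>
     locally_as_bounded M (graph_module M X A D) V \<and>
     (\<forall>z\<in>D. continuous_on_halfline M (graph_module M X A D) (\<lambda>s. V s z)) \<and>
     (\<forall>z\<in>D. \<forall>s\<ge>0. has_riemann_integral M X (\<lambda>u. A (V u z)) (V s z \<ominus>\<^bsub>X\<^esub> C z) 0 s)"

definition strong_C_existence_family ::
  "'w measure \<Rightarrow> ('w, 'k::{real_normed_field,second_countable_topology}, 'x) rn_module \<Rightarrow>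
   ('x \<Rightarrow> 'x) \<Rightarrow> ('x \<Rightarrow> 'x) \<Rightarrow> 'x set \<Rightarrow> (real \<Rightarrow> 'x \<Rightarrow> 'x) \<Rightarrow> bool" where
  "strong_C_existence_family M X C A D V \<longleftrightarrow>
     mild_C_existence_family M X C A D V \<and>
     C_existence_family M X C A D (\<lambda>s. restrict (V s) D)"


section \<open>The abstract Cauchy problem\<close>

definition acp_solution ::
  "'w measure \<Rightarrow> ('w, 'k::{real_normed_field,second_countable_topology}, 'x) rn_module \<Rightarrow>
   ('x \<Rightarrow> 'x) \<Rightarrow> 'x set \<Rightarrow> 'x \<Rightarrow> (real \<Rightarrow> 'x) \<Rightarrow> bool" where
  "acp_solution M X A D z W \<longleftrightarrow>
     continuous_on_halfline M (graph_module M X A D) W \<and> C1_halfline M X W \<and>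
     (\<forall>s>0. has_derivative_halfline M X W (A (W s)) s) \<and> W 0 = z"

definition mild_solution ::
  "'w measure \<Rightarrow> ('w, 'k::{real_normed_field,second_countable_topology}, 'x) rn_module \<Rightarrow>
   ('x \<Rightarrow> 'x) \<Rightarrow> 'x set \<Rightarrow> 'x \<Rightarrow> (real \<Rightarrow> 'x) \<Rightarrow> bool" where
  "mild_solution M X A D z W \<longleftrightarrow>
     continuous_on_halfline M X W \<and>
     (\<forall>s\<ge>0. \<Squnion>\<^bsub>L0bar M\<^esub>((\<lambda>u. to_L0bar M (lnorm X (W u))) ` {0..s}) \<in> to_L0bar M ` L0_plus M) \<and>
     (\<forall>s\<ge>0. \<exists>I. has_riemann_integral M X W I 0 s \<and> I \<in> D \<and> W s = A I \<oplus>\<^bsub>X\<^esub> z)"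

end

theory Submission
  imports Defs
begin

text \<open>
  Convergence in probability is measured by \<open>tmean \<rho> x = E(min 1 (\<rho> \<parallel>x\<parallel>))\<close>, where the positive weight
  \<open>\<rho>\<close> may be chosen freely. If \<open>\<rho>\<close> is the reciprocal of an \<open>L\<^sup>0\<close>-bound of the vectors involved, the
  truncation is not active and \<open>tmean \<rho>\<close> is homogeneous, so that estimates in Banach spaces carry over.
  In particular an \<open>L\<^sup>0\<close>-Lipschitz function \<open>\<phi>\<close> with derivative zero is constant, because
  \<open>u \<mapsto> tmean \<rho> (\<phi> u - \<phi> 0)\<close> is a real function with derivative zero, and a continuous locally
  a.s. bounded function has Riemann integrals, which form an \<open>L\<^sup>0\<close>-Lipschitz primitive.

  For a \<open>C\<close>-semigroup \<open>T\<close> let \<open>S s z = \<integral>\<^sub>0\<^sup>s T u z du\<close>. Uniqueness of primitives gives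
  \<open>T h (S s z) = C (S (s + h) z - S h z)\<close>, hence \<open>A (S s z) = T s z - C z\<close> and, for \<open>z \<in> D(A)\<close>,
  \<open>S s (A z) = T s z - C z\<close>. If \<open>U\<close> is an \<open>L\<^sup>0\<close>-Lipschitz solution with initial value zero, then
  \<open>u \<mapsto> T (s - u) (U u)\<close> is \<open>L\<^sup>0\<close>-Lipschitz with derivative zero, so \<open>C (U s) = 0\<close>. The integral of
  the difference of two mild solutions is such a \<open>U\<close>.
\<close>

section \<open>Equivalence classes and truncated means\<close>

text \<open>The space is in general not locally convex, and two facts used in Banach spaces fail. A
  function with derivative zero need not be constant: over \<open>[0,1]\<close> with Lebesgue
  measure, the difference quotients of the map from \<open>u\<close> to the indicator of
  \<open>[0,u]\<close> live on sets of measure \<open>\<bar>t - u\<bar>\<close>, so they tend to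
  zero in probability. A continuous function on a compact interval need not be bounded by one random
  variable, and then its Riemann sums are out of control. An L0-Lipschitz constant removes the first
  defect, local a.s. boundedness the second; this is where these hypotheses enter. Fubini and
  substitution are replaced by uniqueness of Lipschitz primitives: two expressions agree once both
  vanish at zero and have the same derivative. In the uniqueness proof nothing bounds
  \<open>A (U u)\<close> directly. It is the derivative of \<open>U\<close>, so the Lipschitz
  constant of \<open>U\<close> bounds it, and this is what makes \<open>T (s - u) (U u)\<close>
  Lipschitz in \<open>u\<close>.\<close>

lemma equiv_ae_eq: "equiv (borel_measurable M) (ae_eq M)"
proof (rule equivI)
  show "ae_eq M \<subseteq> borel_measurable M \<times> borel_measurable M" by (auto simp: ae_eq_def)
  show "refl_on (borel_measurable M) (ae_eq M)"
    by (auto simp: ae_eq_def refl_on_def)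
  show "sym (ae_eq M)"
    by (auto simp: ae_eq_def sym_def eq_commute)
  show "trans (ae_eq M)"
    unfolding trans_def ae_eq_def by (auto elim: AE_mp)
qed

lemma cls_in_L0_set: "f \<in> borel_measurable M \<Longrightarrow> cls M f \<in> L0_set M"
  unfolding cls_def L0_set_def by (rule quotientI)

lemma rep_in: assumes "a \<in> L0_set M" shows "rep a \<in> a"
proof -
  obtain f where "f \<in> borel_measurable M" "a = ae_eq M `` {f}"
    using assms unfolding L0_set_def by (auto elim: quotientE)
  then have "f \<in> a" by (auto simp: ae_eq_def)
  then show ?thesis unfolding rep_def by (rule someI[of "\<lambda>f. f \<in> a"])
qed

lemma rep_measurable: assumes "a \<in> L0_set M" shows "rep a \<in> borel_measurable M"
proof -
  have "a \<subseteq> borel_measurable M"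
    using assms unfolding L0_set_def ae_eq_def by (auto elim!: quotientE)
  then show ?thesis using rep_in[OF assms] by auto
qed

lemma cls_rep: assumes "a \<in> L0_set M" shows "cls M (rep a) = a"
proof -
  obtain f where f: "f \<in> borel_measurable M" "a = ae_eq M `` {f}"
    using assms unfolding L0_set_def by (auto elim: quotientE)
  then have "(f, rep a) \<in> ae_eq M" using rep_in[OF assms] by auto
  then show ?thesis unfolding cls_def f(2)
    using equiv_class_eq[OF equiv_ae_eq] by (metis f(2))
qed

lemma cls_cong:
  assumes "f \<in> borel_measurable M" "g \<in> borel_measurable M" "AE w in M. f w = g w"
  shows "cls M f = cls M g"
  unfolding cls_def by (rule equiv_class_eq[OF equiv_ae_eq]) (use assms in \<open>auto simp: ae_eq_def\<close>)

lemma rep_cls: assumes "f \<in> borel_measurable M" shows "AE w in M. rep (cls M f) w = f w"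
proof -
  have "rep (cls M f) \<in> cls M f" by (rule rep_in[OF cls_in_L0_set[OF assms]])
  then show ?thesis by (auto simp: cls_def ae_eq_def eq_commute)
qed

text \<open>Strict positivity at every point, not only almost everywhere, lets weights be inverted
  and cancelled without null sets. Lipschitz constants and operator bounds are carried as weights
  too, so that their reciprocals can normalize.\<close>

definition weight :: "'w measure \<Rightarrow> ('w \<Rightarrow> real) \<Rightarrow> bool" where
  "weight M \<rho> \<longleftrightarrow> \<rho> \<in> borel_measurable M \<and> (\<forall>w. 0 < \<rho> w)"

lemma weight_one [simp]: "weight M (\<lambda>_. 1)"
  by (simp add: weight_def)

lemma weight_measurable [measurable_dest]: "weight M \<rho> \<Longrightarrow> \<rho> \<in> borel_measurable M"
  by (simp add: weight_def)

lemma weight_pos: "weight M \<rho> \<Longrightarrow> 0 < \<rho> w"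
  by (simp add: weight_def)

lemma weight_mult: "weight M v \<Longrightarrow> weight M \<rho> \<Longrightarrow> weight M (\<lambda>w. v w * \<rho> w)"
  by (auto simp: weight_def)

lemma weight_add: "weight M v \<Longrightarrow> weight M \<rho> \<Longrightarrow> weight M (\<lambda>w. v w + \<rho> w)"
  by (auto simp: weight_def intro: add_pos_pos)

lemma weight_inverse: "weight M \<rho> \<Longrightarrow> weight M (\<lambda>w. 1 / \<rho> w)"
  by (auto simp: weight_def)

lemma weight_abs: "f \<in> borel_measurable M \<Longrightarrow> weight M (\<lambda>w. 1 + \<bar>f w\<bar>)"
  by (auto simp: weight_def add_pos_nonneg)

definition nrm :: "('w, 'k, 'x) rn_module \<Rightarrow> 'x \<Rightarrow> 'w \<Rightarrow> real" where
  "nrm X x = rep (lnorm X x)"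

definition tmean :: "'w measure \<Rightarrow> ('w, 'k, 'x) rn_module \<Rightarrow> ('w \<Rightarrow> real) \<Rightarrow> 'x \<Rightarrow> real" where
  "tmean M X \<rho> x = (\<integral>w. min 1 (\<rho> w * nrm X x w) \<partial>M)"

lemma L0_const_closed [simp]: "L0_const M c \<in> carrier (L0 M)"
  by (simp add: L0_const_def L0_def cls_in_L0_set)

lemma rep_L0_const: "AE w in M. rep (L0_const M c) w = c"
  unfolding L0_const_def by (rule rep_cls) simp

lemma L0_plus_iff: "a \<in> L0_plus M \<longleftrightarrow> a \<in> L0_set M \<and> (AE w in M. 0 \<le> rep a w)"
proof -
  have "(AE w in M. rep (L0_const M 0) w \<le> rep a w) \<longleftrightarrow> (AE w in M. 0 \<le> rep a w)"
    using rep_L0_const[of M "0::real"] by (auto elim!: AE_mp)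
  then show ?thesis by (auto simp: L0_plus_def L0_le_def)
qed

lemma rep_L0_mult:
  assumes "a \<in> L0_set M" "b \<in> L0_set M"
  shows "AE w in M. rep (a \<otimes>\<^bsub>L0 M\<^esub> b) w = rep a w * rep b w"
  unfolding L0_def using rep_cls[OF borel_measurable_times[OF rep_measurable rep_measurable, OF assms]] by simp

lemma rep_L0_add:
  assumes "a \<in> L0_set M" "b \<in> L0_set M"
  shows "AE w in M. rep (a \<oplus>\<^bsub>L0 M\<^esub> b) w = rep a w + rep b w"
  unfolding L0_def using rep_cls[OF borel_measurable_add[OF rep_measurable rep_measurable, OF assms]] by simp

lemma L0_add_closed:
  assumes "a \<in> L0_set M" "b \<in> L0_set M"
  shows "a \<oplus>\<^bsub>L0 M\<^esub> b \<in> L0_set M"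
  unfolding L0_def using cls_in_L0_set[OF borel_measurable_add[OF rep_measurable rep_measurable, OF assms]] by simp

lemma L0_const_add: "L0_const M (a + b) = L0_const M a \<oplus>\<^bsub>L0 M\<^esub> L0_const M b"
proof -
  have "AE w in M. a + b = rep (L0_const M a) w + rep (L0_const M b) w"
    using rep_L0_const[of M a] rep_L0_const[of M b] by eventually_elim simp
  then show ?thesis
    unfolding L0_def L0_const_def
    using cls_cong[OF borel_measurable_const borel_measurable_add[OF rep_measurable rep_measurable, OF cls_in_L0_set cls_in_L0_set, OF borel_measurable_const borel_measurable_const]] by simp
qed

lemma L0_const_mult: "L0_const M (a * b) = L0_const M a \<otimes>\<^bsub>L0 M\<^esub> L0_const M b"
proof -
  have "AE w in M. a * b = rep (L0_const M a) w * rep (L0_const M b) w"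
    using rep_L0_const[of M a] rep_L0_const[of M b] by eventually_elim simp
  then show ?thesis
    unfolding L0_def L0_const_def
    using cls_cong[OF borel_measurable_const borel_measurable_times[OF rep_measurable rep_measurable, OF cls_in_L0_set cls_in_L0_set, OF borel_measurable_const borel_measurable_const]] by simp
qed

lemma L0_const_1: "L0_const M 1 = \<one>\<^bsub>L0 M\<^esub>" by (simp add: L0_const_def L0_def)
lemma L0_const_0: "L0_const M 0 = \<zero>\<^bsub>L0 M\<^esub>" by (simp add: L0_const_def L0_def)

context RN_module
begin

abbreviation vadd (infixl "+\<^sub>X" 65) where "x +\<^sub>X y \<equiv> x \<oplus>\<^bsub>X\<^esub> y"
abbreviation vminus (infixl "-\<^sub>X" 65) where "x -\<^sub>X y \<equiv> x \<ominus>\<^bsub>X\<^esub> y"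
abbreviation vscale (infixr "*\<^sub>X" 75) where "r *\<^sub>X x \<equiv> rscale M X r x"
abbreviation vzero ("0\<^sub>X") where "0\<^sub>X \<equiv> \<zero>\<^bsub>X\<^esub>"
abbreviation "V \<equiv> carrier X"
abbreviation "N \<equiv> nrm X"
abbreviation "d \<equiv> tmean M X"

abbreviation "d1 \<equiv> d (\<lambda>_. 1)"
abbreviation "rsum f p \<equiv> \<Oplus>\<^bsub>X\<^esub>tK\<in>p. measure lborel (snd tK) *\<^sub>X f (fst tK)"
abbreviation "has_deriv \<equiv> has_derivative_halfline M X"
abbreviation "cont\<^sub>X \<equiv> continuous_on_halfline M X"
abbreviation "has_rint \<equiv> has_riemann_integral M X"
abbreviation "ops \<equiv> bounded_ops M X X"
abbreviation "graph\<^sub>X A D \<equiv> graph_module M X A D"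
abbreviation csmult (infixr "\<odot>\<^sub>X" 75) where "c \<odot>\<^sub>X x \<equiv> L0_const M c \<odot>\<^bsub>X\<^esub> x"

lemma vminus_closed [simp, intro]: "x \<in> V \<Longrightarrow> y \<in> V \<Longrightarrow> x -\<^sub>X y \<in> V"
  by simp

lemma rscale_closed [simp, intro]: "x \<in> V \<Longrightarrow> r *\<^sub>X x \<in> V"
  by (simp add: rscale_def)

lemma rscale_add_left: "x \<in> V \<Longrightarrow> (r + s) *\<^sub>X x = r *\<^sub>X x +\<^sub>X s *\<^sub>X x"
  by (simp add: rscale_def L0_const_add smult_l_distr)

lemma rscale_add: "x \<in> V \<Longrightarrow> y \<in> V \<Longrightarrow> r *\<^sub>X (x +\<^sub>X y) = r *\<^sub>X x +\<^sub>X r *\<^sub>X y"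
  by (simp add: rscale_def smult_r_distr)

lemma rscale_rscale: "x \<in> V \<Longrightarrow> r *\<^sub>X s *\<^sub>X x = (r * s) *\<^sub>X x"
  by (simp add: rscale_def L0_const_mult smult_assoc1)

lemma rscale_one [simp]: "x \<in> V \<Longrightarrow> 1 *\<^sub>X x = x"
  by (simp add: rscale_def L0_const_1)

lemma rscale_0 [simp]: "x \<in> V \<Longrightarrow> 0 *\<^sub>X x = 0\<^sub>X"
  by (simp add: rscale_def L0_const_0)

lemma rscale_zero [simp]: "r *\<^sub>X 0\<^sub>X = 0\<^sub>X"
  by (simp add: rscale_def)

lemma rscale_uminus_left: "x \<in> V \<Longrightarrow> (- r) *\<^sub>X x = \<ominus>\<^bsub>X\<^esub> (r *\<^sub>X x)"
  using rscale_add_left[of x "-r" r] by (intro M.minus_equality[symmetric]) auto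

lemma rscale_uminus: "x \<in> V \<Longrightarrow> r *\<^sub>X (\<ominus>\<^bsub>X\<^esub> x) = \<ominus>\<^bsub>X\<^esub> (r *\<^sub>X x)"
  by (simp add: rscale_def smult_r_minus)

lemma rscale_diff: "x \<in> V \<Longrightarrow> y \<in> V \<Longrightarrow> r *\<^sub>X (x -\<^sub>X y) = r *\<^sub>X x -\<^sub>X r *\<^sub>X y"
  by (simp add: a_minus_def rscale_add rscale_uminus)

lemma rscale_diff_left: "x \<in> V \<Longrightarrow> (r - s) *\<^sub>X x = r *\<^sub>X x -\<^sub>X s *\<^sub>X x"
  using rscale_add_left[of x r "-s"] by (simp add: a_minus_def rscale_uminus_left)

lemma lnorm_L0: "x \<in> V \<Longrightarrow> lnorm X x \<in> L0_set M"
  using lnorm_closed by (auto simp: L0_plus_def)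

lemma nrm_measurable [measurable (raw)]: "x \<in> V \<Longrightarrow> N x \<in> borel_measurable M"
  by (simp add: nrm_def rep_measurable lnorm_L0)

lemma nrm_nonneg: "x \<in> V \<Longrightarrow> AE w in M. 0 \<le> N x w"
  using lnorm_closed by (simp add: nrm_def L0_plus_iff)

lemma nrm_triangle:
  assumes "x \<in> V" "y \<in> V" shows "AE w in M. N (x +\<^sub>X y) w \<le> N x w + N y w"
  using lnorm_triangle[OF assms] rep_L0_add[OF lnorm_L0 lnorm_L0, OF assms]
  unfolding L0_le_def nrm_def by eventually_elim simp

lemma nrm_const_smult:
  assumes "x \<in> V" shows "AE w in M. N (c \<odot>\<^sub>X x) w = norm c * N x w"
proof -
  have [measurable]: "rep (L0_const M c) \<in> borel_measurable M"
    by (simp add: L0_const_def rep_measurable cls_in_L0_set)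
  have *: "L0_abs M (L0_const M c) \<in> L0_set M"
    unfolding L0_abs_def by (intro cls_in_L0_set) measurable
  have "AE w in M. rep (L0_abs M (L0_const M c)) w = norm (rep (L0_const M c) w)"
    unfolding L0_abs_def by (rule rep_cls) measurable
  with rep_L0_const[of M c] rep_L0_mult[OF * lnorm_L0[OF assms]]
  show ?thesis unfolding nrm_def lnorm_smult[OF L0_const_closed assms] by eventually_elim simp
qed

lemma nrm_rscale: "x \<in> V \<Longrightarrow> AE w in M. N (r *\<^sub>X x) w = \<bar>r\<bar> * N x w"
  unfolding rscale_def using nrm_const_smult[of x "of_real r"] by simp

lemma nrm_uminus: "x \<in> V \<Longrightarrow> AE w in M. N (\<ominus>\<^bsub>X\<^esub> x) w = N x w"
  using nrm_rscale[of x "-1"] by (simp add: rscale_uminus_left)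

lemma nrm_zero: "AE w in M. N 0\<^sub>X w = 0"
  using nrm_rscale[of "0\<^sub>X" 0] by simp

lemma nrm_zero_imp:
  assumes "x \<in> V" "AE w in M. N x w = 0" shows "x = 0\<^sub>X"
proof (rule lnorm_zero_imp[OF assms(1)])
  have "cls M (rep (lnorm X x)) = cls M (\<lambda>_. 0)"
    by (rule cls_cong) (use assms in \<open>auto simp: nrm_def rep_measurable lnorm_L0\<close>)
  then show "lnorm X x = \<zero>\<^bsub>L0 M\<^esub>"
    using cls_rep[OF lnorm_L0[OF assms(1)]] by (simp add: L0_def)
qed

lemma nrm_diff:
  assumes "x \<in> V" "y \<in> V" shows "AE w in M. N (x -\<^sub>X y) w \<le> N x w + N y w"
  using nrm_triangle[OF assms(1), of "\<ominus>\<^bsub>X\<^esub> y"] nrm_uminus[OF assms(2)] assms(2)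
  unfolding a_minus_def by (auto elim!: AE_mp)

section \<open>Weighted truncated means\<close>

lemma tmean_integrable:
  assumes "weight M \<rho>" "x \<in> V" shows "integrable M (\<lambda>w. min 1 (\<rho> w * N x w))"
proof (rule integrable_const_bound[where B=1])
  show "AE w in M. norm (min 1 (\<rho> w * N x w)) \<le> 1"
    using nrm_nonneg[OF assms(2)]
  proof eventually_elim
    case (elim w) then have "0 \<le> \<rho> w * N x w" using weight_pos[OF assms(1), of w] by simp
    then show ?case by simp
  qed
qed (use assms in measurable)

lemma tmean_nonneg:
  assumes "weight M \<rho>" "x \<in> V" shows "0 \<le> d \<rho> x"
  unfolding tmean_def
proof (rule integral_nonneg_AE)
  show "AE w in M. 0 \<le> min 1 (\<rho> w * N x w)"
    using nrm_nonneg[OF assms(2)]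
    by eventually_elim (use weight_pos[OF assms(1)] in \<open>auto intro!: mult_nonneg_nonneg simp: less_imp_le\<close>)
qed

lemma tmean_mono:
  assumes "weight M \<rho>" "x \<in> V" "weight M v" "y \<in> V" "AE w in M. \<rho> w * N x w \<le> v w * N y w"
  shows "d \<rho> x \<le> d v y"
  unfolding tmean_def
  by (rule integral_mono_AE[OF tmean_integrable tmean_integrable]) (use assms in \<open>auto elim!: AE_mp\<close>)

text \<open>Truncation at 1 is subadditive on nonnegative numbers.\<close>

lemma tmean_triangle:
  assumes "weight M \<rho>" "x \<in> V" "y \<in> V" shows "d \<rho> (x +\<^sub>X y) \<le> d \<rho> x + d \<rho> y"
proof -
  have "d \<rho> (x +\<^sub>X y) \<le> (\<integral>w. min 1 (\<rho> w * N x w) + min 1 (\<rho> w * N y w) \<partial>M)"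
    unfolding tmean_def
  proof (rule integral_mono_AE)
    show "AE w in M. min 1 (\<rho> w * N (x +\<^sub>X y) w) \<le> min 1 (\<rho> w * N x w) + min 1 (\<rho> w * N y w)"
      using nrm_triangle[OF assms(2,3)] nrm_nonneg[OF assms(2)] nrm_nonneg[OF assms(3)]
    proof eventually_elim
      case (elim w)
      have "\<rho> w * N (x +\<^sub>X y) w \<le> \<rho> w * N x w + \<rho> w * N y w"
        using elim weight_pos[OF assms(1), of w] by (simp flip: distrib_left)
      moreover have "0 \<le> \<rho> w * N x w" "0 \<le> \<rho> w * N y w"
        using elim weight_pos[OF assms(1), of w] by auto
      ultimately show ?case by (simp add: min_def)
    qed
  qed (use assms in \<open>auto intro!: tmean_integrable Bochner_Integration.integrable_add\<close>)
  also have "\<dots> = d \<rho> x + d \<rho> y"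
    unfolding tmean_def by (rule Bochner_Integration.integral_add) (use assms tmean_integrable in auto)
  finally show ?thesis .
qed

lemma tmean_uminus:
  assumes "weight M \<rho>" "x \<in> V" shows "d \<rho> (\<ominus>\<^bsub>X\<^esub> x) = d \<rho> x"
  by (rule antisym; rule tmean_mono) (use assms nrm_uminus[OF assms(2)] in \<open>auto elim!: AE_mp\<close>)

lemma tmean_commute:
  assumes "weight M \<rho>" "x \<in> V" "y \<in> V" shows "d \<rho> (x -\<^sub>X y) = d \<rho> (y -\<^sub>X x)"
proof -
  have "\<ominus>\<^bsub>X\<^esub> (y -\<^sub>X x) = x -\<^sub>X y"
    using assms by (simp add: a_minus_def M.minus_add M.a_comm)
  then show ?thesis using tmean_uminus[of \<rho> "y -\<^sub>X x"] assms by simp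
qed

lemma diff_trans:
  assumes "x \<in> V" "y \<in> V" "z \<in> V" shows "x -\<^sub>X z = (x -\<^sub>X y) +\<^sub>X (y -\<^sub>X z)"
  using assms by (simp add: a_minus_def M.a_assoc M.r_neg1 M.r_neg2)

lemma tmean_diff_triangle:
  assumes "weight M \<rho>" "x \<in> V" "y \<in> V" "z \<in> V" shows "d \<rho> (x -\<^sub>X z) \<le> d \<rho> (x -\<^sub>X y) + d \<rho> (y -\<^sub>X z)"
  using tmean_triangle[OF assms(1), of "x -\<^sub>X y" "y -\<^sub>X z"] assms by (simp flip: diff_trans)

lemma tmean_abs_diff:
  assumes "weight M \<rho>" "x \<in> V" "y \<in> V" shows "\<bar>d \<rho> x - d \<rho> y\<bar> \<le> d \<rho> (x -\<^sub>X y)"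
proof -
  have x: "x = (x -\<^sub>X y) +\<^sub>X y" and y: "y = (y -\<^sub>X x) +\<^sub>X x"
    using assms by (simp_all add: a_minus_def M.a_assoc M.l_neg)
  have "d \<rho> x \<le> d \<rho> (x -\<^sub>X y) + d \<rho> y" by (subst (1) x, rule tmean_triangle) (use assms in auto)
  moreover have "d \<rho> y \<le> d \<rho> (y -\<^sub>X x) + d \<rho> x" by (subst (1) y, rule tmean_triangle) (use assms in auto)
  ultimately show ?thesis using tmean_commute[OF assms] by linarith
qed

lemma tmean_zero [simp]: "weight M \<rho> \<Longrightarrow> d \<rho> 0\<^sub>X = 0"
proof -
  assume \<rho>: "weight M \<rho>"
  have "d \<rho> 0\<^sub>X = (\<integral>w. 0 \<partial>M)"
    unfolding tmean_def by (rule integral_cong_AE) (use \<rho> nrm_zero in \<open>auto elim!: AE_mp\<close>)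
  then show ?thesis by simp
qed

lemma tmean_self [simp]: "weight M \<rho> \<Longrightarrow> x \<in> V \<Longrightarrow> d \<rho> (x -\<^sub>X x) = 0"
  by (simp add: a_minus_def M.r_neg)

lemma tmean_eq_0_imp:
  assumes "weight M \<rho>" "x \<in> V" "d \<rho> x = 0" shows "x = 0\<^sub>X"
proof (rule nrm_zero_imp[OF assms(2)])
  have nn: "AE w in M. 0 \<le> min 1 (\<rho> w * N x w)"
    using nrm_nonneg[OF assms(2)]
    by eventually_elim (use weight_pos[OF assms(1)] in \<open>auto intro!: mult_nonneg_nonneg simp: less_imp_le\<close>)
  have "AE w in M. min 1 (\<rho> w * N x w) = 0"
    using integral_nonneg_eq_0_iff_AE[OF tmean_integrable nn] assms by (simp add: tmean_def)
  then show "AE w in M. N x w = 0"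
  proof eventually_elim
    case (elim w) then have "\<rho> w * N x w = 0" by (simp add: min_def split: if_splits)
    then show ?case using weight_pos[OF assms(1), of w] by simp
  qed
qed

lemma diff_add_cancel: "x \<in> V \<Longrightarrow> y \<in> V \<Longrightarrow> (x -\<^sub>X y) +\<^sub>X y = x"
  by (simp add: a_minus_def M.a_assoc M.l_neg)

lemma diff_eq_zero_iff: "x \<in> V \<Longrightarrow> y \<in> V \<Longrightarrow> x -\<^sub>X y = 0\<^sub>X \<longleftrightarrow> x = y"
  using diff_add_cancel[of x y] by (auto simp: a_minus_def M.r_neg)

lemma tmean_eq_0_imp_eq: "weight M \<rho> \<Longrightarrow> x \<in> V \<Longrightarrow> y \<in> V \<Longrightarrow> d \<rho> (x -\<^sub>X y) = 0 \<Longrightarrow> x = y"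
  using tmean_eq_0_imp[of \<rho> "x -\<^sub>X y"] diff_eq_zero_iff by auto

text \<open>On the set where \<open>R * v < \<rho>\<close> the integrand is at most 1. Off it,
  \<open>\<rho>\<close> is at most \<open>R * v\<close>, and
  \<open>min 1 (R * t) \<le> R * min 1 t\<close> holds because \<open>R\<close> is at least
  1.\<close>

lemma tmean_change:
  assumes "weight M \<rho>" "weight M v" "x \<in> V" "1 \<le> R"
  shows "d \<rho> x \<le> measure M {w \<in> space M. R * v w < \<rho> w} + R * d v x"
proof -
  let ?A = "{w \<in> space M. R * v w < \<rho> w}"
  have [measurable]: "?A \<in> sets M" using assms by measurable
  have int: "integrable M (\<lambda>w. indicator ?A w :: real)" by (simp add: emeasure_eq_measure)
  have "d \<rho> x \<le> (\<integral>w. indicator ?A w + R * min 1 (v w * N x w) \<partial>M)"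
    unfolding tmean_def
  proof (rule integral_mono_AE)
    show "AE w in M. min 1 (\<rho> w * N x w) \<le> indicator ?A w + R * min 1 (v w * N x w)"
      using nrm_nonneg[OF assms(3)] AE_space
    proof eventually_elim
      case (elim w)
      have v: "0 \<le> v w * N x w" using elim weight_pos[OF assms(2), of w] by simp
      show ?case
      proof (cases "w \<in> ?A")
        case True
        have "0 \<le> R * min 1 (v w * N x w)" using v assms(4) by simp
        then show ?thesis using True by simp
      next
        case False
        then have "\<rho> w \<le> R * v w" using elim by auto
        then have "\<rho> w * N x w \<le> R * (v w * N x w)" using elim by (metis mult.assoc mult_right_mono)
        then show ?thesis using False assms(4) by (auto simp: min_def)
      qed
    qed
  qed (use assms int in \<open>auto intro!: tmean_integrable Bochner_Integration.integrable_add\<close>)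
  also have "\<dots> = measure M ?A + R * d v x"
    unfolding tmean_def
    by (subst Bochner_Integration.integral_add) (use assms tmean_integrable int in auto)
  finally show ?thesis .
qed

text \<open>The sets where \<open>n * v < \<rho>\<close> decrease to the empty set because
  \<open>v\<close> is positive, so a large \<open>n\<close> makes their probability small before the
  limit in \<open>i\<close> is taken. All weights therefore describe the same convergence, which is
  what leaves their choice free.\<close>

lemma tmean_weight_change:
  assumes "weight M \<rho>" "weight M v" "eventually (\<lambda>i. z i \<in> V) F" "((\<lambda>i. d v (z i)) \<longlongrightarrow> 0) F"
  shows "((\<lambda>i. d \<rho> (z i)) \<longlongrightarrow> 0) F"
proof (rule tendstoI)
  fix e :: real assume e: "0 < e"
  have [measurable]: "\<rho> \<in> borel_measurable M" "v \<in> borel_measurable M" using assms by (auto simp: weight_def)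
  let ?A = "\<lambda>n::nat. {w \<in> space M. real n * v w < \<rho> w}"
  have "(\<lambda>n. measure M (?A n)) \<longlonglongrightarrow> measure M (\<Inter>n. ?A n)"
  proof (rule finite_Lim_measure_decseq)
    have "?A n \<in> sets M" for n by measurable
    then show "range ?A \<subseteq> sets M" by blast
    show "decseq ?A"
    proof (rule decseq_SucI)
      fix n show "?A (Suc n) \<subseteq> ?A n"
      proof
        fix w assume "w \<in> ?A (Suc n)"
        then have "w \<in> space M" "real (Suc n) * v w < \<rho> w" by auto
        moreover have "real n * v w \<le> real (Suc n) * v w"
          using weight_pos[OF assms(2), of w] by (intro mult_right_mono) auto
        ultimately show "w \<in> ?A n" by auto
      qed
    qed
  qed
  moreover have "(\<Inter>n. ?A n) = {}"
  proof -
    have False if "w \<in> (\<Inter>n. ?A n)" for w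
    proof -
      obtain n :: nat where "\<rho> w / v w < real n" using reals_Archimedean2 by blast
      then have "\<rho> w < real n * v w" using weight_pos[OF assms(2), of w] by (simp add: field_simps)
      with that show False by (auto dest: spec[of _ n])
    qed
    then show ?thesis by blast
  qed
  ultimately have "(\<lambda>n. measure M (?A n)) \<longlonglongrightarrow> 0" by simp
  then have "eventually (\<lambda>n. measure M (?A n) < e/2) sequentially"
    using e by (intro order_tendstoD(2)) auto
  then have "eventually (\<lambda>n. measure M (?A n) < e/2 \<and> 1 \<le> n) sequentially"
    using eventually_ge_at_top by eventually_elim auto
  then obtain n where n: "measure M (?A n) < e/2" "1 \<le> n" by (auto simp: eventually_sequentially)
  have "eventually (\<lambda>i. d v (z i) < e / (2 * real n)) F"
    using assms(4) e n by (intro order_tendstoD(2)) auto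
  with assms(3) show "eventually (\<lambda>i. dist (d \<rho> (z i)) 0 < e) F"
  proof eventually_elim
    case (elim i)
    have "d \<rho> (z i) \<le> measure M (?A n) + real n * d v (z i)"
      using tmean_change[OF assms(1,2) elim(1), of "real n"] n by simp
    also have "real n * d v (z i) < e/2" using elim(2) n by (simp add: field_simps)
    finally show ?case using n tmean_nonneg[OF assms(1) elim(1)] by simp
  qed
qed

end

section \<open>The \<open>(\<epsilon>,\<lambda>)\<close>-topology\<close>

text \<open>This lemma and the next ones on the topology assume only a probability measure and
  measurable norms, so that they apply to \<open>graph_module\<close> without a proof that it is an
  \<open>RN_module\<close>.\<close>

lemma el_nbhd_mono:
  assumes "prob_space M" "\<forall>z\<in>carrier X. lnorm X z \<in> L0_set M" "e \<le> e'" "l' \<le> l"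
  shows "el_nbhd M X e l \<subseteq> el_nbhd M X e' l'"
proof
  interpret prob_space M by fact
  fix z assume z: "z \<in> el_nbhd M X e l"
  then have [measurable]: "rep (lnorm X z) \<in> borel_measurable M"
    using assms(2) by (auto simp: el_nbhd_def rep_measurable)
  have "measure M {w \<in> space M. rep (lnorm X z) w < e} \<le> measure M {w \<in> space M. rep (lnorm X z) w < e'}"
    by (rule finite_measure_mono) (use assms in auto)
  with z assms show "z \<in> el_nbhd M X e' l'" by (auto simp: el_nbhd_def)
qed

lemma istopology_el_open:
  assumes "prob_space M" "\<forall>z\<in>carrier X. lnorm X z \<in> L0_set M"
  shows "istopology (el_open M X)"
  unfolding istopology_def
proof (intro conjI allI impI)
  fix S T assume S: "el_open M X S" and T: "el_open M X T"
  show "el_open M X (S \<inter> T)"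
    unfolding el_open_def
  proof (intro conjI ballI)
    show "S \<inter> T \<subseteq> carrier X" using S by (auto simp: el_open_def)
    fix x assume "x \<in> S \<inter> T"
    then obtain e1 l1 e2 l2 where
      1: "0 < e1" "0 < l1" "l1 < 1" "\<And>y. y \<in> carrier X \<Longrightarrow> y \<ominus>\<^bsub>X\<^esub> x \<in> el_nbhd M X e1 l1 \<Longrightarrow> y \<in> S" and
      2: "0 < e2" "0 < l2" "l2 < 1" "\<And>y. y \<in> carrier X \<Longrightarrow> y \<ominus>\<^bsub>X\<^esub> x \<in> el_nbhd M X e2 l2 \<Longrightarrow> y \<in> T"
      using S T unfolding el_open_def by (metis IntE)
    have "el_nbhd M X (min e1 e2) (max l1 l2) \<subseteq> el_nbhd M X e1 l1"
         "el_nbhd M X (min e1 e2) (max l1 l2) \<subseteq> el_nbhd M X e2 l2"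
      using el_nbhd_mono[OF assms, of "min e1 e2"] by simp_all
    then show "\<exists>e>0. \<exists>l. 0 < l \<and> l < 1 \<and>
        (\<forall>y\<in>carrier X. y \<ominus>\<^bsub>X\<^esub> x \<in> el_nbhd M X e l \<longrightarrow> y \<in> S \<inter> T)"
      using 1 2 by (intro exI[of _ "min e1 e2"] conjI exI[of _ "max l1 l2"]) auto
  qed
next
  fix K assume "\<forall>S\<in>K. el_open M X S"
  then show "el_open M X (\<Union> K)"
    unfolding el_open_def by (meson UnionE UnionI Union_least)
qed

lemma openin_el_topology:
  assumes "prob_space M" "\<forall>z\<in>carrier X. lnorm X z \<in> L0_set M"
  shows "openin (el_topology M X) = el_open M X"
  unfolding el_topology_def by (rule topology_inverse'[OF istopology_el_open[OF assms]])

lemma topspace_el_topology: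
  assumes "prob_space M" "\<forall>z\<in>carrier X. lnorm X z \<in> L0_set M"
  shows "topspace (el_topology M X) = carrier X"
proof (rule antisym)
  show "topspace (el_topology M X) \<subseteq> carrier X"
    unfolding topspace_def openin_el_topology[OF assms] by (auto simp: el_open_def)
  have "el_open M X (carrier X)"
    unfolding el_open_def by (auto intro!: exI[of _ 1] exI[of _ "1/2"])
  then show "carrier X \<subseteq> topspace (el_topology M X)"
    unfolding topspace_def openin_el_topology[OF assms] by auto
qed

text \<open>This direction needs only that an open set contains a basic neighbourhood of each of its
  points. The converse needs the triangle inequality as well and is part of
  \<open>lim_iff_one\<close>.\<close>

lemma limitin_el_topologyI:
  assumes "prob_space M" "\<forall>z\<in>carrier X. lnorm X z \<in> L0_set M"
    and "x \<in> carrier X"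
    and "\<And>e l. 0 < e \<Longrightarrow> 0 < l \<Longrightarrow> l < 1 \<Longrightarrow>
      eventually (\<lambda>i. z i \<in> carrier X \<and> z i \<ominus>\<^bsub>X\<^esub> x \<in> el_nbhd M X e l) F"
  shows "limitin (el_topology M X) z x F"
  unfolding limitin_def topspace_el_topology[OF assms(1,2)] openin_el_topology[OF assms(1,2)]
proof (intro conjI allI impI)
  show "x \<in> carrier X" by fact
  fix U assume "el_open M X U \<and> x \<in> U"
  then obtain e l where "0 < e" "0 < l" "l < 1"
    and U: "\<And>y. y \<in> carrier X \<Longrightarrow> y \<ominus>\<^bsub>X\<^esub> x \<in> el_nbhd M X e l \<Longrightarrow> y \<in> U"
    unfolding el_open_def by metis
  then have "eventually (\<lambda>i. z i \<in> carrier X \<and> z i \<ominus>\<^bsub>X\<^esub> x \<in> el_nbhd M X e l) F"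
    using assms(4) by blast
  then show "eventually (\<lambda>i. z i \<in> U) F" by eventually_elim (use U in auto)
qed

text \<open>The filter \<open>at s within S\<close> omits \<open>s\<close> itself, which is harmless
  because \<open>g s\<close> lies in every neighbourhood considered.\<close>

lemma continuous_map_top_of_set_iff:
  "continuous_map (top_of_set S) Y g \<longleftrightarrow> (\<forall>s\<in>S. limitin Y g (g s) (at s within S))"
proof
  assume g: "continuous_map (top_of_set S) Y g"
  show "\<forall>s\<in>S. limitin Y g (g s) (at s within S)"
  proof
    fix s assume s: "s \<in> S"
    show "limitin Y g (g s) (at s within S)"
      unfolding limitin_def
    proof (intro conjI allI impI)
      show "g s \<in> topspace Y" using g s by (auto simp: continuous_map_def)
      fix U assume U: "openin Y U \<and> g s \<in> U"
      then have "openin (top_of_set S) {x \<in> S. g x \<in> U}" using g by (auto simp: continuous_map_def)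
      then obtain T where T: "open T" "{x \<in> S. g x \<in> U} = S \<inter> T" by (auto simp: openin_open)
      then have "s \<in> T" "\<forall>x\<in>T. x \<noteq> s \<longrightarrow> x \<in> S \<longrightarrow> g x \<in> U" using U s by auto
      then show "eventually (\<lambda>x. g x \<in> U) (at s within S)"
        unfolding eventually_at_topological using T(1) by blast
    qed
  qed
next
  assume xlim: "\<forall>s\<in>S. limitin Y g (g s) (at s within S)"
  show "continuous_map (top_of_set S) Y g"
    unfolding continuous_map_def
  proof (intro conjI allI impI)
    show "g \<in> topspace (top_of_set S) \<rightarrow> topspace Y" using xlim by (auto dest: limitin_topspace)
    fix U assume U: "openin Y U"
    show "openin (top_of_set S) {x \<in> topspace (top_of_set S). g x \<in> U}"
    proof (subst openin_subopen, intro ballI)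
      fix s assume "s \<in> {x \<in> topspace (top_of_set S). g x \<in> U}"
      then have s: "s \<in> S" "g s \<in> U" by auto
      then have "eventually (\<lambda>x. g x \<in> U) (at s within S)" using xlim U by (auto simp: limitin_def)
      then obtain T where T: "open T" "s \<in> T" "\<forall>x\<in>T. x \<noteq> s \<longrightarrow> x \<in> S \<longrightarrow> g x \<in> U"
        unfolding eventually_at_topological by blast
      show "\<exists>T. openin (top_of_set S) T \<and> s \<in> T \<and> T \<subseteq> {x \<in> topspace (top_of_set S). g x \<in> U}"
        by (rule exI[of _ "S \<inter> T"]) (use T s in \<open>auto intro!: openin_open_Int\<close>)
    qed
  qed
qed

section \<open>The filter of tagged partitions\<close>

lemma eventually_riemann_filter:
  "eventually P (riemann_filter a b) \<longleftrightarrow>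
     (\<exists>\<delta>>0. \<forall>p. p tagged_division_of {a..b} \<and> (\<forall>(t, K)\<in>p. measure lborel K < \<delta>) \<longrightarrow> P p)"
proof -
  let ?F = "\<lambda>\<delta>. principal {p. p tagged_division_of {a..b} \<and> (\<forall>(t, K)\<in>p. measure lborel K < \<delta>)}"
  have "eventually P (riemann_filter a b) \<longleftrightarrow> (\<exists>\<delta>\<in>{0<..}. eventually P (?F \<delta>))"
    unfolding riemann_filter_def
  proof (rule eventually_INF_base)
    fix x y :: real assume "x \<in> {0<..}" "y \<in> {0<..}"
    then show "\<exists>z\<in>{0<..}. ?F z \<le> inf (?F x) (?F y)"
      by (intro bexI[of _ "min x y"]) fastforce+
  qed auto
  then show ?thesis by (auto simp: eventually_principal)
qed

text \<open>Cousin's lemma for the constant gauge of radius \<open>\<delta>/2\<close>: a cell inside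
  the open ball about its tag is shorter than \<open>\<delta>\<close>. It makes the filter proper,
  and so Riemann integrals unique.\<close>

lemma fine_tagged_division_exists:
  fixes a b \<delta> :: real assumes "0 < \<delta>"
  obtains p where "p tagged_division_of {a..b}" "\<forall>(t, K)\<in>p. measure lborel K < \<delta>"
proof -
  obtain p where p: "p tagged_division_of {a..b}" "(\<lambda>x. ball x (\<delta>/2)) fine p"
    using fine_division_exists_real[OF gauge_ball[of "\<delta>/2"]] assms by auto
  have "measure lborel K < \<delta>" if tK: "(t, K) \<in> p" for t K
  proof -
    obtain u v where K: "K = cbox u v" "t \<in> K" using tagged_division_ofD[OF p(1)] tK by metis
    then have uv: "u \<le> t" "t \<le> v" by auto
    have "K \<subseteq> ball t (\<delta>/2)" using p(2) tK by (auto simp: fine_def)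
    moreover have "u \<in> K" "v \<in> K" using K uv by auto
    ultimately have "u \<in> ball t (\<delta>/2)" "v \<in> ball t (\<delta>/2)" by blast+
    then have "v - u < \<delta>" unfolding mem_ball dist_real_def by linarith
    then show ?thesis using K uv by simp
  qed
  then show ?thesis by (intro that[OF p(1)]) blast
qed

lemma riemann_filter_neq_bot: "riemann_filter a b \<noteq> bot"
  unfolding trivial_limit_def eventually_riemann_filter
  using fine_tagged_division_exists[of _ a b] by blast

section \<open>Convergence in the topology as convergence of truncated means\<close>

context RN_module
begin

text \<open>Markov's inequality for the truncated norm at the level \<open>min e 1\<close>, the
  highest level that truncation leaves visible.\<close>

lemma nbhd_if_tmean_less:
  assumes "z \<in> V" "0 < e" "d1 z < min e 1 * (1 - l)"
  shows "z \<in> el_nbhd M X e l"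
proof -
  let ?e = "min e 1"
  let ?A = "{w \<in> space M. ?e \<le> N z w}" and ?B = "{w \<in> space M. N z w < ?e}"
  have [measurable]: "N z \<in> borel_measurable M" using assms by simp
  have int: "integrable M (\<lambda>w. indicator ?A w :: real)" by (simp add: emeasure_eq_measure)
  have "(\<integral>w. ?e * indicator ?A w \<partial>M) \<le> d1 z"
    unfolding tmean_def
  proof (rule integral_mono_AE)
    show "AE w in M. ?e * indicator ?A w \<le> min 1 (1 * N z w)"
      using nrm_nonneg[OF assms(1)] AE_space by eventually_elim (auto simp: indicator_def min_def)
  qed (use int tmean_integrable[OF weight_one assms(1)] in auto)
  then have "?e * measure M ?A < ?e * (1 - l)" using assms(3) by simp
  then have "measure M ?A < 1 - l" using assms(2) by (subst (asm) mult_less_cancel_left_pos) auto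
  moreover have "measure M ?B = 1 - measure M ?A"
    by (subst prob_compl[symmetric]) (auto intro!: arg_cong[where f="measure M"])
  ultimately have "l < measure M ?B" by simp
  also have "\<dots> \<le> measure M {w \<in> space M. N z w < e}" by (rule finite_measure_mono) auto
  finally show ?thesis using assms by (simp add: el_nbhd_def nrm_def)
qed

text \<open>The integrand is below \<open>e\<close> where the norm is, and at most 1 on the
  remaining set, whose probability is less than \<open>1 - l\<close>.\<close>

lemma tmean_le_if_nbhd:
  assumes "z \<in> el_nbhd M X e l" "0 < e"
  shows "d1 z \<le> e + (1 - l)"
proof -
  have z: "z \<in> V" using assms by (simp add: el_nbhd_def)
  then have [measurable]: "N z \<in> borel_measurable M" by simp
  let ?A = "{w \<in> space M. e \<le> N z w}" and ?B = "{w \<in> space M. N z w < e}"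
  have int: "integrable M (\<lambda>w. indicator ?A w :: real)" by (simp add: emeasure_eq_measure)
  have "d1 z \<le> (\<integral>w. e + indicator ?A w \<partial>M)"
    unfolding tmean_def
  proof (rule integral_mono_AE)
    show "AE w in M. min 1 (1 * N z w) \<le> e + indicator ?A w"
      using nrm_nonneg[OF z] AE_space by eventually_elim (use assms(2) in \<open>auto simp: indicator_def min_def\<close>)
  qed (use int tmean_integrable[OF weight_one z] in auto)
  also have "\<dots> = e + measure M ?A"
    by (subst Bochner_Integration.integral_add) (use int in \<open>auto simp: prob_space\<close>)
  also have "measure M ?A = 1 - measure M ?B"
    by (subst prob_compl[symmetric]) (auto intro!: arg_cong[where f="measure M"])
  also have "e + (1 - measure M ?B) \<le> e + (1 - l)"
    using assms(1) by (simp add: el_nbhd_def nrm_def)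
  finally show ?thesis .
qed

abbreviation xlim :: "('i \<Rightarrow> 'x) \<Rightarrow> 'x \<Rightarrow> 'i filter \<Rightarrow> bool" where "xlim \<equiv> limitin (el_topology M X)"

lemma lnorm_L0_all: "\<forall>z\<in>V. lnorm X z \<in> L0_set M"
  by (simp add: lnorm_L0)

lemma openin_X: "openin (el_topology M X) = el_open M X"
  by (rule openin_el_topology[OF prob_space_axioms lnorm_L0_all])

lemma topspace_X: "topspace (el_topology M X) = V"
  by (rule topspace_el_topology[OF prob_space_axioms lnorm_L0_all])

lemma el_open_ball:
  assumes "x \<in> V" shows "el_open M X {y \<in> V. d1 (y -\<^sub>X x) < r}"
  unfolding el_open_def
proof (intro conjI ballI)
  fix y assume "y \<in> {y \<in> V. d1 (y -\<^sub>X x) < r}"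
  then have y: "y \<in> V" "d1 (y -\<^sub>X x) < r" by auto
  \<comment> \<open>The cap at 1 keeps the level \<open>1 - \<delta>/4\<close> inside the open unit
    interval. For this neighbourhood \<open>tmean_le_if_nbhd\<close> gives a distance of at most
    \<open>\<delta>/2\<close>, strictly inside the remaining radius.\<close>
  define \<delta> where "\<delta> = min 1 (r - d1 (y -\<^sub>X x))"
  have \<delta>: "0 < \<delta>" "\<delta> \<le> 1" "\<delta> \<le> r - d1 (y -\<^sub>X x)" using y by (auto simp: \<delta>_def)
  have "u \<in> {y \<in> V. d1 (y -\<^sub>X x) < r}"
    if u: "u \<in> V" "u -\<^sub>X y \<in> el_nbhd M X (\<delta>/4) (1 - \<delta>/4)" for u
  proof -
    have "d1 (u -\<^sub>X y) \<le> \<delta>/4 + (1 - (1 - \<delta>/4))"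
      using tmean_le_if_nbhd[OF u(2)] \<delta> by simp
    moreover have "d1 (u -\<^sub>X x) \<le> d1 (u -\<^sub>X y) + d1 (y -\<^sub>X x)"
      using tmean_diff_triangle[OF weight_one u(1) y(1) assms] .
    ultimately show ?thesis using \<delta> u by simp
  qed
  then show "\<exists>e>0. \<exists>l. 0 < l \<and> l < 1 \<and>
      (\<forall>u\<in>V. u -\<^sub>X y \<in> el_nbhd M X e l \<longrightarrow> u \<in> {y \<in> V. d1 (y -\<^sub>X x) < r})"
    using \<delta> by (intro exI[of _ "\<delta>/4"] exI[of _ "1 - \<delta>/4"] conjI ballI impI) auto
qed auto

text \<open>The topology is that of the metric \<open>d1 (x -\<^sub>X y)\<close>. Eventual
  membership in \<open>V\<close> is a separate condition because the operations of the module mean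
  nothing outside its carrier.\<close>

lemma lim_iff_one:
  "xlim z x F \<longleftrightarrow> x \<in> V \<and> eventually (\<lambda>i. z i \<in> V) F \<and> ((\<lambda>i. d1 (z i -\<^sub>X x)) \<longlongrightarrow> 0) F"
proof
  assume L: "xlim z x F"
  have x: "x \<in> V" using limitin_topspace[OF L] topspace_X by simp
  have "el_open M X V" using topspace_X openin_X openin_topspace by metis
  then have ev: "eventually (\<lambda>i. z i \<in> V) F" using L x unfolding limitin_def openin_X by blast
  have "((\<lambda>i. d1 (z i -\<^sub>X x)) \<longlongrightarrow> 0) F"
  proof (rule tendstoI)
    fix e :: real assume "0 < e"
    then have "x \<in> {y \<in> V. d1 (y -\<^sub>X x) < e}" using x by simp
    then have "eventually (\<lambda>i. z i \<in> {y \<in> V. d1 (y -\<^sub>X x) < e}) F"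
      using L el_open_ball[OF x] unfolding limitin_def openin_X by blast
    then show "eventually (\<lambda>i. dist (d1 (z i -\<^sub>X x)) 0 < e) F"
      by eventually_elim (use x tmean_nonneg[OF weight_one] in auto)
  qed
  with x ev show "x \<in> V \<and> eventually (\<lambda>i. z i \<in> V) F \<and> ((\<lambda>i. d1 (z i -\<^sub>X x)) \<longlongrightarrow> 0) F" by simp
next
  assume L: "x \<in> V \<and> eventually (\<lambda>i. z i \<in> V) F \<and> ((\<lambda>i. d1 (z i -\<^sub>X x)) \<longlongrightarrow> 0) F"
  show "xlim z x F"
  proof (rule limitin_el_topologyI[OF prob_space_axioms lnorm_L0_all])
    fix e l :: real assume e: "0 < e" "0 < l" "l < 1"
    have "eventually (\<lambda>i. d1 (z i -\<^sub>X x) < min e 1 * (1 - l)) F"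
      by (rule order_tendstoD(2)) (use L e in auto)
    moreover have "eventually (\<lambda>i. z i \<in> V) F" using L by simp
    ultimately show "eventually (\<lambda>i. z i \<in> V \<and> z i -\<^sub>X x \<in> el_nbhd M X e l) F"
      by eventually_elim (use L e in \<open>auto intro!: nbhd_if_tmean_less\<close>)
  qed (use L in auto)
qed

lemma lim_iff:
  assumes "weight M \<rho>"
  shows "xlim z x F \<longleftrightarrow> x \<in> V \<and> eventually (\<lambda>i. z i \<in> V) F \<and> ((\<lambda>i. d \<rho> (z i -\<^sub>X x)) \<longlongrightarrow> 0) F"
proof -
  have ev: "eventually (\<lambda>i. z i -\<^sub>X x \<in> V) F" if "x \<in> V" "eventually (\<lambda>i. z i \<in> V) F"
    using that(2) by eventually_elim (use that(1) in simp)
  show ?thesis unfolding lim_iff_one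
    using tmean_weight_change[OF assms weight_one ev] tmean_weight_change[OF weight_one assms ev] by auto
qed

lemma lim_tmean: "weight M \<rho> \<Longrightarrow> xlim z x F \<Longrightarrow> ((\<lambda>i. d \<rho> (z i -\<^sub>X x)) \<longlongrightarrow> 0) F"
  by (simp add: lim_iff)

lemma limD: "xlim z x F \<Longrightarrow> x \<in> V" "xlim z x F \<Longrightarrow> eventually (\<lambda>i. z i \<in> V) F"
  by (simp_all add: lim_iff_one)

lemma lim_unique:
  assumes "xlim z x F" "xlim z y F" "F \<noteq> bot" shows "x = y"
proof (rule tmean_eq_0_imp_eq[OF weight_one])
  have "((\<lambda>i. d1 (z i -\<^sub>X x) + d1 (z i -\<^sub>X y)) \<longlongrightarrow> 0 + 0) F"
    using assms by (intro tendsto_add lim_tmean) auto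
  then have "((\<lambda>i. d1 (z i -\<^sub>X x) + d1 (z i -\<^sub>X y)) \<longlongrightarrow> 0) F" by simp
  moreover have "eventually (\<lambda>i. d1 (x -\<^sub>X y) \<le> d1 (z i -\<^sub>X x) + d1 (z i -\<^sub>X y)) F"
    using limD(2)[OF assms(1)]
  proof eventually_elim
    case (elim i) then show ?case
      using tmean_diff_triangle[OF weight_one, of x "z i" y] tmean_commute[OF weight_one, of x "z i"]
        limD(1)[OF assms(1)] limD(1)[OF assms(2)] by simp
  qed
  ultimately have "d1 (x -\<^sub>X y) \<le> 0" using assms(3) by (rule tendsto_lowerbound)
  then show "d1 (x -\<^sub>X y) = 0"
    using tmean_nonneg[OF weight_one, of "x -\<^sub>X y"] limD(1)[OF assms(1)] limD(1)[OF assms(2)] by simp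
qed (use limD assms in auto)

lemma lim_const: "x \<in> V \<Longrightarrow> xlim (\<lambda>_. x) x F"
  by (simp add: limitin_const_iff topspace_X)

lemma diff_zero: "x \<in> V \<Longrightarrow> x -\<^sub>X 0\<^sub>X = x"
  using M.minus_equality[of "0\<^sub>X" "0\<^sub>X"] by (simp add: a_minus_def)

lemma lim_shift:
  assumes "x \<in> V" "eventually (\<lambda>i. z i \<in> V) F"
  shows "xlim z x F \<longleftrightarrow> xlim (\<lambda>i. z i -\<^sub>X x) 0\<^sub>X F"
proof -
  have "eventually (\<lambda>i. z i -\<^sub>X x \<in> V) F" using assms(2) by eventually_elim (use assms in simp)
  moreover have "((\<lambda>i. d1 (z i -\<^sub>X x -\<^sub>X 0\<^sub>X)) \<longlongrightarrow> 0) F \<longleftrightarrow> ((\<lambda>i. d1 (z i -\<^sub>X x)) \<longlongrightarrow> 0) F"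
    by (rule tendsto_cong) (use assms in \<open>auto elim!: eventually_mono simp: diff_zero\<close>)
  ultimately show ?thesis using assms by (auto simp: lim_iff_one)
qed

lemma lim_zero_iff:
  assumes "weight M \<rho>" "eventually (\<lambda>i. z i \<in> V) F"
  shows "xlim z 0\<^sub>X F \<longleftrightarrow> ((\<lambda>i. d \<rho> (z i)) \<longlongrightarrow> 0) F"
proof -
  have "((\<lambda>i. d \<rho> (z i -\<^sub>X 0\<^sub>X)) \<longlongrightarrow> 0) F \<longleftrightarrow> ((\<lambda>i. d \<rho> (z i)) \<longlongrightarrow> 0) F"
    by (rule tendsto_cong) (use assms in \<open>auto elim!: eventually_mono simp: diff_zero\<close>)
  then show ?thesis using assms by (simp add: lim_iff[OF assms(1)])
qed

lemma add_diff_add: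
  "a \<in> V \<Longrightarrow> b \<in> V \<Longrightarrow> c \<in> V \<Longrightarrow> e \<in> V \<Longrightarrow> (a +\<^sub>X b) -\<^sub>X (c +\<^sub>X e) = (a -\<^sub>X c) +\<^sub>X (b -\<^sub>X e)"
  by (simp add: a_minus_def M.minus_add M.a_ac)

lemma lim_add:
  assumes "xlim z x F" "xlim u y F" shows "xlim (\<lambda>i. z i +\<^sub>X u i) (x +\<^sub>X y) F"
proof -
  note x = limD(1)[OF assms(1)] and y = limD(1)[OF assms(2)]
  note ev = limD(2)[OF assms(1)] limD(2)[OF assms(2)]
  have "((\<lambda>i. d1 (z i -\<^sub>X x) + d1 (u i -\<^sub>X y)) \<longlongrightarrow> 0 + 0) F"
    using assms by (intro tendsto_add lim_tmean) auto
  then have "((\<lambda>i. d1 (z i -\<^sub>X x) + d1 (u i -\<^sub>X y)) \<longlongrightarrow> 0) F" by simp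
  then have "((\<lambda>i. d1 ((z i +\<^sub>X u i) -\<^sub>X (x +\<^sub>X y))) \<longlongrightarrow> 0) F"
  proof (rule tendsto_sandwich[OF _ _ tendsto_const, rotated 2])
    show "eventually (\<lambda>i. d1 ((z i +\<^sub>X u i) -\<^sub>X (x +\<^sub>X y)) \<le> d1 (z i -\<^sub>X x) + d1 (u i -\<^sub>X y)) F"
      using ev by eventually_elim (use x y in \<open>simp add: add_diff_add tmean_triangle\<close>)
    show "eventually (\<lambda>i. 0 \<le> d1 ((z i +\<^sub>X u i) -\<^sub>X (x +\<^sub>X y))) F"
      using ev by eventually_elim (use x y in \<open>simp add: tmean_nonneg\<close>)
  qed
  moreover have "eventually (\<lambda>i. z i +\<^sub>X u i \<in> V) F" using ev by eventually_elim simp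
  ultimately show ?thesis using x y by (simp add: lim_iff_one)
qed

text \<open>The factor \<open>b\<close> turns into a weight:
  \<open>d1 (z i) \<le> d b (y i)\<close>, and the right side is null because all weights give the
  same limits.\<close>

lemma lim_dominated:
  assumes "xlim y 0\<^sub>X F" "weight M b"
    and "eventually (\<lambda>i. z i \<in> V \<and> (AE w in M. N (z i) w \<le> b w * N (y i) w)) F"
  shows "xlim z 0\<^sub>X F"
proof -
  have zV: "eventually (\<lambda>i. z i \<in> V) F" using assms(3) by eventually_elim auto
  have "((\<lambda>i. d b (y i)) \<longlongrightarrow> 0) F" using assms lim_zero_iff limD(2) by blast
  then have "((\<lambda>i. d1 (z i)) \<longlongrightarrow> 0) F"
  proof (rule tendsto_sandwich[OF _ _ tendsto_const, rotated 2])
    show "eventually (\<lambda>i. d1 (z i) \<le> d b (y i)) F"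
      using assms(3) limD(2)[OF assms(1)]
      by eventually_elim (use assms(2) in \<open>auto intro!: tmean_mono\<close>)
    show "eventually (\<lambda>i. 0 \<le> d1 (z i)) F"
      using zV by eventually_elim (simp add: tmean_nonneg)
  qed
  then show ?thesis using lim_zero_iff[OF weight_one zV] by simp
qed

lemma lim_rscale:
  assumes "xlim z x F" shows "xlim (\<lambda>i. r *\<^sub>X z i) (r *\<^sub>X x) F"
proof -
  note x = limD(1)[OF assms] and ev = limD(2)[OF assms]
  have 0: "xlim (\<lambda>i. z i -\<^sub>X x) 0\<^sub>X F" using assms lim_shift[OF x ev] by simp
  have "xlim (\<lambda>i. r *\<^sub>X z i -\<^sub>X r *\<^sub>X x) 0\<^sub>X F"
  proof (rule lim_dominated[OF 0])
    show "weight M (\<lambda>_. 1 + \<bar>r\<bar>)" by (auto simp: weight_def)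
    show "eventually (\<lambda>i. r *\<^sub>X z i -\<^sub>X r *\<^sub>X x \<in> V \<and>
        (AE w in M. N (r *\<^sub>X z i -\<^sub>X r *\<^sub>X x) w \<le> (1 + \<bar>r\<bar>) * N (z i -\<^sub>X x) w)) F"
      using ev
    proof eventually_elim
      case (elim i)
      have "AE w in M. N (r *\<^sub>X (z i -\<^sub>X x)) w \<le> (1 + \<bar>r\<bar>) * N (z i -\<^sub>X x) w"
        using nrm_rscale[of "z i -\<^sub>X x" r] nrm_nonneg[of "z i -\<^sub>X x"] elim x
        by (auto elim!: AE_mp simp: distrib_right)
      then show ?case using elim x by (simp add: rscale_diff)
    qed
  qed
  moreover have "eventually (\<lambda>i. r *\<^sub>X z i \<in> V) F" using ev by eventually_elim simp
  ultimately show ?thesis using x lim_shift[of "r *\<^sub>X x" "\<lambda>i. r *\<^sub>X z i" F] by simp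
qed

lemma lim_uminus: assumes "xlim z x F" shows "xlim (\<lambda>i. \<ominus>\<^bsub>X\<^esub> z i) (\<ominus>\<^bsub>X\<^esub> x) F"
proof (rule limitin_transform_eventually)
  show "eventually (\<lambda>i. (-1) *\<^sub>X z i = \<ominus>\<^bsub>X\<^esub> z i) F"
    using limD(2)[OF assms] by eventually_elim (simp add: rscale_uminus_left)
  show "xlim (\<lambda>i. (-1) *\<^sub>X z i) (\<ominus>\<^bsub>X\<^esub> x) F"
    using lim_rscale[OF assms, of "-1"] limD(1)[OF assms] by (simp add: rscale_uminus_left)
qed

lemma lim_diff:
  assumes "xlim z x F" "xlim u y F" shows "xlim (\<lambda>i. z i -\<^sub>X u i) (x -\<^sub>X y) F"
  unfolding a_minus_def using assms by (intro lim_add lim_uminus)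

text \<open>The truncated positive part of \<open>N x - g\<close> is dominated by the truncated norm
  of \<open>x -\<^sub>X z i\<close>, so its integral is zero. This avoids almost surely convergent
  subsequences, which a general filter does not provide.\<close>

lemma nrm_lim_le:
  assumes "xlim z x F" "F \<noteq> bot" "g \<in> borel_measurable M"
    and "eventually (\<lambda>i. AE w in M. N (z i) w \<le> g w) F"
  shows "AE w in M. N x w \<le> g w"
proof -
  note x = limD(1)[OF assms(1)]
  have [measurable]: "N x \<in> borel_measurable M" using x by simp
  note assms(3)[measurable]
  let ?h = "\<lambda>w. min 1 (max 0 (N x w - g w))"
  have int: "integrable M ?h" by (rule integrable_const_bound[where B=1]) auto
  have "eventually (\<lambda>i. (\<integral>w. ?h w \<partial>M) \<le> d1 (z i -\<^sub>X x)) F"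
    using assms(4) limD(2)[OF assms(1)]
  proof eventually_elim
    case (elim i)
    have "(\<integral>w. ?h w \<partial>M) \<le> d1 (x -\<^sub>X z i)"
      unfolding tmean_def
    proof (rule integral_mono_AE[OF int tmean_integrable[OF weight_one]])
      have "AE w in M. N ((x -\<^sub>X z i) +\<^sub>X z i) w \<le> N (x -\<^sub>X z i) w + N (z i) w"
        using elim x by (intro nrm_triangle) auto
      then show "AE w in M. ?h w \<le> min 1 (1 * N (x -\<^sub>X z i) w)"
        using elim(1) nrm_nonneg[of "x -\<^sub>X z i"] elim x
        by (auto elim!: AE_mp simp: diff_add_cancel)
    qed (use elim x in auto)
    also have "\<dots> = d1 (z i -\<^sub>X x)" using elim x by (intro tmean_commute) auto
    finally show ?case .
  qed
  then have "(\<integral>w. ?h w \<partial>M) \<le> 0"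
    using tendsto_lowerbound[OF lim_tmean[OF weight_one assms(1)] _ assms(2)] by blast
  moreover have "0 \<le> (\<integral>w. ?h w \<partial>M)" by (rule integral_nonneg_AE) auto
  ultimately have "AE w in M. ?h w = 0"
    using integral_nonneg_eq_0_iff_AE[OF int] by auto
  then show ?thesis by eventually_elim (auto simp: min_def max_def split: if_splits)
qed

lemma continuous_on_halfline_iff:
  "cont\<^sub>X g \<longleftrightarrow> (\<forall>s\<ge>0. xlim g (g s) (at s within {0..}))"
  unfolding continuous_on_halfline_def continuous_map_top_of_set_iff by auto

lemma continuous_on_halfline_closed:
  "cont\<^sub>X g \<Longrightarrow> 0 \<le> s \<Longrightarrow> g s \<in> V"
  unfolding continuous_on_halfline_iff using limD(1) by blast


section \<open>Lipschitz functions and primitives\<close>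

text \<open>For a vector that is not truncated, \<open>min 1 (\<bar>r\<bar> * t) \<le> \<bar>r\<bar>
  * t = \<bar>r\<bar> * min 1 t\<close>. Only an inequality results, since the scaled vector may be
  truncated.\<close>

lemma tmean_scale:
  assumes "weight M \<rho>" "x \<in> V" "AE w in M. \<rho> w * N x w \<le> 1"
  shows "d \<rho> (r *\<^sub>X x) \<le> \<bar>r\<bar> * d \<rho> x"
proof -
  have "d \<rho> (r *\<^sub>X x) \<le> (\<integral>w. \<bar>r\<bar> * min 1 (\<rho> w * N x w) \<partial>M)"
    unfolding tmean_def
  proof (rule integral_mono_AE)
    show "AE w in M. min 1 (\<rho> w * N (r *\<^sub>X x) w) \<le> \<bar>r\<bar> * min 1 (\<rho> w * N x w)"
      using nrm_rscale[OF assms(2), of r] assms(3)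
      by eventually_elim (simp add: mult.left_commute)
  qed (use assms tmean_integrable in auto)
  then show ?thesis by (simp add: tmean_def)
qed

lemma tmean_le_const:
  assumes "weight M \<rho>" "x \<in> V" "AE w in M. \<rho> w * N x w \<le> c"
  shows "d \<rho> x \<le> c"
proof -
  have "d \<rho> x \<le> (\<integral>w. c \<partial>M)"
    unfolding tmean_def
    by (rule integral_mono_AE[OF tmean_integrable]) (use assms in \<open>auto elim!: AE_mp\<close>)
  then show ?thesis by (simp add: prob_space)
qed

lemma at_within_halfline: "0 < (s::real) \<Longrightarrow> at s within {0..} = at s"
  by (rule at_within_interior) simp

lemma diff_diff_diff:
  "a \<in> V \<Longrightarrow> b \<in> V \<Longrightarrow> c \<in> V \<Longrightarrow> e \<in> V \<Longrightarrow> (a -\<^sub>X b) -\<^sub>X (c -\<^sub>X e) = (a -\<^sub>X c) -\<^sub>X (b -\<^sub>X e)"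
  by (simp add: a_minus_def M.minus_add M.a_ac)

lemma diff_self: "a \<in> V \<Longrightarrow> a -\<^sub>X a = 0\<^sub>X"
  by (simp add: a_minus_def M.r_neg)

lemma diff_diff_cancel:
  "a \<in> V \<Longrightarrow> b \<in> V \<Longrightarrow> c \<in> V \<Longrightarrow> (a -\<^sub>X c) -\<^sub>X (b -\<^sub>X c) = a -\<^sub>X b"
  by (simp add: diff_diff_diff[of a c b c] diff_self diff_zero)

theorem zero_derivative_const:
  assumes "0 \<le> L" and V: "\<And>u. u \<in> {0..L} \<Longrightarrow> \<phi> u \<in> V"
    and b: "weight M b"
    and lip: "\<And>u v. u \<in> {0..L} \<Longrightarrow> v \<in> {0..L} \<Longrightarrow>
      AE w in M. N (\<phi> u -\<^sub>X \<phi> v) w \<le> b w * \<bar>u - v\<bar>"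
    and der: "\<And>u. 0 < u \<Longrightarrow> u < L \<Longrightarrow> xlim (\<lambda>t. (1 / (t - u)) *\<^sub>X (\<phi> t -\<^sub>X \<phi> u)) 0\<^sub>X (at u)"
  shows "\<phi> L = \<phi> 0"
proof (cases "L = 0")
  case False
  then have L: "0 < L" using assms(1) by simp
  \<comment> \<open>Divided by the Lipschitz constant, every difference quotient has weighted norm
    at most 1. Hence \<open>tmean_scale\<close> applies to the quotient itself, and
    \<open>(\<psi> t - \<psi> u) / (t - u)\<close> is bounded by its truncated mean.\<close>
  define \<rho> where "\<rho> = (\<lambda>w. 1 / b w)"
  have \<rho>: "weight M \<rho>" unfolding \<rho>_def using b by (rule weight_inverse)
  define \<psi> where "\<psi> u = d \<rho> (\<phi> u -\<^sub>X \<phi> 0)" for u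
  have \<psi>: "\<bar>\<psi> u - \<psi> v\<bar> \<le> d \<rho> (\<phi> u -\<^sub>X \<phi> v)" if "u \<in> {0..L}" "v \<in> {0..L}" for u v
    using tmean_abs_diff[OF \<rho>, of "\<phi> u -\<^sub>X \<phi> 0" "\<phi> v -\<^sub>X \<phi> 0"] V[OF that(1)] V[OF that(2)] V[of 0] L
    by (simp add: \<psi>_def diff_diff_cancel)
  have wlip: "AE w in M. \<rho> w * N (\<phi> u -\<^sub>X \<phi> v) w \<le> \<bar>u - v\<bar>"
    if "u \<in> {0..L}" "v \<in> {0..L}" for u v
    using lip[OF that]
    by eventually_elim (use weight_pos[OF b] in \<open>simp add: \<rho>_def field_simps\<close>)
  have \<psi>_lip: "\<bar>\<psi> u - \<psi> v\<bar> \<le> \<bar>u - v\<bar>" if "u \<in> {0..L}" "v \<in> {0..L}" for u v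
    using \<psi>[OF that] tmean_le_const[OF \<rho> _ wlip[OF that]] V that by fastforce
  have "\<psi> L = \<psi> 0"
  proof (rule DERIV_isconst_end[OF L])
    have "1-lipschitz_on {0..L} \<psi>"
      by (rule lipschitz_onI) (use \<psi>_lip in \<open>auto simp: dist_real_def\<close>)
    then show "continuous_on {0..L} \<psi>" by (rule lipschitz_on_continuous_on)
    fix u assume u: "0 < u" "u < L"
    let ?q = "\<lambda>t. (1 / (t - u)) *\<^sub>X (\<phi> t -\<^sub>X \<phi> u)"
    have ev: "eventually (\<lambda>t. t \<in> {0<..<L} \<and> t \<noteq> u) (at u)"
      by (intro eventually_conj eventually_at_in_open' eventually_neq_at_within) (use u in auto)
    have "eventually (\<lambda>t. ?q t \<in> V) (at u)" using limD(2)[OF der[OF u]] .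
    from lim_zero_iff[OF \<rho> this] have q0: "((\<lambda>t. d \<rho> (?q t)) \<longlongrightarrow> 0) (at u)"
      using der[OF u] by simp
    have "((\<lambda>t. (\<psi> t - \<psi> u) / (t - u)) \<longlongrightarrow> 0) (at u)"
    proof (rule Lim_null_comparison[OF _ q0])
      show "eventually (\<lambda>t. norm ((\<psi> t - \<psi> u) / (t - u)) \<le> d \<rho> (?q t)) (at u)"
        using ev
      proof eventually_elim
        case (elim t)
        then have t: "t \<in> {0..L}" "u \<in> {0..L}" "t - u \<noteq> 0" using u by auto
        have qV: "?q t \<in> V" "\<phi> t \<in> V" "\<phi> u \<in> V" using t V by auto
        have "AE w in M. \<rho> w * N (?q t) w \<le> 1"
          using wlip[OF t(1,2)] nrm_rscale[OF vminus_closed[OF qV(2,3)], of "1 / (t - u)"]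
        proof eventually_elim
          case (elim w)
          then have "\<rho> w * N (?q t) w = (\<rho> w * N (\<phi> t -\<^sub>X \<phi> u) w) / \<bar>t - u\<bar>" by (simp add: abs_divide)
          also have "\<dots> \<le> 1" using elim(1) t(3) by simp
          finally show ?case .
        qed
        then have "d \<rho> ((t - u) *\<^sub>X ?q t) \<le> \<bar>t - u\<bar> * d \<rho> (?q t)"
          using tmean_scale[OF \<rho> qV(1)] by blast
        moreover have "(t - u) *\<^sub>X ?q t = \<phi> t -\<^sub>X \<phi> u" using qV t by (simp add: rscale_rscale)
        ultimately have "\<bar>\<psi> t - \<psi> u\<bar> \<le> \<bar>t - u\<bar> * d \<rho> (?q t)" using \<psi>[OF t(1,2)] by simp
        then show ?case using t(3) by (simp add: abs_divide field_simps)
      qed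
    qed
    then show "DERIV \<psi> u :> 0" by (simp add: has_field_derivative_iff)
  qed
  then have "d \<rho> (\<phi> L -\<^sub>X \<phi> 0) = 0" using V[of 0] L \<rho> by (simp add: \<psi>_def)
  then show ?thesis using tmean_eq_0_imp_eq[OF \<rho>] V L by simp
qed simp

text \<open>The variant of \<open>locally_L0_lipschitz\<close> for use inside the proof: the
  constants are positive functions instead of classes.\<close>

definition loc_lip :: "(real \<Rightarrow> 'x) \<Rightarrow> bool" where
  "loc_lip g \<longleftrightarrow> (\<forall>s\<ge>0. g s \<in> V) \<and> (\<forall>l\<ge>0. \<exists>b. weight M b \<and>
     (\<forall>s\<in>{0..l}. \<forall>t\<in>{0..l}. AE w in M. N (g s -\<^sub>X g t) w \<le> b w * \<bar>s - t\<bar>))"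

text \<open>The Lipschitz condition is part of the notion because the derivative alone does not
  determine a function in this topology.\<close>

definition primitive :: "(real \<Rightarrow> 'x) \<Rightarrow> (real \<Rightarrow> 'x) \<Rightarrow> bool" where
  "primitive f F \<longleftrightarrow> F 0 = 0\<^sub>X \<and> loc_lip F \<and> (\<forall>s\<ge>0. has_deriv F (f s) s)"

lemma loc_lip_closed: "loc_lip g \<Longrightarrow> 0 \<le> s \<Longrightarrow> g s \<in> V"
  by (simp add: loc_lip_def)

lemma loc_lipE:
  assumes "loc_lip g" "0 \<le> l"
  obtains b where "weight M b"
    "\<And>s t. s \<in> {0..l} \<Longrightarrow> t \<in> {0..l} \<Longrightarrow> AE w in M. N (g s -\<^sub>X g t) w \<le> b w * \<bar>s - t\<bar>"
  using assms unfolding loc_lip_def by metis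

lemma loc_lip_diff:
  assumes "loc_lip f" "loc_lip g" shows "loc_lip (\<lambda>s. f s -\<^sub>X g s)"
  unfolding loc_lip_def
proof (intro conjI allI impI)
  fix l :: real assume l: "0 \<le> l"
  obtain a where a: "weight M a" "\<And>s t. s \<in> {0..l} \<Longrightarrow> t \<in> {0..l} \<Longrightarrow>
      AE w in M. N (f s -\<^sub>X f t) w \<le> a w * \<bar>s - t\<bar>" using loc_lipE[OF assms(1) l] by metis
  obtain b where b: "weight M b" "\<And>s t. s \<in> {0..l} \<Longrightarrow> t \<in> {0..l} \<Longrightarrow>
      AE w in M. N (g s -\<^sub>X g t) w \<le> b w * \<bar>s - t\<bar>" using loc_lipE[OF assms(2) l] by metis
  show "\<exists>b. weight M b \<and> (\<forall>s\<in>{0..l}. \<forall>t\<in>{0..l}.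
      AE w in M. N (f s -\<^sub>X g s -\<^sub>X (f t -\<^sub>X g t)) w \<le> b w * \<bar>s - t\<bar>)"
  proof (intro exI[of _ "\<lambda>w. a w + b w"] conjI ballI)
    fix s t assume st: "s \<in> {0..l}" "t \<in> {0..l}"
    then have V: "f s \<in> V" "f t \<in> V" "g s \<in> V" "g t \<in> V" using assms by (auto simp: loc_lip_closed)
    have "AE w in M. N ((f s -\<^sub>X f t) -\<^sub>X (g s -\<^sub>X g t)) w \<le> N (f s -\<^sub>X f t) w + N (g s -\<^sub>X g t) w"
      by (rule nrm_diff) (use V in auto)
    then show "AE w in M. N (f s -\<^sub>X g s -\<^sub>X (f t -\<^sub>X g t)) w \<le> (a w + b w) * \<bar>s - t\<bar>"
      using a(2)[OF st] b(2)[OF st] unfolding diff_diff_diff[OF V(1,3,2,4)]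
      by eventually_elim (simp add: distrib_right)
  qed (use a b weight_add in auto)
qed (use assms loc_lip_closed in auto)

lemma derivative_diff:
  assumes "has_deriv f a s" "has_deriv g b s"
    and "\<And>t. 0 \<le> t \<Longrightarrow> f t \<in> V" "\<And>t. 0 \<le> t \<Longrightarrow> g t \<in> V" "0 \<le> s"
  shows "has_deriv (\<lambda>t. f t -\<^sub>X g t) (a -\<^sub>X b) s"
  unfolding has_derivative_halfline_def
proof (rule limitin_transform_eventually)
  show "eventually (\<lambda>t. (1 / (t - s)) *\<^sub>X (f t -\<^sub>X f s) -\<^sub>X (1 / (t - s)) *\<^sub>X (g t -\<^sub>X g s) =
      (1 / (t - s)) *\<^sub>X (f t -\<^sub>X g t -\<^sub>X (f s -\<^sub>X g s))) (at s within {0..})"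
    unfolding eventually_at_filter
    by (rule always_eventually) (use assms in \<open>auto simp: diff_diff_diff simp flip: rscale_diff\<close>)
  show "xlim (\<lambda>t. (1 / (t - s)) *\<^sub>X (f t -\<^sub>X f s) -\<^sub>X (1 / (t - s)) *\<^sub>X (g t -\<^sub>X g s)) (a -\<^sub>X b) (at s within {0..})"
    using assms unfolding has_derivative_halfline_def by (intro lim_diff)
qed

theorem loc_lip_zero_derivative:
  assumes "loc_lip g" "\<And>s. 0 < s \<Longrightarrow> has_deriv g 0\<^sub>X s" "0 \<le> s"
  shows "g s = g 0"
proof -
  obtain b where b: "weight M b" "\<And>u t. u \<in> {0..s} \<Longrightarrow> t \<in> {0..s} \<Longrightarrow>
      AE w in M. N (g u -\<^sub>X g t) w \<le> b w * \<bar>u - t\<bar>" using loc_lipE[OF assms(1,3)] by metis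
  show ?thesis
    by (rule zero_derivative_const[OF assms(3) _ b])
      (use assms(1,2) in \<open>auto simp: loc_lip_closed has_derivative_halfline_def at_within_halfline\<close>)
qed

lemma primitive_closed: "primitive f F \<Longrightarrow> 0 \<le> s \<Longrightarrow> F s \<in> V"
  by (simp add: primitive_def loc_lip_closed)

text \<open>The difference is L0-Lipschitz with derivative zero. Every identity between integrals
  below is obtained from this.\<close>

lemma primitive_unique:
  assumes "primitive f F" "primitive g G" "\<And>s. 0 < s \<Longrightarrow> f s = g s" "0 \<le> s"
  shows "F s = G s"
proof -
  note FV = primitive_closed[OF assms(1)] and GV = primitive_closed[OF assms(2)]
  have "F s -\<^sub>X G s = F 0 -\<^sub>X G 0"
  proof (rule loc_lip_zero_derivative[OF _ _ assms(4)])
    show "loc_lip (\<lambda>s. F s -\<^sub>X G s)" using assms by (auto simp: primitive_def loc_lip_diff)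
    fix s :: real assume s: "0 < s"
    have f: "has_deriv F (f s) s" and g: "has_deriv G (g s) s"
      using assms(1,2) less_imp_le[OF s] unfolding primitive_def by blast+
    have "f s \<in> V" using f limD(1) unfolding has_derivative_halfline_def by blast
    then have "f s -\<^sub>X g s = 0\<^sub>X" using assms(3)[OF s] by (simp add: a_minus_def M.r_neg)
    then show "has_deriv (\<lambda>s. F s -\<^sub>X G s) 0\<^sub>X s"
      using derivative_diff[OF f g FV GV] s by simp
  qed
  also have "\<dots> = 0\<^sub>X" using assms by (simp add: primitive_def a_minus_def M.r_neg)
  finally show ?thesis using diff_eq_zero_iff FV GV assms(4) by auto
qed

section \<open>Existence of primitives\<close>

text \<open>The common form of Riemann sums, grid sums and differences of grid sums.\<close>

definition lincomb :: "'i set \<Rightarrow> ('i \<Rightarrow> real) \<Rightarrow> ('i \<Rightarrow> 'x) \<Rightarrow> 'x" where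
  "lincomb A c g = (\<Oplus>\<^bsub>X\<^esub>k\<in>A. c k *\<^sub>X g k)"

lemma lincomb_closed: "g \<in> A \<rightarrow> V \<Longrightarrow> lincomb A c g \<in> V"
  unfolding lincomb_def by (intro M.finsum_closed) auto

lemma lincomb_empty: "lincomb {} c g = 0\<^sub>X"
  by (simp add: lincomb_def)

lemma lincomb_insert:
  "finite A \<Longrightarrow> k \<notin> A \<Longrightarrow> g \<in> insert k A \<rightarrow> V \<Longrightarrow> lincomb (insert k A) c g = c k *\<^sub>X g k +\<^sub>X lincomb A c g"
  unfolding lincomb_def by (intro M.finsum_insert) auto

lemma lincomb_diff:
  "finite A \<Longrightarrow> g \<in> A \<rightarrow> V \<Longrightarrow> h \<in> A \<rightarrow> V \<Longrightarrow>
    lincomb A c g -\<^sub>X lincomb A c h = lincomb A c (\<lambda>k. g k -\<^sub>X h k)"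
proof (induction A rule: finite_induct)
  case (insert k A)
  then have V: "g \<in> A \<rightarrow> V" "h \<in> A \<rightarrow> V" "g k \<in> V" "h k \<in> V" "(\<lambda>k. g k -\<^sub>X h k) \<in> insert k A \<rightarrow> V" by auto
  then have "lincomb (insert k A) c g -\<^sub>X lincomb (insert k A) c h =
      (c k *\<^sub>X g k -\<^sub>X c k *\<^sub>X h k) +\<^sub>X (lincomb A c g -\<^sub>X lincomb A c h)"
    using insert by (simp add: lincomb_insert add_diff_add lincomb_closed)
  also have "\<dots> = lincomb (insert k A) c (\<lambda>k. g k -\<^sub>X h k)"
    using insert V by (simp add: lincomb_insert rscale_diff)
  finally show ?case .
qed (simp add: lincomb_empty diff_zero)

lemma lincomb_diff_coeff:
  "finite A \<Longrightarrow> g \<in> A \<rightarrow> V \<Longrightarrow> lincomb A a g -\<^sub>X lincomb A b g = lincomb A (\<lambda>k. a k - b k) g"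
proof (induction A rule: finite_induct)
  case (insert k A)
  then have V: "g \<in> A \<rightarrow> V" "g k \<in> V" by auto
  then have "lincomb (insert k A) a g -\<^sub>X lincomb (insert k A) b g =
      (a k *\<^sub>X g k -\<^sub>X b k *\<^sub>X g k) +\<^sub>X (lincomb A a g -\<^sub>X lincomb A b g)"
    using insert by (simp add: lincomb_insert add_diff_add lincomb_closed)
  also have "\<dots> = lincomb (insert k A) (\<lambda>k. a k - b k) g"
    using insert V by (simp add: lincomb_insert rscale_diff_left)
  finally show ?case .
qed (simp add: lincomb_empty diff_zero)

lemma lincomb_scale:
  "finite A \<Longrightarrow> g \<in> A \<rightarrow> V \<Longrightarrow> r *\<^sub>X lincomb A c g = lincomb A (\<lambda>k. r * c k) g"
proof (induction A rule: finite_induct)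
  case (insert k A)
  then have V: "g \<in> A \<rightarrow> V" "g k \<in> V" by auto
  then show ?case using insert by (simp add: lincomb_insert rscale_add lincomb_closed rscale_rscale)
qed (simp add: lincomb_empty)

lemma lincomb_nrm:
  "finite A \<Longrightarrow> g \<in> A \<rightarrow> V \<Longrightarrow> AE w in M. N (lincomb A c g) w \<le> (\<Sum>k\<in>A. \<bar>c k\<bar> * N (g k) w)"
proof (induction A rule: finite_induct)
  case empty
  show ?case using nrm_zero by (auto simp: lincomb_empty elim!: AE_mp)
next
  case (insert k A)
  then have V: "g \<in> A \<rightarrow> V" "g k \<in> V" by auto
  have "AE w in M. N (lincomb (insert k A) c g) w \<le> N (c k *\<^sub>X g k) w + N (lincomb A c g) w"
    using insert V by (simp add: lincomb_insert nrm_triangle lincomb_closed)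
  moreover have "AE w in M. N (lincomb A c g) w \<le> (\<Sum>k\<in>A. \<bar>c k\<bar> * N (g k) w)"
    using insert V by simp
  ultimately show ?case using nrm_rscale[OF V(2), of "c k"]
    by eventually_elim (use insert in simp)
qed

text \<open>The truncated mean is homogeneous on vectors that it does not truncate, so the
  coefficients can be taken out. Terms with coefficient zero are unconstrained because idle grid
  nodes may lie outside the interval on which \<open>f\<close> is controlled.\<close>

lemma lincomb_tmean:
  assumes "weight M \<rho>"
  shows "finite A \<Longrightarrow> g \<in> A \<rightarrow> V \<Longrightarrow>
    (\<And>k. k \<in> A \<Longrightarrow> 0 \<le> c k \<and> (c k \<noteq> 0 \<longrightarrow> d \<rho> (g k) \<le> e \<and> (AE w in M. \<rho> w * N (g k) w \<le> 1))) \<Longrightarrow>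
    d \<rho> (lincomb A c g) \<le> e * sum c A"
proof (induction A rule: finite_induct)
  case empty
  show ?case using assms by (simp add: lincomb_empty)
next
  case (insert k A)
  then have V: "g \<in> A \<rightarrow> V" "g k \<in> V" by auto
  have "d \<rho> (lincomb (insert k A) c g) \<le> d \<rho> (c k *\<^sub>X g k) + d \<rho> (lincomb A c g)"
    using insert V assms by (simp add: lincomb_insert tmean_triangle lincomb_closed)
  also have "d \<rho> (lincomb A c g) \<le> e * sum c A" using insert V by auto
  also have "d \<rho> (c k *\<^sub>X g k) \<le> e * c k"
  proof (cases "c k = 0")
    case True then show ?thesis using V assms by simp
  next
    case False
    then have c: "0 \<le> c k" "d \<rho> (g k) \<le> e" "AE w in M. \<rho> w * N (g k) w \<le> 1" using insert.prems(2)[of k] by auto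
    have "d \<rho> (c k *\<^sub>X g k) \<le> \<bar>c k\<bar> * d \<rho> (g k)" by (rule tmean_scale[OF assms V(2) c(3)])
    also have "\<dots> \<le> e * c k" using c mult_left_mono[OF c(2,1)] by (simp add: mult.commute)
    finally show ?thesis .
  qed
  finally show ?case using insert by (simp add: distrib_left)
qed

lemma lincomb_sum_left:
  assumes "finite B" "y \<in> V"
  shows "lincomb B a (\<lambda>_. y) = sum a B *\<^sub>X y"
  using assms(1) by (induction B rule: finite_induct)
    (use assms(2) in \<open>simp_all add: lincomb_empty lincomb_insert rscale_add_left\<close>)

lemma lincomb_cong:
  assumes "A = B" "g \<in> B \<rightarrow> V" "\<And>k. k \<in> B \<Longrightarrow> c k *\<^sub>X f k = e k *\<^sub>X g k"
  shows "lincomb A c f = lincomb B e g"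
  unfolding lincomb_def by (rule M.finsum_cong') (use assms in auto)

lemma lincomb_reindex:
  assumes "inj_on h A" "g \<in> h ` A \<rightarrow> V"
  shows "lincomb (h ` A) c g = lincomb A (\<lambda>k. c (h k)) (\<lambda>k. g (h k))"
  unfolding lincomb_def by (rule M.finsum_reindex) (use assms in auto)

lemma lincomb_Times_fst:
  assumes "finite A" "finite B" "g \<in> A \<rightarrow> V"
  shows "lincomb (A \<times> B) (\<lambda>(i, j). a i j) (\<lambda>(i, j). g i) = lincomb A (\<lambda>i. \<Sum>j\<in>B. a i j) g"
  using assms(1,3)
proof (induction A rule: finite_induct)
  case (insert k A)
  have V: "g \<in> A \<rightarrow> V" "g k \<in> V" using insert by auto
  have split: "insert k A \<times> B = Pair k ` B \<union> A \<times> B" by auto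
  have "lincomb (insert k A \<times> B) (\<lambda>(i, j). a i j) (\<lambda>(i, j). g i) =
      lincomb (Pair k ` B) (\<lambda>(i, j). a i j) (\<lambda>(i, j). g i) +\<^sub>X lincomb (A \<times> B) (\<lambda>(i, j). a i j) (\<lambda>(i, j). g i)"
    unfolding lincomb_def split
    by (rule M.finsum_Un_disjoint) (use insert V assms in auto)
  also have "lincomb (Pair k ` B) (\<lambda>(i, j). a i j) (\<lambda>(i, j). g i) = lincomb B (a k) (\<lambda>_. g k)"
    by (subst lincomb_reindex) (use V in \<open>auto simp: inj_on_def\<close>)
  also have "\<dots> = (\<Sum>j\<in>B. a k j) *\<^sub>X g k" by (rule lincomb_sum_left[OF assms(2) V(2)])
  finally show ?case using insert V by (simp add: lincomb_insert)
qed (simp add: lincomb_empty)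

lemma lincomb_Times_snd:
  assumes "finite A" "finite B" "h \<in> B \<rightarrow> V"
  shows "lincomb (A \<times> B) (\<lambda>(i, j). a i j) (\<lambda>(i, j). h j) = lincomb B (\<lambda>j. \<Sum>i\<in>A. a i j) h"
proof -
  have "lincomb (A \<times> B) (\<lambda>(i, j). a i j) (\<lambda>(i, j). h j) =
      lincomb (prod.swap ` (B \<times> A)) (\<lambda>(i, j). a i j) (\<lambda>(i, j). h j)"
    by (simp add: product_swap)
  also have "\<dots> = lincomb (B \<times> A) (\<lambda>(j, i). a i j) (\<lambda>(j, i). h j)"
    by (subst lincomb_reindex) (use assms in \<open>auto intro!: lincomb_cong\<close>)
  also have "\<dots> = lincomb B (\<lambda>j. \<Sum>i\<in>A. a i j) h" by (rule lincomb_Times_fst) (use assms in auto)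
  finally show ?thesis .
qed

text \<open>The matrix \<open>a\<close> is a transport plan between the coefficients of two linear combinations. For two
  Riemann sums, \<open>a i j\<close> is the length of the intersection of cell \<open>i\<close> with cell \<open>j\<close>.\<close>

lemma lincomb_coupling:
  assumes "weight M \<rho>" "finite A" "finite B" "g \<in> A \<rightarrow> V" "h \<in> B \<rightarrow> V"
    and "\<And>i j. i \<in> A \<Longrightarrow> j \<in> B \<Longrightarrow> 0 \<le> a i j"
    and "\<And>i j. i \<in> A \<Longrightarrow> j \<in> B \<Longrightarrow> a i j \<noteq> 0 \<Longrightarrow> d \<rho> (g i -\<^sub>X h j) \<le> e"
    and "\<And>i j. i \<in> A \<Longrightarrow> j \<in> B \<Longrightarrow> a i j \<noteq> 0 \<Longrightarrow> AE w in M. \<rho> w * N (g i -\<^sub>X h j) w \<le> 1"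
  shows "d \<rho> (lincomb A (\<lambda>i. \<Sum>j\<in>B. a i j) g -\<^sub>X lincomb B (\<lambda>j. \<Sum>i\<in>A. a i j) h) \<le> e * (\<Sum>i\<in>A. \<Sum>j\<in>B. a i j)"
proof -
  have V: "(\<lambda>(i, j). g i) \<in> A \<times> B \<rightarrow> V" "(\<lambda>(i, j). h j) \<in> A \<times> B \<rightarrow> V" using assms(4,5) by auto
  have "lincomb A (\<lambda>i. \<Sum>j\<in>B. a i j) g -\<^sub>X lincomb B (\<lambda>j. \<Sum>i\<in>A. a i j) h =
      lincomb (A \<times> B) (\<lambda>(i, j). a i j) (\<lambda>k. (\<lambda>(i, j). g i) k -\<^sub>X (\<lambda>(i, j). h j) k)"
    unfolding lincomb_Times_fst[OF assms(2-4), symmetric] lincomb_Times_snd[OF assms(2,3,5), symmetric]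
    by (rule lincomb_diff) (use assms V in auto)
  also have "d \<rho> \<dots> \<le> e * sum (\<lambda>(i, j). a i j) (A \<times> B)"
    by (rule lincomb_tmean[OF assms(1)]) (use assms in auto)
  finally show ?thesis by (simp add: sum.cartesian_product)
qed


lemma lim_tmean_le:
  assumes "xlim z x F" "F \<noteq> bot" "weight M \<rho>" "y \<in> V" "eventually (\<lambda>i. d \<rho> (z i -\<^sub>X y) \<le> c) F"
  shows "d \<rho> (x -\<^sub>X y) \<le> c"
proof -
  have "((\<lambda>i. d \<rho> (z i -\<^sub>X x) + c) \<longlongrightarrow> 0 + c) F"
    by (intro tendsto_add tendsto_const lim_tmean assms)
  moreover have "eventually (\<lambda>i. d \<rho> (x -\<^sub>X y) \<le> d \<rho> (z i -\<^sub>X x) + c) F"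
    using assms(5) limD(2)[OF assms(1)]
  proof eventually_elim
    case (elim i)
    have "d \<rho> (x -\<^sub>X y) \<le> d \<rho> (x -\<^sub>X z i) + d \<rho> (z i -\<^sub>X y)"
      using limD(1)[OF assms(1)] elim assms by (intro tmean_diff_triangle) auto
    then show ?case using tmean_commute[OF assms(3) limD(1)[OF assms(1)] elim(2)] elim(1) by simp
  qed
  ultimately show ?thesis using tendsto_lowerbound[OF _ _ assms(2)] by fastforce
qed

text \<open>Completeness is formulated through neighbourhoods, that is, through the weight 1. Over
  pairs of indices the Cauchy property becomes convergence to zero, to which the change of weight
  applies.\<close>

lemma el_complete_tmean:
  assumes "el_complete M X" "weight M \<rho>" "\<And>n. z n \<in> V"
    and "\<And>e. 0 < e \<Longrightarrow> \<exists>K::nat. \<forall>m\<ge>K. \<forall>n\<ge>K. d \<rho> (z m -\<^sub>X z n) \<le> e"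
  shows "\<exists>x. xlim z x sequentially"
proof -
  let ?F = "sequentially \<times>\<^sub>F sequentially"
  have "((\<lambda>(m, n). d \<rho> (z m -\<^sub>X z n)) \<longlongrightarrow> 0) ?F"
  proof (rule tendstoI)
    fix e :: real assume "0 < e"
    then obtain K where "\<forall>m\<ge>K. \<forall>n\<ge>K. d \<rho> (z m -\<^sub>X z n) \<le> e/2" using assms(4)[of "e/2"] by auto
    then have "\<forall>m\<ge>K. \<forall>n\<ge>K. dist (d \<rho> (z n -\<^sub>X z m)) 0 < e"
      using tmean_nonneg[OF assms(2) vminus_closed[OF assms(3) assms(3)]] \<open>0 < e\<close> by fastforce
    then show "eventually (\<lambda>p. dist (case p of (m, n) \<Rightarrow> d \<rho> (z m -\<^sub>X z n)) 0 < e) ?F"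
      unfolding eventually_prod_sequentially by (intro exI[of _ K]) simp
  qed
  then have "((\<lambda>p. d \<rho> (z (fst p) -\<^sub>X z (snd p))) \<longlongrightarrow> 0) ?F" by (simp add: case_prod_unfold)
  then have lim: "((\<lambda>p. d1 (z (fst p) -\<^sub>X z (snd p))) \<longlongrightarrow> 0) ?F"
    by (rule tmean_weight_change[OF weight_one assms(2), rotated]) (use assms in simp)
  have "\<exists>K. \<forall>m\<ge>K. \<forall>n\<ge>K. z m -\<^sub>X z n \<in> el_nbhd M X e l" if el: "0 < e" "0 < l" "l < 1" for e l
  proof -
    have "eventually (\<lambda>p. d1 (z (fst p) -\<^sub>X z (snd p)) < min e 1 * (1 - l)) ?F"
      by (rule order_tendstoD(2)[OF lim]) (use el in auto)
    then obtain K where "\<forall>m\<ge>K. \<forall>n\<ge>K. d1 (z n -\<^sub>X z m) < min e 1 * (1 - l)"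
      unfolding eventually_prod_sequentially by auto
    then show ?thesis using assms(3) el by (intro exI[of _ K]) (auto intro!: nbhd_if_tmean_less)
  qed
  moreover have "range z \<subseteq> V" using assms(3) by auto
  ultimately show ?thesis using assms(1) unfolding el_complete_def by blast
qed

text \<open>A Lebesgue number argument: the cover consists of open sets on which \<open>f\<close>
  stays within \<open>e/2\<close> of one of its values, and two points of one such set have images
  at distance at most \<open>e\<close>.\<close>

lemma uniformly_continuous_tmean:
  assumes "cont\<^sub>X f" "weight M \<rho>" "0 < e"
  obtains \<delta> where "0 < \<delta>"
    "\<And>s t. s \<in> {0..l} \<Longrightarrow> t \<in> {0..l} \<Longrightarrow> \<bar>s - t\<bar> < \<delta> \<Longrightarrow> d \<rho> (f s -\<^sub>X f t) \<le> e"
proof -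
  define G where "G = {T. open T \<and> (\<exists>x\<ge>0. \<forall>y\<in>T \<inter> {0..}. d \<rho> (f y -\<^sub>X f x) < e/2)}"
  have fV: "f s \<in> V" if "0 \<le> s" for s using continuous_on_halfline_closed[OF assms(1) that] .
  have "{0..l} \<subseteq> \<Union> G"
  proof
    fix s assume s: "s \<in> {0..l}"
    then have "xlim f (f s) (at s within {0..})" using assms(1) unfolding continuous_on_halfline_iff by simp
    then have "eventually (\<lambda>t. d \<rho> (f t -\<^sub>X f s) < e/2) (at s within {0..})"
      using assms by (intro order_tendstoD(2)[OF lim_tmean]) auto
    then obtain T where T: "open T" "s \<in> T" "\<forall>t\<in>T. t \<noteq> s \<longrightarrow> t \<in> {0..} \<longrightarrow> d \<rho> (f t -\<^sub>X f s) < e/2"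
      unfolding eventually_at_topological by blast
    have "d \<rho> (f t -\<^sub>X f s) < e/2" if "t \<in> T \<inter> {0..}" for t
      using T(3) that assms fV[of s] s by (cases "t = s") auto
    then have "T \<in> G" unfolding G_def using T(1) s by auto
    then show "s \<in> \<Union> G" using T(2) by blast
  qed
  then obtain \<delta> where \<delta>: "0 < \<delta>" "\<And>x. x \<in> {0..l} \<Longrightarrow> \<exists>T\<in>G. ball x \<delta> \<subseteq> T"
    using Heine_Borel_lemma[of "{0..l}" G] unfolding G_def by blast
  show ?thesis
  proof (rule that[OF \<delta>(1)])
    fix s t assume st: "s \<in> {0..l}" "t \<in> {0..l}" "\<bar>s - t\<bar> < \<delta>"
    obtain T where T: "T \<in> G" "ball s \<delta> \<subseteq> T" using \<delta>(2)[OF st(1)] by blast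
    then obtain x where x: "0 \<le> x" "\<And>y. y \<in> T \<inter> {0..} \<Longrightarrow> d \<rho> (f y -\<^sub>X f x) < e/2"
      unfolding G_def by auto
    have "s \<in> ball s \<delta>" "t \<in> ball s \<delta>" using st \<delta>(1) by (auto simp: dist_real_def)
    then have st': "s \<in> T \<inter> {0..}" "t \<in> T \<inter> {0..}" using T(2) st by auto
    have "d \<rho> (f s -\<^sub>X f t) \<le> d \<rho> (f s -\<^sub>X f x) + d \<rho> (f x -\<^sub>X f t)"
      using st' x by (intro tmean_diff_triangle fV assms) auto
    also have "d \<rho> (f x -\<^sub>X f t) = d \<rho> (f t -\<^sub>X f x)"
      using st' x by (intro tmean_commute fV assms) auto
    also have "d \<rho> (f s -\<^sub>X f x) + d \<rho> (f t -\<^sub>X f x) \<le> e" using x(2)[OF st'(1)] x(2)[OF st'(2)] by simp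
    finally show "d \<rho> (f s -\<^sub>X f t) \<le> e" by simp
  qed
qed

end

section \<open>Grid sums on the half-line\<close>

definition node :: "nat \<Rightarrow> nat \<Rightarrow> real" where
  "node n k = real k / real (Suc n)"

text \<open>For \<open>x \<ge> 0\<close>, the length of the part of the \<open>k\<close>-th grid interval that lies in \<open>[0,x]\<close>.\<close>

definition cell :: "nat \<Rightarrow> nat \<Rightarrow> real \<Rightarrow> real" where
  "cell n k x = min x (node n (Suc k)) - min x (node n k)"

lemma node_nonneg [simp]: "0 \<le> node n k"
  by (simp add: node_def)

lemma node_0: "node n 0 = 0"
  by (simp add: node_def)

lemma node_Suc: "node n (Suc k) = node n k + node n 1"
  by (simp add: node_def add_divide_distrib)

lemma node_one: "node n 1 = 1 / real (Suc n)" "0 < node n 1"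
  by (simp_all add: node_def)

text \<open>With mesh \<open>1/(n+1)\<close>, it takes \<open>(n+1)\<close> squared intervals to
  reach \<open>n+1\<close>. So the mesh tends to zero while the grid exhausts the half-line, and one
  grid serves all upper limits of integration at once.\<close>

lemma node_last: "node n (Suc n * Suc n) = real (Suc n)"
  unfolding node_def of_nat_mult by simp

lemma cell_0: "cell n k 0 = 0"
  using node_nonneg[of n k] node_nonneg[of n "Suc k"] by (simp add: cell_def)

lemma sum_cell:
  assumes "0 \<le> x" "x \<le> real (Suc n)" shows "(\<Sum>k<Suc n * Suc n. cell n k x) = x"
proof -
  have "(\<Sum>k<m. cell n k x) = min x (node n m) - min x (node n 0)" for m
    unfolding cell_def by (rule sum_lessThan_telescope)
  then show ?thesis using assms by (simp only: node_last node_0 min_def) auto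
qed

lemma cell_mono: "a \<le> b \<Longrightarrow> cell n k a \<le> cell n k b"
  using node_one(2)[of n] unfolding cell_def node_Suc by (auto simp: min_def)

text \<open>A grid interval contributes to the part between \<open>a\<close> and \<open>b\<close>
  only if it overlaps it. This locates the nodes with nonzero coefficient.\<close>

lemma cell_neqD:
  assumes "a \<le> b" "cell n k a \<noteq> cell n k b"
  shows "node n k < b" "a < node n k + node n 1"
  using assms node_one(2)[of n] unfolding cell_def node_Suc min_def
  by (auto split: if_splits)

context RN_module
begin

text \<open>The integral over \<open>[0,x]\<close> of the step function that takes the value of
  \<open>f\<close> at the left end of each grid interval. The grid does not depend on
  \<open>x\<close>, so the difference for two values of \<open>x\<close> is again a combination over
  the same nodes.\<close>

definition step :: "(real \<Rightarrow> 'x) \<Rightarrow> nat \<Rightarrow> real \<Rightarrow> 'x" where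
  "step f n x = lincomb {..<Suc n * Suc n} (\<lambda>k. cell n k x) (\<lambda>k. f (node n k))"

lemma nodes_closed:
  assumes "\<forall>s\<ge>0. f s \<in> V"
  shows "(\<lambda>k. f (node n k)) \<in> A \<rightarrow> V"
  using assms node_nonneg by auto

lemma step_closed: "\<forall>s\<ge>0. f s \<in> V \<Longrightarrow> step f n x \<in> V"
  unfolding step_def by (intro lincomb_closed nodes_closed)

lemma step_0: "\<forall>s\<ge>0. f s \<in> V \<Longrightarrow> step f n 0 = 0\<^sub>X"
  unfolding step_def cell_0 lincomb_def using node_nonneg by (simp add: M.finsum_zero cong: M.finsum_cong)

lemma step_diff:
  "\<forall>s\<ge>0. f s \<in> V \<Longrightarrow> step f n b -\<^sub>X step f n a =
    lincomb {..<Suc n * Suc n} (\<lambda>k. cell n k b - cell n k a) (\<lambda>k. f (node n k))"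
  unfolding step_def by (intro lincomb_diff_coeff nodes_closed) auto

text \<open>The coefficients are nonnegative with sum \<open>b - a\<close>, and the nodes that carry
  a nonzero coefficient lie in \<open>[0,l]\<close>, where \<open>\<beta>\<close> bounds
  \<open>f\<close>.\<close>

lemma step_nrm:
  assumes "\<forall>s\<ge>0. f s \<in> V" "\<And>u. u \<in> {0..l} \<Longrightarrow> AE w in M. N (f u) w \<le> \<beta> w"
    and "0 \<le> a" "a \<le> b" "b \<le> l" "b \<le> real (Suc n)"
  shows "AE w in M. N (step f n b -\<^sub>X step f n a) w \<le> \<beta> w * (b - a)"
proof -
  let ?A = "{..<Suc n * Suc n}" and ?c = "\<lambda>k. cell n k b - cell n k a"
  have "AE w in M. \<forall>k\<in>?A. \<bar>?c k\<bar> * N (f (node n k)) w \<le> ?c k * \<beta> w"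
  proof (rule AE_finite_allI)
    fix k assume "k \<in> ?A"
    have c: "0 \<le> ?c k" using cell_mono[OF assms(4)] by simp
    show "AE w in M. \<bar>?c k\<bar> * N (f (node n k)) w \<le> ?c k * \<beta> w"
    proof (cases "?c k = 0")
      case False
      then have "node n k \<in> {0..l}" using cell_neqD(1)[OF assms(4), of n k] assms(5) node_nonneg[of n k] by auto
      from assms(2)[OF this] show ?thesis
        by eventually_elim (use c in \<open>auto intro!: mult_left_mono\<close>)
    qed simp
  qed simp
  moreover have "AE w in M. N (step f n b -\<^sub>X step f n a) w \<le> (\<Sum>k\<in>?A. \<bar>?c k\<bar> * N (f (node n k)) w)"
    unfolding step_diff[OF assms(1)] by (rule lincomb_nrm) (use nodes_closed assms(1) in auto)
  ultimately show ?thesis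
  proof eventually_elim
    case (elim w)
    have "(\<Sum>k\<in>?A. \<bar>?c k\<bar> * N (f (node n k)) w) \<le> (\<Sum>k\<in>?A. ?c k * \<beta> w)"
      using elim(1) by (intro sum_mono) auto
    also have "\<dots> = (\<Sum>k\<in>?A. ?c k) * \<beta> w" by (rule sum_distrib_right[symmetric])
    also have "(\<Sum>k\<in>?A. ?c k) = b - a"
      using sum_cell[of b n] sum_cell[of a n] assms by (simp add: sum_subtractf del: mult_Suc mult_Suc_right)
    finally show ?case using elim(2) by (simp add: mult.commute)
  qed
qed

text \<open>The slope is an average of values of \<open>f\<close> at nodes near
  \<open>[a,b]\<close>. A contributing node lies between \<open>a - node n 1\<close> and
  \<open>b\<close>, hence within \<open>b - a + node n 1\<close> of \<open>t\<close>. The estimate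
  is uniform in \<open>n\<close> and survives the limit.\<close>

lemma step_slope:
  assumes "\<forall>s\<ge>0. f s \<in> V" "weight M \<rho>" "0 \<le> a" "a < b" "b \<le> l" "b \<le> real (Suc n)" "t \<in> {a..b}"
    and cont: "\<And>s t. s \<in> {0..l} \<Longrightarrow> t \<in> {0..l} \<Longrightarrow> \<bar>s - t\<bar> < \<delta> \<Longrightarrow> d \<rho> (f s -\<^sub>X f t) \<le> e"
    and bound: "\<And>s t. s \<in> {0..l} \<Longrightarrow> t \<in> {0..l} \<Longrightarrow> AE w in M. \<rho> w * N (f s -\<^sub>X f t) w \<le> 1"
    and fine: "b - a + node n 1 < \<delta>"
  shows "d \<rho> ((1 / (b - a)) *\<^sub>X (step f n b -\<^sub>X step f n a) -\<^sub>X f t) \<le> e"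
proof -
  let ?A = "{..<Suc n * Suc n}" and ?h = "\<lambda>k::nat. f (node n k)"
  \<comment> \<open>The transport plan sends the unit mass at the single point \<open>t\<close>,
    indexed by the unit type, to the nodes in proportion to their share of
    \<open>[a,b]\<close>.\<close>
  let ?c = "\<lambda>(i::unit) k. (1 / (b - a)) * (cell n k b - cell n k a)"
  have near: "node n k \<in> {0..l} \<and> t \<in> {0..l} \<and> \<bar>t - node n k\<bar> < \<delta>"
    if "?c i k \<noteq> 0" for i :: unit and k
  proof -
    have "cell n k a \<noteq> cell n k b" using that by auto
    note * = cell_neqD[OF less_imp_le[OF assms(4)] this]
    have "\<bar>t - node n k\<bar> < \<delta>" using * assms(7) fine node_one(2)[of n] by (auto simp: abs_less_iff simp del: One_nat_def)
    then show ?thesis using * assms(3-7) node_nonneg[of n k] by auto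
  qed
  have t: "f t \<in> V" using assms by auto
  have sum: "(\<Sum>k\<in>?A. ?c i k) = 1" for i :: unit
  proof -
    have "(\<Sum>k\<in>?A. ?c i k) = (1 / (b - a)) * ((\<Sum>k\<in>?A. cell n k b) - (\<Sum>k\<in>?A. cell n k a))"
      by (simp add: sum_subtractf sum_distrib_left right_diff_distrib del: mult_Suc mult_Suc_right)
    also have "\<dots> = 1" using sum_cell[of b n] sum_cell[of a n] assms by (simp del: mult_Suc mult_Suc_right)
    finally show ?thesis .
  qed
  have "d \<rho> (lincomb {()} (\<lambda>i. \<Sum>k\<in>?A. ?c i k) (\<lambda>_. f t) -\<^sub>X lincomb ?A (\<lambda>k. \<Sum>i\<in>{()}. ?c i k) ?h)
      \<le> e * (\<Sum>i\<in>{()}. \<Sum>k\<in>?A. ?c i k)"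
  proof (rule lincomb_coupling[OF assms(2)])
    fix i :: unit and k assume *: "?c i k \<noteq> 0"
    show "d \<rho> (f t -\<^sub>X ?h k) \<le> e" using near[OF *] by (intro cont) auto
    show "AE w in M. \<rho> w * N (f t -\<^sub>X ?h k) w \<le> 1" using near[OF *] by (intro bound) auto
  next
    fix i :: unit and k show "0 \<le> ?c i k" using cell_mono[of a b n k] assms(4) by simp
  qed (use t assms(1) nodes_closed in auto)
  also have "lincomb {()} (\<lambda>i. \<Sum>k\<in>?A. ?c i k) (\<lambda>_. f t) = f t"
    unfolding sum using t by (simp add: lincomb_def)
  also have "lincomb ?A (\<lambda>k. \<Sum>i\<in>{()}. ?c i k) ?h = (1 / (b - a)) *\<^sub>X (step f n b -\<^sub>X step f n a)"
    unfolding step_diff[OF assms(1)] by (subst lincomb_scale) (use assms(1) in auto)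
  also have "e * (\<Sum>i\<in>{()}. \<Sum>k\<in>?A. ?c i k) = e" unfolding sum by simp
  also have "d \<rho> (f t -\<^sub>X (1 / (b - a)) *\<^sub>X (step f n b -\<^sub>X step f n a)) =
      d \<rho> ((1 / (b - a)) *\<^sub>X (step f n b -\<^sub>X step f n a) -\<^sub>X f t)"
    by (rule tmean_commute) (use assms(1,2) t in \<open>auto intro!: step_closed\<close>)
  finally show ?thesis .
qed

text \<open>The transport plan gives to a cell of \<open>p\<close> and a grid interval the length of
  their intersection. Its row sums are the lengths of the cells of \<open>p\<close>, its column sums
  the coefficients of \<open>step f n x\<close>, and its total mass is \<open>x\<close>. Where mass
  is transported, tag and node are closer than the two lengths together.\<close>

lemma step_riemann_sum:
  assumes "\<forall>s\<ge>0. f s \<in> V" "weight M \<rho>" "0 \<le> x" "x \<le> l" "x \<le> real (Suc n)"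
    and cont: "\<And>s t. s \<in> {0..l} \<Longrightarrow> t \<in> {0..l} \<Longrightarrow> \<bar>s - t\<bar> < \<delta> \<Longrightarrow> d \<rho> (f s -\<^sub>X f t) \<le> e"
    and bound: "\<And>s t. s \<in> {0..l} \<Longrightarrow> t \<in> {0..l} \<Longrightarrow> AE w in M. \<rho> w * N (f s -\<^sub>X f t) w \<le> 1"
    and p: "p tagged_division_of {0..x}"
    and fine: "\<forall>(t, K)\<in>p. measure lborel K + node n 1 < \<delta>"
  shows "rsum f p \<in> V"
    "d \<rho> (rsum f p -\<^sub>X step f n x) \<le> e * x"
proof -
  let ?A = "{..<Suc n * Suc n}" and ?h = "\<lambda>k::nat. f (node n k)"
  let ?c = "\<lambda>(tK :: real \<times> real set) k. cell n k (Sup (snd tK)) - cell n k (Inf (snd tK))"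
  have finp: "finite p" using p by auto
  have K: "0 \<le> Inf (snd tK) \<and> Inf (snd tK) \<le> fst tK \<and> fst tK \<le> Sup (snd tK) \<and> Sup (snd tK) \<le> x \<and>
      measure lborel (snd tK) = Sup (snd tK) - Inf (snd tK)" if tK: "tK \<in> p" for tK
  proof -
    have tK': "(fst tK, snd tK) \<in> p" using tK by simp
    obtain u v where uv: "snd tK = cbox u v" using tagged_division_ofD(4)[OF p tK'] by auto
    moreover have "fst tK \<in> snd tK" "snd tK \<subseteq> {0..x}" using tagged_division_ofD(2,3)[OF p tK'] by auto
    ultimately show ?thesis by auto
  qed
  have near: "node n k \<in> {0..l} \<and> fst tK \<in> {0..l} \<and> \<bar>fst tK - node n k\<bar> < \<delta>"
    if "?c tK k \<noteq> 0" "tK \<in> p" for tK k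
  proof -
    note K' = K[OF that(2)]
    have "measure lborel (snd tK) + node n 1 < \<delta>" using fine that(2) by auto
    moreover have "cell n k (Inf (snd tK)) \<noteq> cell n k (Sup (snd tK))" using that(1) by auto
    note * = cell_neqD[OF _ this]
    ultimately have "\<bar>fst tK - node n k\<bar> < \<delta>" using * K' node_one(2)[of n] by (auto simp: abs_less_iff simp del: One_nat_def)
    then show ?thesis using * K' assms(4) node_nonneg[of n k] by auto
  qed
  have pV: "(\<lambda>tK. f (fst tK)) \<in> p \<rightarrow> V"
  proof
    fix tK assume "tK \<in> p" then show "f (fst tK) \<in> V" using K[of tK] assms(1) by auto
  qed
  have row: "(\<Sum>k\<in>?A. ?c tK k) = measure lborel (snd tK)" if "tK \<in> p" for tK
    using K[OF that] sum_cell[of "Inf (snd tK)" n] sum_cell[of "Sup (snd tK)" n] assms(5)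
    by (simp add: sum_subtractf del: mult_Suc mult_Suc_right)
  \<comment> \<open>For a fixed grid interval the increments of \<open>cell n k\<close> over the
    cells of \<open>p\<close> telescope from \<open>0\<close> to \<open>x\<close>.\<close>
  have col: "(\<Sum>tK\<in>p. ?c tK k) = cell n k x" for k
    using additive_tagged_division_1[OF assms(3) p, of "cell n k"] by (simp add: case_prod_unfold cell_0)
  have total: "(\<Sum>tK\<in>p. \<Sum>k\<in>?A. ?c tK k) = x"
    by (subst sum.swap) (use sum_cell[OF assms(3,5)] col in \<open>simp del: mult_Suc mult_Suc_right\<close>)
  have "d \<rho> (lincomb p (\<lambda>tK. \<Sum>k\<in>?A. ?c tK k) (\<lambda>tK. f (fst tK)) -\<^sub>X lincomb ?A (\<lambda>k. \<Sum>tK\<in>p. ?c tK k) ?h)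
      \<le> e * (\<Sum>tK\<in>p. \<Sum>k\<in>?A. ?c tK k)"
  proof (rule lincomb_coupling[OF assms(2) finp])
    fix tK k assume *: "tK \<in> p" "?c tK k \<noteq> 0"
    show "d \<rho> (f (fst tK) -\<^sub>X ?h k) \<le> e" using near[OF *(2,1)] by (intro cont) auto
    show "AE w in M. \<rho> w * N (f (fst tK) -\<^sub>X ?h k) w \<le> 1" using near[OF *(2,1)] by (intro bound) auto
  next
    fix tK k assume "tK \<in> p" then show "0 \<le> ?c tK k"
      using cell_mono[of "Inf (snd tK)" "Sup (snd tK)" n k] K[of tK] by simp
  qed (use pV nodes_closed assms(1) in auto)
  moreover have "lincomb p (\<lambda>tK. \<Sum>k\<in>?A. ?c tK k) (\<lambda>tK. f (fst tK)) = rsum f p"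
    unfolding lincomb_def by (rule M.finsum_cong') (use row pV in auto)
  ultimately show "d \<rho> (rsum f p -\<^sub>X step f n x) \<le> e * x"
    unfolding col total step_def by simp
  show "rsum f p \<in> V"
    by (rule M.finsum_closed) (use pV in auto)
qed


lemma minus_diff: "x \<in> V \<Longrightarrow> y \<in> V \<Longrightarrow> \<ominus>\<^bsub>X\<^esub> (x -\<^sub>X y) = y -\<^sub>X x"
  by (simp add: a_minus_def M.minus_add M.a_comm)

lemma rscale_uminus_diff: "x \<in> V \<Longrightarrow> y \<in> V \<Longrightarrow> (- r) *\<^sub>X (x -\<^sub>X y) = r *\<^sub>X (y -\<^sub>X x)"
  by (simp add: rscale_uminus_left minus_diff flip: rscale_uminus)

lemma nrm_commute: "x \<in> V \<Longrightarrow> y \<in> V \<Longrightarrow> AE w in M. N (x -\<^sub>X y) w = N (y -\<^sub>X x) w"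
  using nrm_uminus[of "y -\<^sub>X x"] by (simp add: minus_diff)

definition loc_bounded :: "(real \<Rightarrow> 'x) \<Rightarrow> bool" where
  "loc_bounded f \<longleftrightarrow> (\<forall>l\<ge>0. \<exists>b. weight M b \<and> (\<forall>u\<in>{0..l}. AE w in M. N (f u) w \<le> b w))"

lemma eventually_node_less: "0 < c \<Longrightarrow> eventually (\<lambda>n. node n 1 < c) sequentially"
proof -
  have "(\<lambda>n. node n 1) \<longlonglongrightarrow> 0"
    using LIMSEQ_inverse_real_of_nat by (simp add: node_def inverse_eq_divide)
  then show "0 < c \<Longrightarrow> eventually (\<lambda>n. node n 1 < c) sequentially" by (rule order_tendstoD(2))
qed

lemma eventually_le_Suc: "eventually (\<lambda>n. s \<le> real (Suc n)) sequentially"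
proof -
  obtain K :: nat where "s \<le> real K" using real_arch_simple by blast
  then show ?thesis by (intro eventually_sequentiallyI[of K]) auto
qed

section \<open>The primitive of a continuous, locally a.s. bounded function\<close>

context
  fixes f
  assumes compl: "el_complete M X" and cont: "cont\<^sub>X f" and bd: "loc_bounded f"
begin

lemma f_closed: "\<forall>s\<ge>0. f s \<in> V"
  using continuous_on_halfline_closed[OF cont] by blast

text \<open>The weight is the reciprocal of twice the bound of \<open>f\<close>, since differences
  of two values have to escape truncation.\<close>

lemma normalizing_weight:
  assumes "0 \<le> l"
  obtains \<rho> where "weight M \<rho>"
    "\<And>s t. s \<in> {0..l} \<Longrightarrow> t \<in> {0..l} \<Longrightarrow> AE w in M. \<rho> w * N (f s -\<^sub>X f t) w \<le> 1"
proof -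
  obtain b where b: "weight M b" "\<And>u. u \<in> {0..l} \<Longrightarrow> AE w in M. N (f u) w \<le> b w"
    using bd assms unfolding loc_bounded_def by metis
  show ?thesis
  proof (rule that)
    show "weight M (\<lambda>w. 1 / (b w + b w))" by (intro weight_inverse weight_add b)
    fix s t assume st: "s \<in> {0..l}" "t \<in> {0..l}"
    have "AE w in M. N (f s -\<^sub>X f t) w \<le> N (f s) w + N (f t) w"
      using st f_closed by (intro nrm_diff) auto
    then show "AE w in M. 1 / (b w + b w) * N (f s -\<^sub>X f t) w \<le> 1"
      using b(2)[OF st(1)] b(2)[OF st(2)]
    proof eventually_elim
      case (elim w)
      then show ?case using weight_pos[OF b(1), of w] by (simp add: divide_le_eq)
    qed
  qed
qed

text \<open>The same \<open>\<delta>\<close> serves all fine divisions and all large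
  \<open>n\<close>, so \<open>n\<close> can tend to infinity with \<open>p\<close> fixed.\<close>

lemma riemann_sum_near_step:
  assumes s: "0 \<le> s" and \<rho>: "weight M \<rho>"
    "\<And>u t. u \<in> {0..s} \<Longrightarrow> t \<in> {0..s} \<Longrightarrow> AE w in M. \<rho> w * N (f u -\<^sub>X f t) w \<le> 1"
    and e: "0 < e"
  obtains \<delta> where "0 < \<delta>" "\<And>p n. p tagged_division_of {0..s} \<Longrightarrow> \<forall>(t, K)\<in>p. measure lborel K < \<delta> \<Longrightarrow>
    node n 1 < \<delta> \<Longrightarrow> s \<le> real (Suc n) \<Longrightarrow>
    rsum f p \<in> V \<and>
    d \<rho> (rsum f p -\<^sub>X step f n s) \<le> e"
proof -
  \<comment> \<open>The summand 1 covers \<open>s = 0\<close>.\<close>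
  define e' where "e' = e / (s + 1)"
  have e': "0 < e'" "e' * s \<le> e" using e s by (auto simp: e'_def field_simps)
  obtain \<delta> where \<delta>: "0 < \<delta>"
    "\<And>u t. u \<in> {0..s} \<Longrightarrow> t \<in> {0..s} \<Longrightarrow> \<bar>u - t\<bar> < \<delta> \<Longrightarrow> d \<rho> (f u -\<^sub>X f t) \<le> e'"
    using uniformly_continuous_tmean[OF cont \<rho>(1) e'(1)] by metis
  show ?thesis
  proof (rule that[OF half_gt_zero[OF \<delta>(1)]])
    fix p n assume p: "p tagged_division_of {0..s}" "\<forall>(t, K)\<in>p. measure lborel K < \<delta>/2"
      and n: "node n 1 < \<delta>/2" "s \<le> real (Suc n)"
    have "\<forall>(t, K)\<in>p. measure lborel K + node n 1 < \<delta>"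
    proof clarify
      fix t K assume "(t, K) \<in> p"
      then have "measure lborel K < \<delta>/2" using p(2) by auto
      then show "measure lborel K + node n 1 < \<delta>" using n(1) by linarith
    qed
    then show "rsum f p \<in> V \<and>
      d \<rho> (rsum f p -\<^sub>X step f n s) \<le> e"
      using step_riemann_sum[where \<delta>=\<delta> and l=s, OF f_closed \<rho>(1) s order_refl n(2) \<delta>(2) \<rho>(2) p(1)] e'(2) by auto
  qed
qed

definition antider :: "real \<Rightarrow> 'x" where
  "antider s = (SOME x. xlim (\<lambda>n. step f n s) x sequentially)"

lemma step_lim: assumes s: "0 \<le> s" shows "xlim (\<lambda>n. step f n s) (antider s) sequentially"
proof -
  obtain \<rho> where \<rho>: "weight M \<rho>"
    "\<And>u t. u \<in> {0..s} \<Longrightarrow> t \<in> {0..s} \<Longrightarrow> AE w in M. \<rho> w * N (f u -\<^sub>X f t) w \<le> 1"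
    using normalizing_weight[OF s] by blast
  have "\<exists>x. xlim (\<lambda>n. step f n s) x sequentially"
  proof (rule el_complete_tmean[OF compl \<rho>(1)])
    show "step f n s \<in> V" for n by (rule step_closed[OF f_closed])
    fix e :: real assume "0 < e"
    let ?R = "rsum f"
    obtain \<delta> where \<delta>: "0 < \<delta>" "\<And>p n. p tagged_division_of {0..s} \<Longrightarrow> \<forall>(t, K)\<in>p. measure lborel K < \<delta> \<Longrightarrow>
        node n 1 < \<delta> \<Longrightarrow> s \<le> real (Suc n) \<Longrightarrow> ?R p \<in> V \<and> d \<rho> (?R p -\<^sub>X step f n s) \<le> e/2"
      using riemann_sum_near_step[OF s \<rho> half_gt_zero[OF \<open>0 < e\<close>]] by blast
    \<comment> \<open>Two grids need not refine one another; their sums are compared through one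
      fine division.\<close>
    obtain p where p: "p tagged_division_of {0..s}" "\<forall>(t, K)\<in>p. measure lborel K < \<delta>"
      using fine_tagged_division_exists[OF \<delta>(1)] by metis
    have "eventually (\<lambda>n. ?R p \<in> V \<and> d \<rho> (?R p -\<^sub>X step f n s) \<le> e/2) sequentially"
      using eventually_node_less[OF \<delta>(1)] eventually_le_Suc[of s] by eventually_elim (rule \<delta>(2)[OF p])
    then obtain K where R: "\<And>n. n \<ge> K \<Longrightarrow> ?R p \<in> V \<and> d \<rho> (?R p -\<^sub>X step f n s) \<le> e/2"
      by (auto simp: eventually_sequentially)
    show "\<exists>K. \<forall>m\<ge>K. \<forall>n\<ge>K. d \<rho> (step f m s -\<^sub>X step f n s) \<le> e"
    proof (intro exI[of _ K] allI impI)
      fix m n assume mn: "m \<ge> K" "n \<ge> K"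
      have V: "step f m s \<in> V" "step f n s \<in> V" by (auto intro: step_closed[OF f_closed])
      have "d \<rho> (step f m s -\<^sub>X step f n s) \<le> d \<rho> (step f m s -\<^sub>X ?R p) + d \<rho> (?R p -\<^sub>X step f n s)"
        using R[OF mn(1)] V by (intro tmean_diff_triangle \<rho>) auto
      also have "d \<rho> (step f m s -\<^sub>X ?R p) = d \<rho> (?R p -\<^sub>X step f m s)"
        using R[OF mn(1)] V by (intro tmean_commute \<rho>) auto
      finally show "d \<rho> (step f m s -\<^sub>X step f n s) \<le> e" using R[OF mn(1)] R[OF mn(2)] by simp
    qed
  qed
  then show ?thesis unfolding antider_def by (rule someI_ex)
qed

lemma antider_closed: "0 \<le> s \<Longrightarrow> antider s \<in> V"
  using limD(1)[OF step_lim] .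

lemma antider_0: "antider 0 = 0\<^sub>X"
  using lim_unique[OF step_lim[of 0]] lim_const[of "0\<^sub>X"] by (simp add: step_0 f_closed)

text \<open>For each fine \<open>p\<close> the comparison with grid sums holds for all large
  \<open>n\<close>, and \<open>n\<close> tending to infinity replaces the grid sum by
  \<open>antider s\<close>.\<close>

lemma antider_integral: assumes s: "0 \<le> s" shows "has_rint f (antider s) 0 s"
proof -
  obtain \<rho> where \<rho>: "weight M \<rho>"
    "\<And>u t. u \<in> {0..s} \<Longrightarrow> t \<in> {0..s} \<Longrightarrow> AE w in M. \<rho> w * N (f u -\<^sub>X f t) w \<le> 1"
    using normalizing_weight[OF s] by blast
  let ?R = "rsum f"
  have ev: "eventually (\<lambda>p. ?R p \<in> V \<and> d \<rho> (?R p -\<^sub>X antider s) \<le> e) (riemann_filter 0 s)" if "0 < e" for e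
  proof -
    obtain \<delta> where \<delta>: "0 < \<delta>" "\<And>p n. p tagged_division_of {0..s} \<Longrightarrow> \<forall>(t, K)\<in>p. measure lborel K < \<delta> \<Longrightarrow>
        node n 1 < \<delta> \<Longrightarrow> s \<le> real (Suc n) \<Longrightarrow> ?R p \<in> V \<and> d \<rho> (?R p -\<^sub>X step f n s) \<le> e"
      using riemann_sum_near_step[OF s \<rho> \<open>0 < e\<close>] by blast
    show ?thesis
      unfolding eventually_riemann_filter
    proof (intro exI[of _ \<delta>] conjI allI impI \<delta>(1))
      fix p assume p: "p tagged_division_of {0..s} \<and> (\<forall>(t, K)\<in>p. measure lborel K < \<delta>)"
      have ev: "eventually (\<lambda>n. ?R p \<in> V \<and> d \<rho> (?R p -\<^sub>X step f n s) \<le> e) sequentially"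
        using eventually_node_less[OF \<delta>(1)] eventually_le_Suc[of s]
        by eventually_elim (rule \<delta>(2)[OF conjunct1[OF p] conjunct2[OF p]])
      then obtain n where "?R p \<in> V" by (auto dest: eventually_happens)
      from ev have "eventually (\<lambda>n. d \<rho> (step f n s -\<^sub>X ?R p) \<le> e) sequentially"
        by eventually_elim (auto simp: tmean_commute[OF \<rho>(1) step_closed[OF f_closed]])
      then have "d \<rho> (antider s -\<^sub>X ?R p) \<le> e"
        by (intro lim_tmean_le[OF step_lim[OF s] _ \<rho>(1) \<open>?R p \<in> V\<close>]) auto
      then show "?R p \<in> V" "d \<rho> (?R p -\<^sub>X antider s) \<le> e"
        using tmean_commute[OF \<rho>(1) antider_closed[OF s] \<open>?R p \<in> V\<close>] \<open>?R p \<in> V\<close> by auto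
    qed
  qed
  have "((\<lambda>p. d \<rho> (?R p -\<^sub>X antider s)) \<longlongrightarrow> 0) (riemann_filter 0 s)"
  proof (rule tendstoI)
    fix e :: real assume "0 < e"
    then have "eventually (\<lambda>p. ?R p \<in> V \<and> d \<rho> (?R p -\<^sub>X antider s) \<le> e/2) (riemann_filter 0 s)" by (intro ev) simp
    then show "eventually (\<lambda>p. dist (d \<rho> (?R p -\<^sub>X antider s)) 0 < e) (riemann_filter 0 s)"
      by eventually_elim (use \<open>0 < e\<close> tmean_nonneg[OF \<rho>(1)] antider_closed[OF s] in auto)
  qed
  moreover have "eventually (\<lambda>p. ?R p \<in> V) (riemann_filter 0 s)"
    using ev[of 1] by (auto elim!: eventually_mono)
  ultimately show ?thesis
    unfolding has_riemann_integral_def lim_iff[OF \<rho>(1)] using antider_closed[OF s] by blast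
qed

text \<open>The bound of \<open>f\<close> is itself the Lipschitz constant, without loss. For
  \<open>f u = T u z\<close> it can be taken proportional to the norm of \<open>z\<close>, which
  later controls \<open>S s\<close> as an operator.\<close>

lemma antider_bound:
  assumes \<beta>: "\<beta> \<in> borel_measurable M" and b: "\<And>u. u \<in> {0..l} \<Longrightarrow> AE w in M. N (f u) w \<le> \<beta> w"
    and st: "s \<in> {0..l}" "t \<in> {0..l}"
  shows "AE w in M. N (antider s -\<^sub>X antider t) w \<le> \<beta> w * \<bar>s - t\<bar>"
proof -
  have le: "AE w in M. N (antider y -\<^sub>X antider x) w \<le> \<beta> w * (y - x)" if "0 \<le> x" "x \<le> y" "y \<le> l" for x y
  proof (rule nrm_lim_le)
    show "xlim (\<lambda>n. step f n y -\<^sub>X step f n x) (antider y -\<^sub>X antider x) sequentially"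
      using that by (intro lim_diff step_lim) auto
    show "(\<lambda>w. \<beta> w * (y - x)) \<in> borel_measurable M" using \<beta> by measurable
    show "eventually (\<lambda>n. AE w in M. N (step f n y -\<^sub>X step f n x) w \<le> \<beta> w * (y - x)) sequentially"
      using eventually_le_Suc[of y]
    proof eventually_elim
      case (elim n)
      then show ?case using step_nrm[OF f_closed b that] by simp
    qed
  qed simp
  show ?thesis
  proof (cases "s \<le> t")
    case True
    have "AE w in M. N (antider s -\<^sub>X antider t) w = N (antider t -\<^sub>X antider s) w"
      using st antider_closed by (intro nrm_commute) auto
    with le[of s t] show ?thesis using st True by (auto elim!: AE_mp)
  next
    case False
    with le[of t s] show ?thesis using st by auto
  qed
qed

lemma antider_derivative: assumes s: "0 \<le> s" shows "has_deriv antider (f s) s"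
proof -
  \<comment> \<open>The margin 1 leaves room to the right of \<open>s\<close>.\<close>
  let ?l = "s + 1" and ?q = "\<lambda>t. (1 / (t - s)) *\<^sub>X (antider t -\<^sub>X antider s)"
  have l: "0 \<le> ?l" using s by simp
  obtain \<rho> where \<rho>: "weight M \<rho>"
    "\<And>u t. u \<in> {0..?l} \<Longrightarrow> t \<in> {0..?l} \<Longrightarrow> AE w in M. \<rho> w * N (f u -\<^sub>X f t) w \<le> 1"
    using normalizing_weight[OF l] by blast
  have fs: "f s \<in> V" using f_closed s by simp
  have qV: "?q t \<in> V" if "0 \<le> t" for t using that s antider_closed by auto
  have "((\<lambda>t. d \<rho> (?q t -\<^sub>X f s)) \<longlongrightarrow> 0) (at s within {0..})"
  proof (rule tendstoI)
    fix e :: real assume e: "0 < e"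
    obtain \<delta> where \<delta>: "0 < \<delta>"
      "\<And>u t. u \<in> {0..?l} \<Longrightarrow> t \<in> {0..?l} \<Longrightarrow> \<bar>u - t\<bar> < \<delta> \<Longrightarrow> d \<rho> (f u -\<^sub>X f t) \<le> e/2"
      using uniformly_continuous_tmean[OF cont \<rho>(1), of "e/2"] e by (metis half_gt_zero)
    \<comment> \<open>Stated for any short interval that contains \<open>s\<close>, the estimate
      covers the quotients from the right, on \<open>[s,t]\<close>, and from the left, on
      \<open>[t,s]\<close>.\<close>
    have slope: "d \<rho> ((1 / (b - a)) *\<^sub>X (antider b -\<^sub>X antider a) -\<^sub>X f s) \<le> e/2"
      if ab: "0 \<le> a" "a < b" "b \<le> ?l" "s \<in> {a..b}" "b - a < \<delta>/2" for a b
    proof (rule lim_tmean_le[OF _ _ \<rho>(1) fs])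
      show "xlim (\<lambda>n. (1 / (b - a)) *\<^sub>X (step f n b -\<^sub>X step f n a)) ((1 / (b - a)) *\<^sub>X (antider b -\<^sub>X antider a)) sequentially"
        using ab by (intro lim_rscale lim_diff step_lim) auto
      show "eventually (\<lambda>n. d \<rho> ((1 / (b - a)) *\<^sub>X (step f n b -\<^sub>X step f n a) -\<^sub>X f s) \<le> e/2) sequentially"
        using eventually_node_less[OF half_gt_zero[OF \<delta>(1)]] eventually_le_Suc[of b]
      proof eventually_elim
        case (elim n)
        have "b - a + node n 1 < \<delta>" using elim(1) ab(5) by linarith
        with elim(2) show ?case
          using step_slope[OF f_closed \<rho>(1) ab(1-3) _ ab(4) \<delta>(2) \<rho>(2)] by simp
      qed
    qed simp
    have "eventually (\<lambda>t. dist t s < min 1 (\<delta>/2)) (at s within {0..})"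
      using \<delta>(1) by (intro tendstoD[OF tendsto_ident_at]) auto
    moreover have "eventually (\<lambda>t. t \<in> {0..} \<and> t \<noteq> s) (at s within {0..})"
      by (simp add: eventually_at_filter)
    ultimately show "eventually (\<lambda>t. dist (d \<rho> (?q t -\<^sub>X f s)) 0 < e) (at s within {0..})"
    proof eventually_elim
      case (elim t)
      have "d \<rho> (?q t -\<^sub>X f s) \<le> e/2"
      proof (cases "s < t")
        case True
        then show ?thesis using elim s by (intro slope) (auto simp: dist_real_def)
      next
        case False
        then have "t < s" using elim by auto
        have "?q t = (- (1 / (s - t))) *\<^sub>X (antider t -\<^sub>X antider s)"
          using \<open>t < s\<close> by (intro arg_cong[where f="\<lambda>r. r *\<^sub>X _"]) (simp add: field_simps)
        also have "\<dots> = (1 / (s - t)) *\<^sub>X (antider s -\<^sub>X antider t)"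
          using elim s antider_closed by (intro rscale_uminus_diff) auto
        finally show ?thesis using slope[of t s] elim s \<open>t < s\<close> by (auto simp: dist_real_def)
      qed
      then show ?case using tmean_nonneg[OF \<rho>(1)] qV[of t] fs elim e by simp
    qed
  qed
  moreover have "eventually (\<lambda>t. ?q t \<in> V) (at s within {0..})"
    unfolding eventually_at_filter by (rule always_eventually) (use qV in auto)
  ultimately show ?thesis
    unfolding has_derivative_halfline_def lim_iff[OF \<rho>(1)] using fs by blast
qed

theorem primitive_exists:
  "\<exists>F. primitive f F \<and> (\<forall>s\<ge>0. has_rint f (F s) 0 s) \<and>
    (\<forall>l \<beta>. \<beta> \<in> borel_measurable M \<longrightarrow> (\<forall>u\<in>{0..l}. AE w in M. N (f u) w \<le> \<beta> w) \<longrightarrow>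
      (\<forall>s\<in>{0..l}. \<forall>t\<in>{0..l}. AE w in M. N (F s -\<^sub>X F t) w \<le> \<beta> w * \<bar>s - t\<bar>))"
proof (intro exI[of _ antider] conjI allI impI ballI)
  show "primitive f antider"
    unfolding primitive_def loc_lip_def
  proof (intro conjI allI impI)
    fix l :: real assume "0 \<le> l"
    then obtain b where b: "weight M b" "\<And>u. u \<in> {0..l} \<Longrightarrow> AE w in M. N (f u) w \<le> b w"
      using bd unfolding loc_bounded_def by metis
    show "\<exists>b. weight M b \<and> (\<forall>s\<in>{0..l}. \<forall>t\<in>{0..l}. AE w in M. N (antider s -\<^sub>X antider t) w \<le> b w * \<bar>s - t\<bar>)"
      using antider_bound[OF weight_measurable[OF b(1)] b(2), where l=l] b(1) by blast
  qed (use antider_0 antider_closed antider_derivative in auto)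
next
  fix l \<beta> s t
  assume "\<beta> \<in> borel_measurable M" "\<forall>u\<in>{0..l}. AE w in M. N (f u) w \<le> \<beta> w" "s \<in> {0..l}" "t \<in> {0..l}"
  then show "AE w in M. N (antider s -\<^sub>X antider t) w \<le> \<beta> w * \<bar>s - t\<bar>" by (intro antider_bound) auto
qed (use antider_integral in auto)

end

end

section \<open>Essential suprema and operator norms\<close>

text \<open>A bounded, strictly increasing map that makes extended real functions integrable. The
  values at the infinities lie strictly beyond the range of the arctangent, as
  \<open>pi/2 < 2\<close>.\<close>

definition squash :: "ereal \<Rightarrow> real" where
  "squash x = (if x = \<infinity> then 2 else if x = -\<infinity> then -2 else arctan (real_of_ereal x))"

lemma squash_measurable [measurable]: "squash \<in> borel_measurable borel"
  unfolding squash_def by measurable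

lemma squash_less: assumes "x < y" shows "squash x < squash y"
  using assms arctan_bounded[of "real_of_ereal x"] arctan_bounded[of "real_of_ereal y"] pi_less_4
  by (cases x; cases y) (auto simp: squash_def arctan_less_iff)

lemma squash_mono: "x \<le> y \<Longrightarrow> squash x \<le> squash y"
  using squash_less[of x y] by (cases "x = y") (auto simp: less_le)

lemma squash_bound: "\<bar>squash x\<bar> \<le> 2"
  using arctan_bounded[of "real_of_ereal x"] pi_less_4 by (auto simp: squash_def)

text \<open>A countable subfamily that maximizes the integral of the squashed supremum.\<close>

lemma (in prob_space) countable_ess_sup:
  fixes S :: "('a \<Rightarrow> ereal) set"
  assumes "S \<noteq> {}" "S \<subseteq> borel_measurable M"
  obtains h :: "nat \<Rightarrow> 'a \<Rightarrow> ereal" where "range h \<subseteq> S"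
    "\<And>f. f \<in> S \<Longrightarrow> AE w in M. f w \<le> (SUP n. h n w)"
proof -
  define \<H> where "\<H> = {h :: nat \<Rightarrow> 'a \<Rightarrow> ereal. range h \<subseteq> S}"
  define J where "J h = (\<integral>w. squash (SUP n. h n w) \<partial>M)" for h :: "nat \<Rightarrow> 'a \<Rightarrow> ereal"
  have meas: "(\<lambda>w. SUP n. h n w) \<in> borel_measurable M" if "h \<in> \<H>" for h
    using that assms(2) unfolding \<H>_def by (intro borel_measurable_SUP) auto
  have int: "integrable M (\<lambda>w. squash (SUP n. h n w))" if "h \<in> \<H>" for h
    using meas[OF that] squash_bound by (intro integrable_const_bound[where B=2]) auto
  have J_mono: "J g \<le> J h" if "g \<in> \<H>" "h \<in> \<H>" "\<And>w. (SUP n. g n w) \<le> (SUP n. h n w)" for g h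
    unfolding J_def using int that by (intro integral_mono squash_mono) auto
  have J2: "J h \<le> 2" if "h \<in> \<H>" for h
  proof -
    have "J h \<le> (\<integral>w. 2 \<partial>M)" unfolding J_def
    proof (rule integral_mono[OF int[OF that]])
      show "squash (SUP n. h n w) \<le> 2" for w using squash_bound[of "SUP n. h n w"] by simp
    qed simp
    then show ?thesis by (simp add: prob_space)
  qed
  have bdd: "bdd_above (J ` \<H>)" using J2 by (intro bdd_aboveI2)
  obtain f0 where "f0 \<in> S" using assms(1) by blast
  then have ne: "\<H> \<noteq> {}" unfolding \<H>_def by (auto intro!: exI[of _ "\<lambda>_. f0"])
  define \<alpha> where "\<alpha> = (SUP h\<in>\<H>. J h)"
  have "\<exists>h\<in>\<H>. \<alpha> - 1 / real (Suc k) < J h" for k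
  proof -
    have "\<alpha> - 1 / real (Suc k) < (SUP h\<in>\<H>. J h)" by (simp add: \<alpha>_def)
    then show ?thesis using less_cSUP_iff[OF ne bdd] by simp
  qed
  then obtain hh where hh: "\<And>k. hh k \<in> \<H>" "\<And>k. \<alpha> - 1 / real (Suc k) < J (hh k)" by metis
  \<comment> \<open>Enumerating pairs merges the countably many almost maximizing families into one
    family, which attains \<open>\<alpha>\<close>.\<close>
  define H where "H n = hh (fst (prod_decode n)) (snd (prod_decode n))" for n
  have H: "H \<in> \<H>" using hh(1) unfolding \<H>_def H_def by auto
  have "J (hh k) \<le> J H" for k
  proof (rule J_mono[OF hh(1) H])
    fix w show "(SUP n. hh k n w) \<le> (SUP n. H n w)"
    proof (rule SUP_least)
      fix n have "hh k n w = H (prod_encode (k, n)) w" by (simp add: H_def)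
      then show "hh k n w \<le> (SUP n. H n w)" by (metis SUP_upper UNIV_I)
    qed
  qed
  then have less: "\<alpha> - 1 / real (Suc k) < J H" for k using hh(2)[of k] by (metis less_le_trans)
  have "\<alpha> \<le> J H"
  proof (rule ccontr)
    assume "\<not> \<alpha> \<le> J H"
    then obtain k where "1 / real (Suc k) < \<alpha> - J H"
      using nat_approx_posE[of "\<alpha> - J H"] by auto
    with less[of k] show False by simp
  qed
  show ?thesis
  proof (rule that)
    show "range H \<subseteq> S" using H by (simp add: \<H>_def)
    fix f assume f: "f \<in> S"
    \<comment> \<open>Adjoining \<open>f\<close> cannot raise the integral above
      \<open>\<alpha>\<close>, so the two squashed suprema agree almost everywhere. As
      \<open>squash\<close> is strictly increasing, \<open>f\<close> already lies below the old
      supremum.\<close>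
    define H' where "H' = case_nat f H"
    have "H n \<in> S" for n using H unfolding \<H>_def by blast
    then have H': "H' \<in> \<H>" using f unfolding \<H>_def H'_def by (auto split: nat.splits)
    have le: "(SUP n. H n w) \<le> (SUP n. H' n w)" and fle: "f w \<le> (SUP n. H' n w)" for w
    proof -
      show "(SUP n. H n w) \<le> (SUP n. H' n w)"
      proof (rule SUP_least)
        fix n have "H n w = H' (Suc n) w" by (simp add: H'_def)
        then show "H n w \<le> (SUP n. H' n w)" by (metis SUP_upper UNIV_I)
      qed
      have "f w = H' 0 w" by (simp add: H'_def)
      then show "f w \<le> (SUP n. H' n w)" by (metis SUP_upper UNIV_I)
    qed
    have "J H' \<le> \<alpha>" unfolding \<alpha>_def by (rule cSUP_upper[OF H' bdd])
    then have "(\<integral>w. squash (SUP n. H' n w) - squash (SUP n. H n w) \<partial>M) \<le> 0"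
      using \<open>\<alpha> \<le> J H\<close> int[OF H] int[OF H'] by (simp add: J_def)
    moreover have nn: "AE w in M. 0 \<le> squash (SUP n. H' n w) - squash (SUP n. H n w)"
      using le by (auto intro: squash_mono)
    ultimately have "(\<integral>w. squash (SUP n. H' n w) - squash (SUP n. H n w) \<partial>M) = 0"
      using integral_nonneg_AE[OF nn] by linarith
    then have "AE w in M. squash (SUP n. H' n w) - squash (SUP n. H n w) = 0"
      using integral_nonneg_eq_0_iff_AE[OF Bochner_Integration.integrable_diff[OF int[OF H'] int[OF H]] nn] by simp
    then show "AE w in M. f w \<le> (SUP n. H n w)"
    proof eventually_elim
      case (elim w)
      then have "\<not> (SUP n. H n w) < (SUP n. H' n w)" using squash_less by force
      then show ?case using fle[of w] by (simp add: order.trans)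
    qed
  qed
qed

section \<open>Suprema and infima of classes\<close>

lemma carrier_L0bar: "carrier (L0bar M) = L0_set M"
  by (simp add: L0bar_def)

lemma le_L0bar: "a \<sqsubseteq>\<^bsub>L0bar M\<^esub> b \<longleftrightarrow> (AE w in M. rep a w \<le> rep b w)"
  by (simp add: L0bar_def)

text \<open>The lattice supremum is a Hilbert choice and says nothing until a least upper bound is
  known to exist. The pointwise supremum of the countable subfamily provides one.\<close>

lemma (in prob_space) L0bar_sup:
  assumes "A \<noteq> {}" "A \<subseteq> L0_set M"
  shows "least (L0bar M) (\<Squnion>\<^bsub>L0bar M\<^esub>A) (Upper (L0bar M) A)"
proof -
  have S: "rep ` A \<noteq> {}" "rep ` A \<subseteq> borel_measurable M" using assms rep_measurable by auto
  obtain h :: "nat \<Rightarrow> 'a \<Rightarrow> ereal" where h: "range h \<subseteq> rep ` A"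
    "\<And>f. f \<in> rep ` A \<Longrightarrow> AE w in M. f w \<le> (SUP n. h n w)"
    by (rule countable_ess_sup[OF S]) (rule that)
  have m: "(\<lambda>w. SUP n. h n w) \<in> borel_measurable M"
    using h(1) S(2) by (intro borel_measurable_SUP) blast+
  let ?g = "cls M (\<lambda>w. SUP n. h n w)"
  note g = rep_cls[OF m]
  have "least (L0bar M) ?g (Upper (L0bar M) A)"
    unfolding least_def
  proof (intro conjI ballI)
    show "Upper (L0bar M) A \<subseteq> carrier (L0bar M)" by (simp add: Upper_def)
    show "?g \<in> Upper (L0bar M) A"
      unfolding Upper_def carrier_L0bar le_L0bar
    proof safe
      fix a assume "a \<in> A"
      then have "AE w in M. rep a w \<le> (SUP n. h n w)" using h(2) by blast
      with g show "AE w in M. rep a w \<le> rep ?g w" by eventually_elim simp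
    qed (rule cls_in_L0_set[OF m])
    fix u assume u: "u \<in> Upper (L0bar M) A"
    have "AE w in M. h n w \<le> rep u w" for n
    proof -
      obtain a where "a \<in> A" "h n = rep a" using h(1) by blast
      then show ?thesis using u assms(2) unfolding Upper_def carrier_L0bar le_L0bar by auto
    qed
    then have "AE w in M. \<forall>n. h n w \<le> rep u w" by (simp add: AE_all_countable)
    with g show "?g \<sqsubseteq>\<^bsub>L0bar M\<^esub> u"
      unfolding le_L0bar by eventually_elim (auto intro: SUP_least)
  qed
  then show ?thesis unfolding sup_def by (rule someI)
qed

lemma (in prob_space) le_L0bar_sup:
  assumes "a \<in> A" "A \<subseteq> L0_set M"
  shows "AE w in M. rep a w \<le> rep (\<Squnion>\<^bsub>L0bar M\<^esub>A) w"
proof -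
  have "A \<noteq> {}" using assms(1) by blast
  from L0bar_sup[OF this assms(2)] have "\<Squnion>\<^bsub>L0bar M\<^esub>A \<in> Upper (L0bar M) A" by (simp add: least_def)
  then show ?thesis using assms unfolding Upper_def carrier_L0bar le_L0bar by blast
qed

text \<open>The essential supremum is applied to the negatives. That countably many members realize
  the infimum is what later turns a bound on an operator norm into a bound on vectors.\<close>

lemma (in prob_space) L0bar_inf:
  assumes "A \<noteq> {}" "A \<subseteq> L0_set M"
  shows "greatest (L0bar M) (\<Sqinter>\<^bsub>L0bar M\<^esub>A) (Lower (L0bar M) A)"
    and "\<exists>a::nat \<Rightarrow> _. range a \<subseteq> A \<and> (AE w in M. rep (\<Sqinter>\<^bsub>L0bar M\<^esub>A) w = (INF n. rep (a n) w))"
proof -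
  let ?S = "(\<lambda>a w. - rep a w) ` A"
  have S: "?S \<noteq> {}" "?S \<subseteq> borel_measurable M" using assms by (auto dest!: subsetD intro!: borel_measurable_uminus_ereal rep_measurable)
  obtain h :: "nat \<Rightarrow> 'a \<Rightarrow> ereal" where h: "range h \<subseteq> ?S"
    "\<And>f. f \<in> ?S \<Longrightarrow> AE w in M. f w \<le> (SUP n. h n w)"
    by (rule countable_ess_sup[OF S]) (rule that)
  have "\<forall>n. \<exists>a\<in>A. h n = (\<lambda>w. - rep a w)" using h(1) by blast
  then obtain a where a: "\<And>n. a n \<in> A" "\<And>n. h n = (\<lambda>w. - rep (a n) w)" by metis
  have SUP_h: "(SUP n. h n w) = - (INF n. rep (a n) w)" for w
    unfolding a(2) by (rule ereal_SUP_uminus_eq)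
  have m: "(\<lambda>w. INF n. rep (a n) w) \<in> borel_measurable M"
    using a(1) assms rep_measurable by (intro borel_measurable_INF) auto
  let ?g = "cls M (\<lambda>w. INF n. rep (a n) w)"
  note g = rep_cls[OF m]
  have great: "greatest (L0bar M) ?g (Lower (L0bar M) A)"
    unfolding greatest_def
  proof (intro conjI ballI)
    show "Lower (L0bar M) A \<subseteq> carrier (L0bar M)" by (simp add: Lower_def)
    show "?g \<in> Lower (L0bar M) A"
      unfolding Lower_def carrier_L0bar le_L0bar
    proof safe
      fix b assume "b \<in> A"
      then have "AE w in M. - rep b w \<le> (SUP n. h n w)" using h(2)[of "\<lambda>w. - rep b w"] by blast
      with g show "AE w in M. rep ?g w \<le> rep b w" by eventually_elim (simp add: SUP_h)
    qed (rule cls_in_L0_set[OF m])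
    fix u assume u: "u \<in> Lower (L0bar M) A"
    have "AE w in M. rep u w \<le> rep (a n) w" for n
      using u a(1)[of n] assms(2) unfolding Lower_def carrier_L0bar le_L0bar by auto
    then have "AE w in M. \<forall>n. rep u w \<le> rep (a n) w" by (simp add: AE_all_countable)
    with g show "u \<sqsubseteq>\<^bsub>L0bar M\<^esub> ?g"
      unfolding le_L0bar by eventually_elim (auto intro: INF_greatest)
  qed
  then show great': "greatest (L0bar M) (\<Sqinter>\<^bsub>L0bar M\<^esub>A) (Lower (L0bar M) A)"
    unfolding inf_def by (rule someI)
  have "AE w in M. rep (\<Sqinter>\<^bsub>L0bar M\<^esub>A) w \<le> rep ?g w" "AE w in M. rep ?g w \<le> rep (\<Sqinter>\<^bsub>L0bar M\<^esub>A) w"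
    using great great' unfolding greatest_def le_L0bar by auto
  with g have "AE w in M. rep (\<Sqinter>\<^bsub>L0bar M\<^esub>A) w = (INF n. rep (a n) w)" by eventually_elim simp
  then show "\<exists>a::nat \<Rightarrow> _. range a \<subseteq> A \<and> (AE w in M. rep (\<Sqinter>\<^bsub>L0bar M\<^esub>A) w = (INF n. rep (a n) w))"
    using a(1) by blast
qed

lemma to_L0bar_measurable: "a \<in> L0_set M \<Longrightarrow> (\<lambda>w. ereal (rep a w)) \<in> borel_measurable M"
  using rep_measurable[of a M] by measurable

lemma to_L0bar_closed: "a \<in> L0_set M \<Longrightarrow> to_L0bar M a \<in> L0_set M"
  unfolding to_L0bar_def by (intro cls_in_L0_set to_L0bar_measurable)

lemma rep_to_L0bar: "a \<in> L0_set M \<Longrightarrow> AE w in M. rep (to_L0bar M a) w = ereal (rep a w)"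
  unfolding to_L0bar_def by (intro rep_cls to_L0bar_measurable)

lemma L0_plus_L0_set: "a \<in> L0_plus M \<Longrightarrow> a \<in> L0_set M"
  by (simp add: L0_plus_def)

text \<open>Being squeezed between zero and a real random variable makes the extended values finite
  almost everywhere.\<close>

lemma to_L0bar_image_if_between:
  assumes a: "a \<in> L0_set M" and \<xi>: "\<xi> \<in> L0_set M"
    and b: "AE w in M. 0 \<le> rep a w" "AE w in M. rep a w \<le> ereal (rep \<xi> w)"
  shows "a \<in> to_L0bar M ` L0_plus M"
proof -
  have ma: "rep a \<in> borel_measurable M" by (rule rep_measurable[OF a])
  have m: "(\<lambda>w. real_of_ereal (rep a w)) \<in> borel_measurable M" using ma by measurable
  let ?r = "cls M (\<lambda>w. real_of_ereal (rep a w))"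
  note r = rep_cls[OF m] and rL = cls_in_L0_set[OF m]
  have eq: "AE w in M. ereal (rep ?r w) = rep a w"
    using r b
  proof eventually_elim
    case (elim w)
    then have "\<bar>rep a w\<bar> \<noteq> \<infinity>" by auto
    then show ?case using elim(1) by (simp add: ereal_real')
  qed
  have "AE w in M. 0 \<le> rep ?r w"
    using eq b(1)
  proof eventually_elim
    case (elim w)
    then have "0 \<le> ereal (rep ?r w)" by simp
    then show ?case by simp
  qed
  then have "?r \<in> L0_plus M" using rL by (simp add: L0_plus_iff)
  moreover have "to_L0bar M ?r = a"
  proof -
    have "cls M (\<lambda>w. ereal (rep ?r w)) = cls M (rep a)"
      by (rule cls_cong[OF to_L0bar_measurable[OF rL] ma eq])
    then show ?thesis by (simp add: to_L0bar_def cls_rep[OF a])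
  qed
  ultimately show ?thesis by blast
qed

lemma L0_bounds_subset: "to_L0bar M ` L0_bounds M X Y T \<subseteq> L0_set M"
  by (auto simp: L0_bounds_def intro: to_L0bar_closed L0_plus_L0_set)

text \<open>The last claim confines the infimum over possibly uncountably many bounds to a sequence,
  so that the exceptional sets can be united into one null set.\<close>

lemma (in prob_space) opnorm_props:
  assumes "L0_bounds M X Y T \<noteq> {}"
  shows "opnorm M X Y T \<in> L0_set M"
    and "AE w in M. 0 \<le> rep (opnorm M X Y T) w"
    and "\<eta> \<in> L0_bounds M X Y T \<Longrightarrow> AE w in M. rep (opnorm M X Y T) w \<le> ereal (rep \<eta> w)"
    and "\<exists>\<eta>::nat \<Rightarrow> _. range \<eta> \<subseteq> L0_bounds M X Y T \<and>
      (AE w in M. rep (opnorm M X Y T) w = (INF n. ereal (rep (\<eta> n) w)))"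
proof -
  let ?B = "to_L0bar M ` L0_bounds M X Y T"
  have B: "?B \<noteq> {}" "?B \<subseteq> L0_set M" using assms L0_bounds_subset[of M X Y T] by simp_all
  show inL: "opnorm M X Y T \<in> L0_set M"
    using L0bar_inf(1)[OF B] unfolding opnorm_def greatest_def Lower_def carrier_L0bar by auto
  obtain a :: "nat \<Rightarrow> _" where a: "range a \<subseteq> ?B" "AE w in M. rep (opnorm M X Y T) w = (INF n. rep (a n) w)"
    using L0bar_inf(2)[OF B] unfolding opnorm_def by blast
  then have "\<forall>n. \<exists>e\<in>L0_bounds M X Y T. a n = to_L0bar M e" by blast
  then obtain e where e: "\<And>n. e n \<in> L0_bounds M X Y T" "\<And>n. a n = to_L0bar M (e n)" by metis
  have eL: "e n \<in> L0_plus M" for n using e(1) by (simp add: L0_bounds_def)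
  have "AE w in M. \<forall>n. rep (a n) w = ereal (rep (e n) w)"
    unfolding AE_all_countable e(2) using rep_to_L0bar[OF L0_plus_L0_set[OF eL]] by blast
  with a(2) have inf: "AE w in M. rep (opnorm M X Y T) w = (INF n. ereal (rep (e n) w))"
    by eventually_elim simp
  then show "\<exists>\<eta>::nat \<Rightarrow> _. range \<eta> \<subseteq> L0_bounds M X Y T \<and>
      (AE w in M. rep (opnorm M X Y T) w = (INF n. ereal (rep (\<eta> n) w)))"
    using e(1) by blast
  have "AE w in M. \<forall>n. 0 \<le> rep (e n) w"
    unfolding AE_all_countable using eL by (simp add: L0_plus_iff)
  with inf show "AE w in M. 0 \<le> rep (opnorm M X Y T) w"
    by eventually_elim (auto intro: INF_greatest)
  assume \<eta>: "\<eta> \<in> L0_bounds M X Y T"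
  then have "AE w in M. rep (opnorm M X Y T) w \<le> rep (to_L0bar M \<eta>) w"
    using L0bar_inf(1)[OF B] B(2) unfolding opnorm_def greatest_def Lower_def carrier_L0bar le_L0bar by auto
  moreover have "\<eta> \<in> L0_set M" using \<eta> by (simp add: L0_bounds_def L0_plus_L0_set)
  ultimately show "AE w in M. rep (opnorm M X Y T) w \<le> ereal (rep \<eta> w)"
    using rep_to_L0bar[of \<eta> M] by (auto elim!: AE_mp)
qed

text \<open>A common bound \<open>\<xi>\<close> dominates all operator norms, so their supremum is
  finite. No module axioms are assumed, so that the lemma applies to
  \<open>graph_module\<close>.\<close>

lemma (in prob_space) locally_as_boundedI:
  assumes "\<And>s. 0 \<le> s \<Longrightarrow> T s \<in> bounded_ops M X X"
    and "\<And>l. 0 < l \<Longrightarrow> \<exists>\<xi>. \<forall>s\<in>{0..l}. \<xi> \<in> L0_bounds M X X (T s)"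
  shows "locally_as_bounded M X T"
  unfolding locally_as_bounded_def
proof (intro conjI allI impI assms(1))
  fix l :: real assume l: "0 < l"
  then obtain \<xi> where \<xi>: "\<And>s. s \<in> {0..l} \<Longrightarrow> \<xi> \<in> L0_bounds M X X (T s)" using assms(2) by metis
  have ne: "L0_bounds M X X (T s) \<noteq> {}" if "s \<in> {0..l}" for s using \<xi>[OF that] by blast
  let ?A = "(\<lambda>s. opnorm M X X (T s)) ` {0..l}"
  have A: "?A \<noteq> {}" "?A \<subseteq> L0_set M" using l opnorm_props(1)[OF ne] by auto
  note sup = L0bar_sup[OF A]
  have \<xi>L: "\<xi> \<in> L0_set M" using \<xi>[of 0] l by (simp add: L0_bounds_def L0_plus_L0_set)
  have aL: "\<Squnion>\<^bsub>L0bar M\<^esub>?A \<in> L0_set M"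
    using sup unfolding least_def Upper_def carrier_L0bar by auto
  have "AE w in M. rep (opnorm M X X (T 0)) w \<le> rep (\<Squnion>\<^bsub>L0bar M\<^esub>?A) w"
    by (rule le_L0bar_sup[OF _ A(2)]) (use l in auto)
  moreover have "AE w in M. 0 \<le> rep (opnorm M X X (T 0)) w" using l by (intro opnorm_props(2) ne) auto
  ultimately have nn: "AE w in M. 0 \<le> rep (\<Squnion>\<^bsub>L0bar M\<^esub>?A) w" by eventually_elim simp
  have "to_L0bar M \<xi> \<in> Upper (L0bar M) ?A"
    unfolding Upper_def carrier_L0bar le_L0bar
  proof safe
    fix s assume s: "s \<in> {0..l}"
    from opnorm_props(3)[OF ne[OF s] \<xi>[OF s]] rep_to_L0bar[OF \<xi>L]
    show "AE w in M. rep (opnorm M X X (T s)) w \<le> rep (to_L0bar M \<xi>) w" by eventually_elim simp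
  qed (rule to_L0bar_closed[OF \<xi>L])
  then have "AE w in M. rep (\<Squnion>\<^bsub>L0bar M\<^esub>?A) w \<le> rep (to_L0bar M \<xi>) w"
    using sup unfolding least_def le_L0bar by blast
  with rep_to_L0bar[OF \<xi>L] have "AE w in M. rep (\<Squnion>\<^bsub>L0bar M\<^esub>?A) w \<le> ereal (rep \<xi> w)"
    by eventually_elim simp
  from to_L0bar_image_if_between[OF aL \<xi>L nn this]
  show "\<Squnion>\<^bsub>L0bar M\<^esub>?A \<in> to_L0bar M ` L0_plus M" .
qed

context RN_module
begin

lemma L0_bounds_iff:
  "\<eta> \<in> L0_bounds M X X T \<longleftrightarrow> \<eta> \<in> L0_plus M \<and>
    (\<forall>z\<in>V. AE w in M. N (T z) w \<le> rep \<eta> w * N z w)"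
proof -
  have "L0_le M (lnorm X (T z)) (\<eta> \<otimes>\<^bsub>L0 M\<^esub> lnorm X z) \<longleftrightarrow> (AE w in M. N (T z) w \<le> rep \<eta> w * N z w)"
    if "\<eta> \<in> L0_plus M" "z \<in> V" for z
    unfolding L0_le_def nrm_def using rep_L0_mult[OF L0_plus_L0_set[OF that(1)] lnorm_L0[OF that(2)]]
    by (auto elim!: AE_mp)
  then show ?thesis unfolding L0_bounds_def by auto
qed

text \<open>The supremum of the operator norms is itself a bound for every operator. Outside one
  null set all bounds of a sequence realizing the operator norm hold for \<open>z\<close>; divide by
  \<open>N z w\<close> and take the infimum. Where \<open>N z w\<close> vanishes, any one of these
  bounds gives the claim.\<close>

lemma locally_as_boundedD:
  assumes "locally_as_bounded M X T" "0 < l"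
  obtains \<xi> where "\<And>s. s \<in> {0..l} \<Longrightarrow> \<xi> \<in> L0_bounds M X X (T s)"
proof -
  let ?A = "(\<lambda>s. opnorm M X X (T s)) ` {0..l}"
  have ne: "L0_bounds M X X (T s) \<noteq> {}" if "s \<in> {0..l}" for s
    using assms(1) that unfolding locally_as_bounded_def bounded_ops_def by auto
  have A: "?A \<noteq> {}" "?A \<subseteq> L0_set M" using assms(2) opnorm_props(1)[OF ne] by auto
  obtain \<xi> where \<xi>: "\<xi> \<in> L0_plus M" "\<Squnion>\<^bsub>L0bar M\<^esub>?A = to_L0bar M \<xi>"
    using assms unfolding locally_as_bounded_def by blast
  show ?thesis
  proof (rule that)
    fix s assume s: "s \<in> {0..l}"
    have "AE w in M. rep (opnorm M X X (T s)) w \<le> rep (to_L0bar M \<xi>) w"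
      unfolding \<xi>(2)[symmetric] by (rule le_L0bar_sup[OF _ A(2)]) (use s in auto)
    with rep_to_L0bar[OF L0_plus_L0_set[OF \<xi>(1)]]
    have op: "AE w in M. rep (opnorm M X X (T s)) w \<le> ereal (rep \<xi> w)" by eventually_elim simp
    obtain \<eta> :: "nat \<Rightarrow> _" where \<eta>: "\<And>n. \<eta> n \<in> L0_bounds M X X (T s)"
      "AE w in M. rep (opnorm M X X (T s)) w = (INF n. ereal (rep (\<eta> n) w))"
      using opnorm_props(4)[OF ne[OF s]] by blast
    show "\<xi> \<in> L0_bounds M X X (T s)"
      unfolding L0_bounds_iff
    proof (intro conjI ballI \<xi>(1))
      fix z assume z: "z \<in> V"
      have "AE w in M. \<forall>n. N (T s z) w \<le> rep (\<eta> n) w * N z w"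
        unfolding AE_all_countable using \<eta>(1) z unfolding L0_bounds_iff by blast
      with op \<eta>(2) nrm_nonneg[OF z] show "AE w in M. N (T s z) w \<le> rep \<xi> w * N z w"
      proof eventually_elim
        case (elim w)
        show ?case
        proof (cases "N z w = 0")
          case True
          then show ?thesis using elim(4)[rule_format, of 0] by simp
        next
          case False
          then have pos: "0 < N z w" using elim by simp
          have "ereal (N (T s z) w / N z w) \<le> (INF n. ereal (rep (\<eta> n) w))"
          proof (rule INF_greatest)
            fix n show "ereal (N (T s z) w / N z w) \<le> ereal (rep (\<eta> n) w)"
              using elim(4)[rule_format, of n] pos by (simp add: divide_le_eq)
          qed
          also have "\<dots> \<le> ereal (rep \<xi> w)" using elim by simp
          finally show ?thesis using pos by (simp add: divide_le_eq)
        qed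
      qed
    qed
  qed
qed

end

lemma limitin_compose_filter:
  assumes "limitin Y g x G" "filterlim \<phi> G F"
  shows "limitin Y (\<lambda>i. g (\<phi> i)) x F"
  using assms(1) eventually_compose_filterlim[OF _ assms(2)] unfolding limitin_def by blast

context RN_module
begin

section \<open>Almost surely bounded operators\<close>

lemma op_closed: "T \<in> ops \<Longrightarrow> x \<in> V \<Longrightarrow> T x \<in> V"
  by (auto simp: bounded_ops_def linear_op_def)

lemma op_add: "T \<in> ops \<Longrightarrow> x \<in> V \<Longrightarrow> y \<in> V \<Longrightarrow> T (x +\<^sub>X y) = T x +\<^sub>X T y"
  by (auto simp: bounded_ops_def linear_op_def)

lemma op_smult: "T \<in> ops \<Longrightarrow> x \<in> V \<Longrightarrow> T (c \<odot>\<^sub>X x) = c \<odot>\<^sub>X T x"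
  by (auto simp: bounded_ops_def linear_op_def)

lemma op_rscale: "T \<in> ops \<Longrightarrow> x \<in> V \<Longrightarrow> T (r *\<^sub>X x) = r *\<^sub>X T x"
  by (simp add: rscale_def op_smult)

lemma op_zero: "T \<in> ops \<Longrightarrow> T 0\<^sub>X = 0\<^sub>X"
  using op_rscale[of T "0\<^sub>X" 0] op_closed[of T "0\<^sub>X"] by simp

lemma op_diff:
  assumes "T \<in> ops" "x \<in> V" "y \<in> V" shows "T (x -\<^sub>X y) = T x -\<^sub>X T y"
  using assms op_rscale[OF assms(1,3), of "-1"] op_closed[OF assms(1)]
  by (simp add: a_minus_def op_add rscale_uminus_left)

lemma L0_bounds_weight:
  assumes "\<eta> \<in> L0_bounds M X X T"
  shows "weight M (\<lambda>w. 1 + \<bar>rep \<eta> w\<bar>)"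
    and "z \<in> V \<Longrightarrow> AE w in M. N (T z) w \<le> (1 + \<bar>rep \<eta> w\<bar>) * N z w"
proof -
  have \<eta>: "\<eta> \<in> L0_plus M" "\<And>z. z \<in> V \<Longrightarrow> AE w in M. N (T z) w \<le> rep \<eta> w * N z w"
    using assms unfolding L0_bounds_iff by auto
  show "weight M (\<lambda>w. 1 + \<bar>rep \<eta> w\<bar>)" by (intro weight_abs rep_measurable L0_plus_L0_set \<eta>)
  assume z: "z \<in> V"
  show "AE w in M. N (T z) w \<le> (1 + \<bar>rep \<eta> w\<bar>) * N z w"
    using \<eta>(2)[OF z] nrm_nonneg[OF z]
  proof eventually_elim
    case (elim w)
    have "rep \<eta> w * N z w \<le> (1 + \<bar>rep \<eta> w\<bar>) * N z w" using elim(2) by (intro mult_right_mono) auto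
    then show ?case using elim(1) by simp
  qed
qed

lemma op_bound:
  assumes "T \<in> ops"
  obtains b where "weight M b" "\<And>z. z \<in> V \<Longrightarrow> AE w in M. N (T z) w \<le> b w * N z w"
proof -
  obtain \<eta> where "\<eta> \<in> L0_bounds M X X T" using assms unfolding bounded_ops_def by auto
  from that[OF L0_bounds_weight(1)[OF this] L0_bounds_weight(2)[OF this]] show thesis by simp
qed

lemma bounded_opsI:
  assumes "\<And>x. x \<in> V \<Longrightarrow> T x \<in> V"
    and "\<And>x y. x \<in> V \<Longrightarrow> y \<in> V \<Longrightarrow> T (x +\<^sub>X y) = T x +\<^sub>X T y"
    and "\<And>c x. x \<in> V \<Longrightarrow> T (c \<odot>\<^sub>X x) = c \<odot>\<^sub>X T x"
    and b: "weight M b" "\<And>z. z \<in> V \<Longrightarrow> AE w in M. N (T z) w \<le> b w * N z w"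
  shows "T \<in> ops"
proof -
  have bm: "b \<in> borel_measurable M" using b(1) by (rule weight_measurable)
  note r = rep_cls[OF bm]
  have "cls M b \<in> L0_plus M"
    unfolding L0_plus_iff using r weight_pos[OF b(1)]
    by (auto intro: cls_in_L0_set[OF bm] elim!: AE_mp simp: less_imp_le)
  moreover have "AE w in M. N (T z) w \<le> rep (cls M b) w * N z w" if "z \<in> V" for z
    using r b(2)[OF that] by eventually_elim simp
  ultimately have "cls M b \<in> L0_bounds M X X T" unfolding L0_bounds_iff by blast
  then show ?thesis unfolding bounded_ops_def linear_op_def using assms(1-3) by auto
qed

text \<open>As a bounded operator, scalar multiplication is covered by the commutation lemmas for
  \<open>S\<close> and for the generator.\<close>

lemma smult_op: "(\<lambda>x. c \<odot>\<^sub>X x) \<in> ops"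
proof (rule bounded_opsI)
  show "weight M (\<lambda>_. 1 + norm c)" by (auto simp: weight_def add_pos_nonneg)
  fix z assume z: "z \<in> V"
  show "AE w in M. N (c \<odot>\<^sub>X z) w \<le> (1 + norm c) * N z w"
    using nrm_const_smult[OF z, of c] nrm_nonneg[OF z] by eventually_elim (simp add: distrib_right)
next
  fix a x assume "x \<in> V"
  then show "c \<odot>\<^sub>X (a \<odot>\<^sub>X x) = a \<odot>\<^sub>X (c \<odot>\<^sub>X x)"
    by (simp add: R.m_comm flip: smult_assoc1)
qed (auto simp: smult_r_distr)

lemma lim_op:
  assumes T: "T \<in> ops" and z: "xlim z x F"
  shows "xlim (\<lambda>i. T (z i)) (T x) F"
proof -
  note x = limD(1)[OF z] and ev = limD(2)[OF z]
  obtain b where b: "weight M b" "\<And>z. z \<in> V \<Longrightarrow> AE w in M. N (T z) w \<le> b w * N z w"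
    using op_bound[OF T] by blast
  have "xlim (\<lambda>i. z i -\<^sub>X x) 0\<^sub>X F" using z lim_shift[OF x ev] by simp
  then have "xlim (\<lambda>i. T (z i) -\<^sub>X T x) 0\<^sub>X F"
  proof (rule lim_dominated[OF _ b(1)])
    show "eventually (\<lambda>i. T (z i) -\<^sub>X T x \<in> V \<and>
        (AE w in M. N (T (z i) -\<^sub>X T x) w \<le> b w * N (z i -\<^sub>X x) w)) F"
      using ev
    proof eventually_elim
      case (elim i)
      then show ?case using b(2)[of "z i -\<^sub>X x"] x op_closed[OF T] by (simp add: op_diff[OF T])
    qed
  qed
  moreover have "eventually (\<lambda>i. T (z i) \<in> V) F" using ev by eventually_elim (rule op_closed[OF T])
  ultimately show ?thesis using lim_shift[of "T x" "\<lambda>i. T (z i)" F] op_closed[OF T x] by simp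
qed

lemma loc_lip_op:
  assumes T: "T \<in> ops" and F: "loc_lip F" shows "loc_lip (\<lambda>s. T (F s))"
  unfolding loc_lip_def
proof (intro conjI allI impI)
  fix l :: real assume l: "0 \<le> l"
  obtain a where a: "weight M a" "\<And>s t. s \<in> {0..l} \<Longrightarrow> t \<in> {0..l} \<Longrightarrow>
      AE w in M. N (F s -\<^sub>X F t) w \<le> a w * \<bar>s - t\<bar>" using loc_lipE[OF F l] by metis
  obtain b where b: "weight M b" "\<And>z. z \<in> V \<Longrightarrow> AE w in M. N (T z) w \<le> b w * N z w"
    using op_bound[OF T] by blast
  show "\<exists>b. weight M b \<and> (\<forall>s\<in>{0..l}. \<forall>t\<in>{0..l}. AE w in M. N (T (F s) -\<^sub>X T (F t)) w \<le> b w * \<bar>s - t\<bar>)"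
  proof (intro exI[of _ "\<lambda>w. b w * a w"] conjI ballI)
    fix s t assume st: "s \<in> {0..l}" "t \<in> {0..l}"
    then have V: "F s \<in> V" "F t \<in> V" using F by (auto simp: loc_lip_closed)
    show "AE w in M. N (T (F s) -\<^sub>X T (F t)) w \<le> b w * a w * \<bar>s - t\<bar>"
      using a(2)[OF st] b(2)[OF vminus_closed[OF V]]
      unfolding op_diff[OF T V]
    proof eventually_elim
      case (elim w)
      have "b w * N (F s -\<^sub>X F t) w \<le> b w * (a w * \<bar>s - t\<bar>)"
        using elim(1) weight_pos[OF b(1), of w] by (intro mult_left_mono) auto
      then show ?case using elim(2) by (simp add: mult.assoc)
    qed
  qed (use a b weight_mult in auto)
qed (use T F loc_lip_closed op_closed in auto)

lemma primitive_op:
  assumes T: "T \<in> ops" and F: "primitive f F"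
  shows "primitive (\<lambda>s. T (f s)) (\<lambda>s. T (F s))"
  unfolding primitive_def
proof (intro conjI allI impI)
  show "T (F 0) = 0\<^sub>X" using F op_zero[OF T] by (simp add: primitive_def)
  show "loc_lip (\<lambda>s. T (F s))" using F loc_lip_op[OF T] by (simp add: primitive_def)
  fix s :: real assume s: "0 \<le> s"
  show "has_deriv (\<lambda>s. T (F s)) (T (f s)) s"
    unfolding has_derivative_halfline_def
  proof (rule limitin_transform_eventually)
    show "xlim (\<lambda>t. T ((1 / (t - s)) *\<^sub>X (F t -\<^sub>X F s))) (T (f s)) (at s within {0..})"
      using F s by (intro lim_op[OF T]) (simp add: primitive_def has_derivative_halfline_def)
    show "eventually (\<lambda>t. T ((1 / (t - s)) *\<^sub>X (F t -\<^sub>X F s)) = (1 / (t - s)) *\<^sub>X (T (F t) -\<^sub>X T (F s)))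
        (at s within {0..})"
      unfolding eventually_at_filter
      by (rule always_eventually) (use s primitive_closed[OF F] in \<open>auto simp: op_rscale[OF T] op_diff[OF T]\<close>)
  qed
qed

lemma primitive_diff:
  assumes "primitive f F" "primitive g G" shows "primitive (\<lambda>s. f s -\<^sub>X g s) (\<lambda>s. F s -\<^sub>X G s)"
  unfolding primitive_def
proof (intro conjI allI impI)
  show "F 0 -\<^sub>X G 0 = 0\<^sub>X" using assms by (simp add: primitive_def diff_zero)
  show "loc_lip (\<lambda>s. F s -\<^sub>X G s)" using assms by (simp add: primitive_def loc_lip_diff)
  fix s :: real assume "0 \<le> s"
  then show "has_deriv (\<lambda>s. F s -\<^sub>X G s) (f s -\<^sub>X g s) s"
    using assms by (intro derivative_diff primitive_closed[OF assms(1)] primitive_closed[OF assms(2)]) (auto simp: primitive_def)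
qed

text \<open>The substitution rule for translations; subtracting \<open>F h\<close> restores the
  initial value zero.\<close>

lemma primitive_shift:
  assumes F: "primitive f F" and h: "0 \<le> h"
  shows "primitive (\<lambda>s. f (s + h)) (\<lambda>s. F (s + h) -\<^sub>X F h)"
  unfolding primitive_def
proof (intro conjI allI impI)
  note FV = primitive_closed[OF F]
  show "F (0 + h) -\<^sub>X F h = 0\<^sub>X" using FV[OF h] by (simp add: diff_self)
  show "loc_lip (\<lambda>s. F (s + h) -\<^sub>X F h)"
    unfolding loc_lip_def
  proof (intro conjI allI impI)
    fix l :: real assume "0 \<le> l"
    then have lh: "0 \<le> l + h" using h by simp
    have FL: "loc_lip F" using F by (simp add: primitive_def)
    obtain a where a: "weight M a" "\<And>s t. s \<in> {0..l + h} \<Longrightarrow> t \<in> {0..l + h} \<Longrightarrow>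
        AE w in M. N (F s -\<^sub>X F t) w \<le> a w * \<bar>s - t\<bar>" using loc_lipE[OF FL lh] by metis
    show "\<exists>b. weight M b \<and> (\<forall>s\<in>{0..l}. \<forall>t\<in>{0..l}.
        AE w in M. N (F (s + h) -\<^sub>X F h -\<^sub>X (F (t + h) -\<^sub>X F h)) w \<le> b w * \<bar>s - t\<bar>)"
    proof (intro exI[of _ a] conjI ballI a(1))
      fix s t assume "s \<in> {0..l}" "t \<in> {0..l}"
      then show "AE w in M. N (F (s + h) -\<^sub>X F h -\<^sub>X (F (t + h) -\<^sub>X F h)) w \<le> a w * \<bar>s - t\<bar>"
        using a(2)[of "s + h" "t + h"] h FV by (simp add: diff_diff_cancel)
    qed
  qed (use FV h in auto)
  fix s :: real assume s: "0 \<le> s"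
  have "has_deriv F (f (s + h)) (s + h)" using F s h by (simp add: primitive_def)
  moreover have "filterlim (\<lambda>t. t + h) (at (s + h) within {0..}) (at s within {0..})"
    unfolding filterlim_at using h
    by (auto simp: eventually_at_filter intro!: tendsto_intros always_eventually)
  ultimately have "xlim (\<lambda>t. (1 / (t + h - (s + h))) *\<^sub>X (F (t + h) -\<^sub>X F (s + h))) (f (s + h)) (at s within {0..})"
    unfolding has_derivative_halfline_def by (rule limitin_compose_filter)
  then show "has_deriv (\<lambda>s. F (s + h) -\<^sub>X F h) (f (s + h)) s"
    unfolding has_derivative_halfline_def
  proof (rule limitin_transform_eventually[rotated])
    show "eventually (\<lambda>t. (1 / (t + h - (s + h))) *\<^sub>X (F (t + h) -\<^sub>X F (s + h)) =
        (1 / (t - s)) *\<^sub>X (F (t + h) -\<^sub>X F h -\<^sub>X (F (s + h) -\<^sub>X F h))) (at s within {0..})"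
      unfolding eventually_at_filter
      by (rule always_eventually) (use s h FV in \<open>auto simp: diff_diff_cancel\<close>)
  qed
qed

text \<open>All tags lie in \<open>[0,s]\<close>, so corresponding Riemann sums are equal for every
  tagged division.\<close>

lemma has_riemann_integral_cong:
  assumes "has_rint f I 0 s" "\<And>u. u \<in> {0..s} \<Longrightarrow> f u = g u \<and> g u \<in> V"
  shows "has_rint g I 0 s"
  unfolding has_riemann_integral_def
proof (rule limitin_transform_eventually)
  show "xlim (\<lambda>p. rsum f p) I (riemann_filter 0 s)"
    using assms(1) by (simp add: has_riemann_integral_def)
  show "eventually (\<lambda>p. rsum f p = rsum g p) (riemann_filter 0 s)"
    unfolding eventually_riemann_filter
  proof (intro exI[of _ 1] conjI allI impI)
    fix p assume p: "p tagged_division_of {0..s} \<and> (\<forall>(t, K)\<in>p. measure lborel K < 1)"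
    have "fst tK \<in> {0..s}" if "tK \<in> p" for tK
      using p that tagged_division_ofD(2,3)[of p "{0..s}" "fst tK" "snd tK"] by auto
    then show "rsum f p = rsum g p"
      using assms(2) by (intro M.finsum_cong') auto
  qed simp
qed

end

section \<open>\<open>C\<close>-semigroups\<close>

locale bounded_C_semigroup = RN_module M X
  for M :: "'w measure"
    and X :: "('w, 'k::{real_normed_field,second_countable_topology}, 'x) rn_module" +
  fixes C :: "'x \<Rightarrow> 'x" and T :: "real \<Rightarrow> 'x \<Rightarrow> 'x"
  assumes complete: "el_complete M X"
    and semigroup: "C_semigroup M X C T"
    and bounded: "locally_as_bounded M X T"
begin

lemma C_op: "C \<in> ops"
  and C_inj: "inj_on C V"
  and T_op: "0 \<le> s \<Longrightarrow> T s \<in> ops"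
  and T_continuous: "z \<in> V \<Longrightarrow> cont\<^sub>X (\<lambda>s. T s z)"
  and T_0: "z \<in> V \<Longrightarrow> T 0 z = C z"
  and C_T_add: "0 \<le> s \<Longrightarrow> 0 \<le> t \<Longrightarrow> z \<in> V \<Longrightarrow> C (T (s + t) z) = T s (T t z)"
  using semigroup by (auto simp: C_semigroup_def)

lemmas C_closed = op_closed[OF C_op]
lemmas T_closed = op_closed[OF T_op]

text \<open>Both sides equal \<open>C (T (s + t) z)\<close>.\<close>

lemma T_commute: "0 \<le> s \<Longrightarrow> 0 \<le> t \<Longrightarrow> z \<in> V \<Longrightarrow> T s (T t z) = T t (T s z)"
  by (metis C_T_add add.commute)

lemma C_T_commute: "0 \<le> s \<Longrightarrow> z \<in> V \<Longrightarrow> C (T s z) = T s (C z)"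
  using C_T_add[of s 0 z] by (simp add: T_0)

lemma T_bound:
  assumes "0 \<le> l"
  obtains b where "weight M b" "\<And>s z. s \<in> {0..l} \<Longrightarrow> z \<in> V \<Longrightarrow> AE w in M. N (T s z) w \<le> b w * N z w"
proof -
  \<comment> \<open>Local boundedness speaks of intervals with positive right end only; enlarging
    the interval covers \<open>l = 0\<close>.\<close>
  have "0 < l + 1" using assms by simp
  then obtain \<xi> where \<xi>: "\<And>s. s \<in> {0..l + 1} \<Longrightarrow> \<xi> \<in> L0_bounds M X X (T s)"
    using locally_as_boundedD[OF bounded] by metis
  show ?thesis
  proof (rule that)
    show "weight M (\<lambda>w. 1 + \<bar>rep \<xi> w\<bar>)" using L0_bounds_weight(1)[OF \<xi>[of 0]] assms by simp
    fix s z assume "s \<in> {0..l}" "z \<in> V"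
    then show "AE w in M. N (T s z) w \<le> (1 + \<bar>rep \<xi> w\<bar>) * N z w"
      using L0_bounds_weight(2)[OF \<xi>[of s]] by simp
  qed
qed

lemma T_loc_bounded: assumes z: "z \<in> V" shows "loc_bounded (\<lambda>u. T u z)"
  unfolding loc_bounded_def
proof (intro allI impI)
  fix l :: real assume "0 \<le> l"
  then obtain b where b: "weight M b" "\<And>s z. s \<in> {0..l} \<Longrightarrow> z \<in> V \<Longrightarrow> AE w in M. N (T s z) w \<le> b w * N z w"
    using T_bound by metis
  show "\<exists>b. weight M b \<and> (\<forall>u\<in>{0..l}. AE w in M. N (T u z) w \<le> b w)"
  proof (intro exI[of _ "\<lambda>w. b w * (1 + \<bar>N z w\<bar>)"] conjI ballI)
    show "weight M (\<lambda>w. b w * (1 + \<bar>N z w\<bar>))" by (intro weight_mult weight_abs b nrm_measurable z)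
    fix u assume "u \<in> {0..l}"
    from b(2)[OF this z] show "AE w in M. N (T u z) w \<le> b w * (1 + \<bar>N z w\<bar>)"
    proof eventually_elim
      case (elim w)
      have "b w * N z w \<le> b w * (1 + \<bar>N z w\<bar>)" using weight_pos[OF b(1), of w] by (intro mult_left_mono) auto
      then show ?case using elim by simp
    qed
  qed
qed

text \<open>For each \<open>z\<close> a whole primitive is chosen, not a value for each
  \<open>s\<close>. Compatibility with differences, operators and shifts is recovered from
  uniqueness of primitives.\<close>

definition S :: "real \<Rightarrow> 'x \<Rightarrow> 'x" where
  "S s z = (SOME F. primitive (\<lambda>u. T u z) F \<and> (\<forall>s\<ge>0. has_rint (\<lambda>u. T u z) (F s) 0 s) \<and>
    (\<forall>l \<beta>. \<beta> \<in> borel_measurable M \<longrightarrow> (\<forall>u\<in>{0..l}. AE w in M. N (T u z) w \<le> \<beta> w) \<longrightarrow>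
      (\<forall>s\<in>{0..l}. \<forall>t\<in>{0..l}. AE w in M. N (F s -\<^sub>X F t) w \<le> \<beta> w * \<bar>s - t\<bar>))) s"

lemma
  assumes z: "z \<in> V"
  shows S_primitive: "primitive (\<lambda>u. T u z) (\<lambda>s. S s z)"
    and S_integral: "0 \<le> s \<Longrightarrow> has_rint (\<lambda>u. T u z) (S s z) 0 s"
    and S_lipschitz: "\<beta> \<in> borel_measurable M \<Longrightarrow> (\<And>u. u \<in> {0..l} \<Longrightarrow> AE w in M. N (T u z) w \<le> \<beta> w) \<Longrightarrow>
      s \<in> {0..l} \<Longrightarrow> t \<in> {0..l} \<Longrightarrow> AE w in M. N (S s z -\<^sub>X S t z) w \<le> \<beta> w * \<bar>s - t\<bar>"
proof -
  note ex = someI_ex[OF primitive_exists[OF complete T_continuous[OF z] T_loc_bounded[OF z]]]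
  show "primitive (\<lambda>u. T u z) (\<lambda>s. S s z)" using ex unfolding S_def by blast
  show "0 \<le> s \<Longrightarrow> has_rint (\<lambda>u. T u z) (S s z) 0 s" using ex unfolding S_def by blast
  assume "\<beta> \<in> borel_measurable M" "\<And>u. u \<in> {0..l} \<Longrightarrow> AE w in M. N (T u z) w \<le> \<beta> w" "s \<in> {0..l}" "t \<in> {0..l}"
  then show "AE w in M. N (S s z -\<^sub>X S t z) w \<le> \<beta> w * \<bar>s - t\<bar>" using ex unfolding S_def by blast
qed

lemma S_closed: "0 \<le> s \<Longrightarrow> z \<in> V \<Longrightarrow> S s z \<in> V"
  using primitive_closed[OF S_primitive] .

lemma S_0: "z \<in> V \<Longrightarrow> S 0 z = 0\<^sub>X"
  using S_primitive by (simp add: primitive_def)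

lemma S_derivative: "z \<in> V \<Longrightarrow> 0 \<le> s \<Longrightarrow> has_deriv (\<lambda>s. S s z) (T s z) s"
  using S_primitive by (simp add: primitive_def)

text \<open>Both sides are primitives of \<open>T u (R z)\<close> as functions of the upper
  limit.\<close>

lemma S_commute:
  assumes R: "R \<in> ops" and comm: "\<And>u. 0 \<le> u \<Longrightarrow> R (T u z) = T u (R z)"
    and z: "z \<in> V" "0 \<le> s"
  shows "R (S s z) = S s (R z)"
  by (rule primitive_unique[OF primitive_op[OF R S_primitive[OF z(1)]] S_primitive[OF op_closed[OF R z(1)]] _ z(2)])
    (simp add: comm)

lemma S_diff: "x \<in> V \<Longrightarrow> y \<in> V \<Longrightarrow> 0 \<le> s \<Longrightarrow> S s (x -\<^sub>X y) = S s x -\<^sub>X S s y"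
  by (rule primitive_unique[OF S_primitive primitive_diff[OF S_primitive S_primitive]]) (auto simp: op_diff T_op)

lemma T_S: assumes z: "z \<in> V" and "0 \<le> s" "0 \<le> h" shows "T h (S s z) = C (S (s + h) z -\<^sub>X S h z)"
  by (rule primitive_unique[OF primitive_op[OF T_op S_primitive] primitive_op[OF C_op primitive_shift[OF S_primitive]]])
    (use assms in \<open>simp_all add: C_T_add T_commute[of h]\<close>)

text \<open>The Lipschitz constant \<open>b w * N (y i) w\<close> of the primitive, used between
  \<open>0\<close> and \<open>s\<close>, bounds \<open>S s (y i)\<close> by a multiple of the norm
  of \<open>y i\<close>.\<close>

lemma S_lim_zero:
  assumes "xlim y 0\<^sub>X F" "0 \<le> s" shows "xlim (\<lambda>i. S s (y i)) 0\<^sub>X F"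
proof -
  obtain b where b: "weight M b" "\<And>u z. u \<in> {0..s} \<Longrightarrow> z \<in> V \<Longrightarrow> AE w in M. N (T u z) w \<le> b w * N z w"
    using T_bound[OF assms(2)] by metis
  show ?thesis
  proof (rule lim_dominated[OF assms(1)])
    show "weight M (\<lambda>w. b w * (1 + \<bar>s\<bar>))" by (intro weight_mult b weight_abs) simp
    show "eventually (\<lambda>i. S s (y i) \<in> V \<and>
        (AE w in M. N (S s (y i)) w \<le> b w * (1 + \<bar>s\<bar>) * N (y i) w)) F"
      using limD(2)[OF assms(1)]
    proof eventually_elim
      case (elim i)
      note [measurable] = weight_measurable[OF b(1)] nrm_measurable[OF elim]
      have "AE w in M. N (S s (y i) -\<^sub>X S 0 (y i)) w \<le> (b w * N (y i) w) * \<bar>s - 0\<bar>"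
        by (rule S_lipschitz[OF elim, where l=s]) (use assms(2) b(2)[OF _ elim] in auto)
      then have "AE w in M. N (S s (y i)) w \<le> b w * (1 + \<bar>s\<bar>) * N (y i) w"
        using nrm_nonneg[OF elim]
      proof eventually_elim
        case (elim w)
        have "0 \<le> b w * N (y i) w" using elim(2) weight_pos[OF b(1), of w] by simp
        then show ?case using elim(1) S_closed[OF assms(2) \<open>y i \<in> V\<close>] \<open>y i \<in> V\<close>
          by (simp add: S_0 diff_zero algebra_simps)
      qed
      then show ?case using S_closed[OF assms(2) elim] by simp
    qed
  qed
qed

lemma S_lim:
  assumes "xlim y x F" "0 \<le> s" shows "xlim (\<lambda>i. S s (y i)) (S s x) F"
proof -
  note x = limD(1)[OF assms(1)] and ev = limD(2)[OF assms(1)]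
  have "xlim (\<lambda>i. y i -\<^sub>X x) 0\<^sub>X F" using assms(1) lim_shift[OF x ev] by simp
  from S_lim_zero[OF this assms(2)] have "xlim (\<lambda>i. S s (y i) -\<^sub>X S s x) 0\<^sub>X F"
    by (rule limitin_transform_eventually[rotated]) (use ev x assms(2) in \<open>auto elim!: eventually_mono simp: S_diff\<close>)
  moreover have "eventually (\<lambda>i. S s (y i) \<in> V) F"
    using ev by eventually_elim (use S_closed assms(2) in auto)
  ultimately show ?thesis using lim_shift[of "S s x" "\<lambda>i. S s (y i)" F] S_closed[OF assms(2) x] by simp
qed

text \<open>The graph of the generator as a relation. It avoids the definite description and the
  inverse of \<open>C\<close> in \<open>generator\<close>, and \<open>G_iff\<close> translates
  back.\<close>

definition G :: "'x \<Rightarrow> 'x \<Rightarrow> bool" where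
  "G z y \<longleftrightarrow> z \<in> V \<and> y \<in> V \<and> generator_limit M X C T z (C y)"

lemma C_cancel: "x \<in> V \<Longrightarrow> y \<in> V \<Longrightarrow> C x = C y \<Longrightarrow> x = y"
  using C_inj by (auto dest: inj_onD)

lemma G_unique: "G z y \<Longrightarrow> G z y' \<Longrightarrow> y = y'"
  unfolding G_def generator_limit_def by (rule C_cancel) (auto intro: lim_unique)

lemma G_dom: "z \<in> generator_dom M X C T \<longleftrightarrow> (\<exists>y. G z y)"
  by (auto simp: generator_dom_def G_def)

lemma G_generator: assumes "G z y" shows "generator M X C T z = y"
proof -
  have "(THE y. generator_limit M X C T z y) = C y"
  proof (rule the_equality)
    show lim: "generator_limit M X C T z (C y)" using assms by (simp add: G_def)
    show "y' = C y" if "generator_limit M X C T z y'" for y'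
      using that lim unfolding generator_limit_def by (rule lim_unique) simp
  qed
  then show ?thesis using assms C_inj by (simp add: generator_def G_def the_inv_into_f_f)
qed

lemma T_lim: "0 \<le> s \<Longrightarrow> z \<in> V \<Longrightarrow> xlim (\<lambda>u. T u z) (T s z) (at s within {0..})"
  using T_continuous by (simp add: continuous_on_halfline_iff)

lemma eventually_right: "(\<And>t::real. 0 < t \<Longrightarrow> P t) \<Longrightarrow> eventually P (at_right 0)"
  by (auto simp: eventually_at_filter)

lemma S_slope_lim:
  assumes z: "z \<in> V" and s: "0 \<le> s"
  shows "xlim (\<lambda>t. (1 / t) *\<^sub>X (S (s + t) z -\<^sub>X S s z)) (T s z) (at_right 0)"
proof -
  have "filterlim (\<lambda>t. s + t) (at s within {0..}) (at_right 0)"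
    unfolding filterlim_at using s
    by (auto intro!: eventually_right tendsto_eq_intros)
  from limitin_compose_filter[OF S_derivative[OF z s, unfolded has_derivative_halfline_def] this]
  show ?thesis by simp
qed

text \<open>By \<open>T_S\<close>, applying \<open>T t\<close> minus \<open>C\<close> to
  \<open>S s z\<close> is \<open>C\<close> applied to the difference of the increments of the
  primitive over \<open>[s, s + t]\<close> and over \<open>[0, t]\<close>.\<close>

lemma generator_limit_S:
  assumes z: "z \<in> V" and s: "0 \<le> s"
  shows "generator_limit M X C T (S s z) (C (T s z -\<^sub>X C z))"
  unfolding generator_limit_def
proof (rule limitin_transform_eventually)
  show "xlim (\<lambda>t. C ((1 / t) *\<^sub>X (S (s + t) z -\<^sub>X S s z) -\<^sub>X (1 / t) *\<^sub>X (S (0 + t) z -\<^sub>X S 0 z)))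
      (C (T s z -\<^sub>X C z)) (at_right 0)"
    \<comment> \<open>With \<open>C z\<close> read as \<open>T 0 z\<close>, both limits are
      instances of \<open>S_slope_lim\<close>, at \<open>s\<close> and at \<open>0\<close>.\<close>
    unfolding T_0[OF z, symmetric] by (intro lim_op[OF C_op] lim_diff S_slope_lim z s order_refl)
  show "eventually (\<lambda>t. C ((1 / t) *\<^sub>X (S (s + t) z -\<^sub>X S s z) -\<^sub>X (1 / t) *\<^sub>X (S (0 + t) z -\<^sub>X S 0 z)) =
      (1 / t) *\<^sub>X (T t (S s z) -\<^sub>X C (S s z))) (at_right 0)"
  proof (rule eventually_right)
    fix t :: real assume t: "0 < t"
    have SV: "S (s + t) z \<in> V" "S s z \<in> V" "S t z \<in> V" using S_closed z s t by auto
    have "T t (S s z) -\<^sub>X C (S s z) = C (S (s + t) z -\<^sub>X S t z -\<^sub>X S s z)"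
      using T_S[OF z s, of t] t SV by (simp add: op_diff[OF C_op])
    also have "S (s + t) z -\<^sub>X S t z -\<^sub>X S s z = (S (s + t) z -\<^sub>X S s z) -\<^sub>X S t z"
      using SV by (simp add: a_minus_def M.a_ac)
    finally show "C ((1 / t) *\<^sub>X (S (s + t) z -\<^sub>X S s z) -\<^sub>X (1 / t) *\<^sub>X (S (0 + t) z -\<^sub>X S 0 z)) =
        (1 / t) *\<^sub>X (T t (S s z) -\<^sub>X C (S s z))"
      using SV z by (simp add: S_0 diff_zero op_rscale[OF C_op] flip: rscale_diff)
  qed
qed

lemma G_S: "z \<in> V \<Longrightarrow> 0 \<le> s \<Longrightarrow> G (S s z) (T s z -\<^sub>X C z)"
  unfolding G_def using generator_limit_S S_closed T_closed C_closed by simp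

lemma G_limD: "G z y \<Longrightarrow> xlim (\<lambda>t. (1 / t) *\<^sub>X (T t z -\<^sub>X C z)) (C y) (at_right 0)"
  by (simp add: G_def generator_limit_def)

text \<open>Apply the continuous map \<open>S s\<close> to the difference quotients that define
  \<open>A z\<close>. As \<open>S s\<close> commutes with \<open>T t\<close>, \<open>C\<close> and
  scalars, they become the quotients for \<open>S s z\<close>, whose limit is known. Both limits
  carry a factor \<open>C\<close>, which is cancelled by injectivity.\<close>

lemma S_G:
  assumes G: "G z y" and s: "0 \<le> s" shows "S s y = T s z -\<^sub>X C z"
proof (rule C_cancel)
  have z: "z \<in> V" and y: "y \<in> V" using G by (auto simp: G_def)
  have "xlim (\<lambda>t. S s ((1 / t) *\<^sub>X (T t z -\<^sub>X C z))) (S s (C y)) (at_right 0)"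
    by (rule S_lim[OF G_limD[OF G] s])
  moreover have "eventually (\<lambda>t. S s ((1 / t) *\<^sub>X (T t z -\<^sub>X C z)) = (1 / t) *\<^sub>X (T t (S s z) -\<^sub>X C (S s z))) (at_right 0)"
  proof (rule eventually_right)
    fix t :: real assume t: "0 < t"
    have V: "T t z \<in> V" "C z \<in> V" using z t T_closed C_closed by auto
    have "S s ((1 / t) *\<^sub>X (T t z -\<^sub>X C z)) = (1 / t) *\<^sub>X S s (T t z -\<^sub>X C z)"
      unfolding rscale_def by (rule S_commute[OF smult_op, symmetric]) (use V s in \<open>auto simp: op_smult T_op\<close>)
    also have "S s (T t z -\<^sub>X C z) = S s (T t z) -\<^sub>X S s (C z)" by (rule S_diff[OF V s])
    also have "S s (T t z) = T t (S s z)"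
      by (rule S_commute[OF T_op, symmetric]) (use t z s in \<open>auto intro: T_commute\<close>)
    also have "S s (C z) = C (S s z)"
      by (rule S_commute[OF C_op, symmetric]) (use z s in \<open>auto intro: C_T_commute\<close>)
    finally show "S s ((1 / t) *\<^sub>X (T t z -\<^sub>X C z)) = (1 / t) *\<^sub>X (T t (S s z) -\<^sub>X C (S s z))" .
  qed
  ultimately have "xlim (\<lambda>t. (1 / t) *\<^sub>X (T t (S s z) -\<^sub>X C (S s z))) (S s (C y)) (at_right 0)"
    by (rule limitin_transform_eventually[rotated])
  then have "S s (C y) = C (T s z -\<^sub>X C z)"
    using generator_limit_S[OF z s] unfolding generator_limit_def by (rule lim_unique) simp
  moreover have "C (S s y) = S s (C y)"
    by (rule S_commute[OF C_op]) (use y s in \<open>auto intro: C_T_commute\<close>)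
  ultimately show "C (S s y) = C (T s z -\<^sub>X C z)" by simp
  show "S s y \<in> V" "T s z -\<^sub>X C z \<in> V" using S_closed T_closed C_closed z y s by auto
qed

text \<open>An operator that commutes with the semigroup and with \<open>C\<close> carries the
  difference quotients of \<open>z\<close> to those of \<open>R z\<close>.\<close>

lemma G_op:
  assumes R: "R \<in> ops" and comm: "\<And>u x. 0 \<le> u \<Longrightarrow> x \<in> V \<Longrightarrow> R (T u x) = T u (R x)"
    and RC: "\<And>x. x \<in> V \<Longrightarrow> R (C x) = C (R x)" and G: "G z y"
  shows "G (R z) (R y)"
proof -
  have z: "z \<in> V" and y: "y \<in> V" using G by (auto simp: G_def)
  have "xlim (\<lambda>t. R ((1 / t) *\<^sub>X (T t z -\<^sub>X C z))) (R (C y)) (at_right 0)"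
    by (rule lim_op[OF R G_limD[OF G]])
  moreover have "eventually (\<lambda>t. R ((1 / t) *\<^sub>X (T t z -\<^sub>X C z)) = (1 / t) *\<^sub>X (T t (R z) -\<^sub>X C (R z))) (at_right 0)"
    by (rule eventually_right)
      (use z T_closed C_closed in \<open>simp add: op_rscale[OF R] op_diff[OF R] comm RC\<close>)
  ultimately have "xlim (\<lambda>t. (1 / t) *\<^sub>X (T t (R z) -\<^sub>X C (R z))) (R (C y)) (at_right 0)"
    by (rule limitin_transform_eventually[rotated])
  then show ?thesis using z y op_closed[OF R] by (simp add: G_def generator_limit_def RC)
qed

lemma G_T: "G z y \<Longrightarrow> 0 \<le> s \<Longrightarrow> G (T s z) (T s y)"
  by (rule G_op[OF T_op]) (auto intro: T_commute C_T_commute[symmetric])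

lemma G_smult: "G z y \<Longrightarrow> G (c \<odot>\<^sub>X z) (c \<odot>\<^sub>X y)"
  by (rule G_op[OF smult_op]) (auto simp: op_smult T_op C_op)

lemma G_add:
  assumes "G z y" "G z' y'" shows "G (z +\<^sub>X z') (y +\<^sub>X y')"
proof -
  have V: "z \<in> V" "y \<in> V" "z' \<in> V" "y' \<in> V" using assms by (auto simp: G_def)
  have "xlim (\<lambda>t. (1 / t) *\<^sub>X (T t z -\<^sub>X C z) +\<^sub>X (1 / t) *\<^sub>X (T t z' -\<^sub>X C z')) (C y +\<^sub>X C y') (at_right 0)"
    using assms by (intro lim_add G_limD)
  moreover have "eventually (\<lambda>t. (1 / t) *\<^sub>X (T t z -\<^sub>X C z) +\<^sub>X (1 / t) *\<^sub>X (T t z' -\<^sub>X C z') =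
      (1 / t) *\<^sub>X (T t (z +\<^sub>X z') -\<^sub>X C (z +\<^sub>X z'))) (at_right 0)"
    by (rule eventually_right)
      (use V T_closed C_closed in \<open>simp add: op_add[OF T_op] op_add[OF C_op] add_diff_add flip: rscale_add\<close>)
  ultimately have "xlim (\<lambda>t. (1 / t) *\<^sub>X (T t (z +\<^sub>X z') -\<^sub>X C (z +\<^sub>X z'))) (C y +\<^sub>X C y') (at_right 0)"
    by (rule limitin_transform_eventually[rotated])
  then show ?thesis using V by (simp add: G_def generator_limit_def op_add[OF C_op])
qed

lemma G_zero: "G 0\<^sub>X 0\<^sub>X"
  using G_S[of "0\<^sub>X" 0] by (simp add: S_0 T_0 diff_self op_zero[OF C_op])

lemma G_uminus: "G z y \<Longrightarrow> G (\<ominus>\<^bsub>X\<^esub> z) (\<ominus>\<^bsub>X\<^esub> y)"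
proof -
  assume G: "G z y"
  then have "z \<in> V" "y \<in> V" by (auto simp: G_def)
  with G_smult[OF G, of "of_real (-1)"] show ?thesis
    by (simp only: rscale_def[symmetric] rscale_uminus_left rscale_one)
qed

lemma G_diff: "G z y \<Longrightarrow> G z' y' \<Longrightarrow> G (z -\<^sub>X z') (y -\<^sub>X y')"
  unfolding a_minus_def by (intro G_add G_uminus)


section \<open>The graph norm\<close>

lemma graph_carrier: "carrier (graph\<^sub>X A D) = D"
  by (simp add: graph_module_def)

lemma graph_lnorm:
  assumes "z \<in> V" "A z \<in> V"
  shows "lnorm (graph\<^sub>X A D) z \<in> L0_set M"
    and "AE w in M. rep (lnorm (graph\<^sub>X A D) z) w = N z w + N (A z) w"
  using L0_add_closed[OF lnorm_L0 lnorm_L0, OF assms] rep_L0_add[OF lnorm_L0 lnorm_L0, OF assms]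
  by (simp_all add: graph_module_def nrm_def)

lemma continuous_graph_closed:
  assumes "A \<in> D \<rightarrow> V" "D \<subseteq> V" "continuous_on_halfline M (graph\<^sub>X A D) g" "0 \<le> s"
  shows "g s \<in> D"
proof -
  have "\<forall>z\<in>carrier (graph\<^sub>X A D). lnorm (graph\<^sub>X A D) z \<in> L0_set M"
    unfolding graph_carrier using assms(1,2) by (auto intro!: graph_lnorm)
  note top = topspace_el_topology[OF prob_space_axioms this]
  show ?thesis using assms(3,4) unfolding continuous_on_halfline_def continuous_map_def top graph_carrier by auto
qed

context
  fixes A D
  assumes D: "subgroup D (add_monoid X)" and A: "A \<in> D \<rightarrow> V"
begin

lemma D_closed: "x \<in> D \<Longrightarrow> x \<in> V"
  using subgroup.subset[OF D] by auto

lemma D_diff: "x \<in> D \<Longrightarrow> y \<in> D \<Longrightarrow> x -\<^sub>X y \<in> D"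
  using subgroup.m_closed[OF D, of x "\<ominus>\<^bsub>X\<^esub> y"] subgroup.m_inv_closed[OF D, of y]
  by (simp add: a_minus_def a_inv_def)

text \<open>Restricting the carrier keeps addition, but negation is defined as an inverse within the
  carrier. It agrees with that of \<open>X\<close> because \<open>D\<close> is a subgroup.\<close>

lemma graph_minus:
  assumes "x \<in> D" "y \<in> D" shows "x \<ominus>\<^bsub>graph\<^sub>X A D\<^esub> y = x -\<^sub>X y"
proof -
  have "add_monoid (graph\<^sub>X A D) = (add_monoid X)\<lparr>carrier := D\<rparr>"
    by (simp add: graph_module_def)
  then have "\<ominus>\<^bsub>graph\<^sub>X A D\<^esub> y = \<ominus>\<^bsub>X\<^esub> y"
    using group.m_inv_consistent[OF M.a_group D assms(2)] by (simp add: a_inv_def)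
  then show ?thesis by (simp add: a_minus_def graph_module_def)
qed

text \<open>Two events of probability above \<open>(1 + l)/2\<close> meet with probability above
  \<open>l\<close>, and on their intersection the two halves of the graph norm add up to less than
  \<open>e\<close>.\<close>

lemma nbhd_graph:
  assumes "u \<in> D" "u \<in> el_nbhd M X (e/2) ((1 + l)/2)" "A u \<in> el_nbhd M X (e/2) ((1 + l)/2)"
  shows "u \<in> el_nbhd M (graph\<^sub>X A D) e l"
proof -
  let ?B = "\<lambda>v. {w \<in> space M. N v w < e/2}" and ?r = "rep (lnorm (graph\<^sub>X A D) u)"
  have V: "u \<in> V" "A u \<in> V" using assms by (auto simp: el_nbhd_def)
  have [measurable]: "?r \<in> borel_measurable M" by (intro rep_measurable graph_lnorm V)
  note [measurable] = nrm_measurable[OF V(1)] nrm_measurable[OF V(2)]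
  have "measure M (?B u) + measure M (?B (A u)) \<le> 1 + measure M (?B u \<inter> ?B (A u))"
  proof -
    have "measure M (?B u \<union> ?B (A u)) = measure M (?B u) + measure M (?B (A u) - ?B u)"
      by (rule finite_measure_Union') measurable
    moreover have "measure M (?B (A u) - ?B u) = measure M (?B (A u)) - measure M (?B (A u) \<inter> ?B u)"
      by (rule finite_measure_Diff') measurable
    ultimately show ?thesis using prob_le_1[of "?B u \<union> ?B (A u)"] by (simp add: Int_commute)
  qed
  moreover have "(1 + l)/2 < measure M (?B u)" "(1 + l)/2 < measure M (?B (A u))"
    using assms(2,3) by (simp_all add: el_nbhd_def nrm_def)
  ultimately have "l < measure M (?B u \<inter> ?B (A u))" by (simp add: field_simps)
  also have "\<dots> \<le> measure M {w \<in> space M. ?r w < e}"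
  proof (rule finite_measure_mono_AE)
    show "AE w in M. w \<in> ?B u \<inter> ?B (A u) \<longrightarrow> w \<in> {w \<in> space M. ?r w < e}"
      using graph_lnorm(2)[where A=A and D=D and z=u, OF V] by eventually_elim auto
  qed measurable
  finally show ?thesis using assms(1) by (simp add: el_nbhd_def graph_carrier)
qed

lemma graph_continuous:
  assumes A_diff: "\<And>x y. x \<in> D \<Longrightarrow> y \<in> D \<Longrightarrow> A (x -\<^sub>X y) = A x -\<^sub>X A y"
    and g: "\<And>s. 0 \<le> s \<Longrightarrow> g s \<in> D" "cont\<^sub>X g"
    and Ag: "cont\<^sub>X (\<lambda>s. A (g s))"
  shows "continuous_on_halfline M (graph\<^sub>X A D) g"
  unfolding continuous_on_halfline_def continuous_map_top_of_set_iff
proof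
  fix s :: real assume s: "s \<in> {0..}"
  have gs: "g s \<in> D" using g(1) s by simp
  show "limitin (el_topology M (graph\<^sub>X A D)) g (g s) (at s within {0..})"
  proof (rule limitin_el_topologyI[OF prob_space_axioms], unfold graph_carrier)
    show "\<forall>z\<in>D. lnorm (graph\<^sub>X A D) z \<in> L0_set M"
      using A D_closed by (auto intro!: graph_lnorm)
    fix e l :: real assume el: "0 < e" "0 < l" "l < 1"
    have small: "eventually (\<lambda>t. d1 (f t -\<^sub>X f s) < min (e/2) 1 * (1 - (1 + l)/2)) (at s within {0..})"
      if "cont\<^sub>X f" for f
      by (rule order_tendstoD(2)[OF lim_tmean[OF weight_one]])
        (use that s el in \<open>auto simp: continuous_on_halfline_iff\<close>)
    have "eventually (\<lambda>t. t \<in> {0..}) (at s within {0..})" by (simp add: eventually_at_filter)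
    with small[OF g(2)] small[OF Ag]
    show "eventually (\<lambda>t. g t \<in> D \<and> g t \<ominus>\<^bsub>graph\<^sub>X A D\<^esub> g s \<in> el_nbhd M (graph\<^sub>X A D) e l)
        (at s within {0..})"
    proof eventually_elim
      case (elim t)
      have gt: "g t \<in> D" using elim g(1) by simp
      note u = D_diff[OF gt gs]
      have "g t -\<^sub>X g s \<in> el_nbhd M X (e/2) ((1 + l)/2)"
        using elim(1) u D_closed el by (intro nbhd_if_tmean_less) auto
      moreover have "A (g t -\<^sub>X g s) \<in> el_nbhd M X (e/2) ((1 + l)/2)"
        using elim(2) u A el by (intro nbhd_if_tmean_less) (auto simp: A_diff[OF gt gs, symmetric])
      ultimately show ?case using nbhd_graph[OF u] gt by (simp add: graph_minus gs)
    qed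
  qed (rule gs)
qed

end


abbreviation "A \<equiv> generator M X C T"
abbreviation "D \<equiv> generator_dom M X C T"

lemma G_iff: "G z y \<longleftrightarrow> z \<in> D \<and> A z = y"
  using G_dom G_generator by blast

lemma D_subgroup: "subgroup D (add_monoid X)"
proof (rule group.subgroupI[OF M.a_group])
  show "D \<subseteq> carrier (add_monoid X)" by (auto simp: generator_dom_def)
  show "D \<noteq> {}" using G_zero G_dom by blast
  show "inv\<^bsub>add_monoid X\<^esub> z \<in> D" if "z \<in> D" for z
    using that G_uminus G_dom unfolding a_inv_def by blast
  show "z \<otimes>\<^bsub>add_monoid X\<^esub> z' \<in> D" if "z \<in> D" "z' \<in> D" for z z'
    using that G_add G_dom unfolding monoid.simps by (metis)
qed

lemma A_closed: "A \<in> D \<rightarrow> V"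
  using G_iff by (auto simp: G_def)

lemma A_diff: "x \<in> D \<Longrightarrow> y \<in> D \<Longrightarrow> A (x -\<^sub>X y) = A x -\<^sub>X A y"
  using G_diff[of x "A x" y "A y"] by (simp add: G_iff)

lemma A_T: "z \<in> D \<Longrightarrow> 0 \<le> s \<Longrightarrow> T s z \<in> D" "z \<in> D \<Longrightarrow> 0 \<le> s \<Longrightarrow> A (T s z) = T s (A z)"
  using G_T[of z "A z" s] by (simp_all add: G_iff)

lemma D_V: "z \<in> D \<Longrightarrow> z \<in> V"
  by (simp add: generator_dom_def)

lemma A_V: "z \<in> D \<Longrightarrow> A z \<in> V"
  using A_closed by auto

text \<open>As \<open>A\<close> commutes with \<open>T s\<close> on the domain, the bound for
  \<open>T s\<close> on \<open>X\<close> works for both terms of the graph norm.\<close>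

lemma graph_bounds:
  assumes "\<xi> \<in> L0_bounds M X X (T s)" "0 \<le> s"
  shows "\<xi> \<in> L0_bounds M (graph\<^sub>X A D) (graph\<^sub>X A D) (restrict (T s) D)"
  unfolding L0_bounds_def graph_carrier
proof (intro CollectI conjI ballI)
  show \<xi>: "\<xi> \<in> L0_plus M" using assms(1) by (simp add: L0_bounds_def)
  fix z assume z: "z \<in> D"
  let ?Y = "graph\<^sub>X A D"
  have V: "z \<in> V" "A z \<in> V" "T s z \<in> V" "A (T s z) \<in> V"
    using D_V[OF z] A_V[OF z] D_V[OF A_T(1)[OF z assms(2)]] A_V[OF A_T(1)[OF z assms(2)]] .
  have "AE w in M. N (T s z) w \<le> rep \<xi> w * N z w" "AE w in M. N (A (T s z)) w \<le> rep \<xi> w * N (A z) w"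
    using assms V z A_T(2)[OF z assms(2)] unfolding L0_bounds_iff by auto
  with graph_lnorm(2)[where A=A and D=D and z=z, OF V(1,2)]
    graph_lnorm(2)[where A=A and D=D and z="T s z", OF V(3,4)]
    rep_L0_mult[OF L0_plus_L0_set[OF \<xi>] graph_lnorm(1)[where A=A and D=D and z=z, OF V(1,2)]]
  show "L0_le M (lnorm ?Y (restrict (T s) D z)) (\<xi> \<otimes>\<^bsub>L0 M\<^esub> lnorm ?Y z)"
    unfolding L0_le_def restrict_apply'[OF z] by eventually_elim (simp add: distrib_left)
qed

lemma graph_linear:
  assumes s: "0 \<le> s"
  shows "linear_op M (graph\<^sub>X A D) (graph\<^sub>X A D) (restrict (T s) D)"
  unfolding linear_op_def graph_carrier
proof (intro conjI ballI allI)
  show "restrict (T s) D \<in> D \<rightarrow> D" using A_T s by auto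
  fix x y assume xy: "x \<in> D" "y \<in> D"
  then have "x +\<^sub>X y \<in> D" using G_add G_dom by metis
  then show "restrict (T s) D (x \<oplus>\<^bsub>graph\<^sub>X A D\<^esub> y) =
      restrict (T s) D x \<oplus>\<^bsub>graph\<^sub>X A D\<^esub> restrict (T s) D y"
    using xy D_V by (simp add: graph_module_def op_add[OF T_op[OF s]])
next
  fix c x assume x: "x \<in> D"
  then have "c \<odot>\<^sub>X x \<in> D" using G_smult G_dom by metis
  then show "restrict (T s) D (L0_const M c \<odot>\<^bsub>graph\<^sub>X A D\<^esub> x) =
      L0_const M c \<odot>\<^bsub>graph\<^sub>X A D\<^esub> restrict (T s) D x"
    using x D_V by (simp add: graph_module_def op_smult[OF T_op[OF s]])
qed

theorem strong_C_existence: "strong_C_existence_family M X C A D T"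
  unfolding strong_C_existence_family_def
proof
  show "mild_C_existence_family M X C A D T"
    unfolding mild_C_existence_family_def
  proof (intro conjI ballI allI impI bounded T_continuous)
    fix z :: 'x and s :: real assume "z \<in> V" "0 \<le> s"
    then show "\<exists>I. has_rint (\<lambda>u. T u z) I 0 s \<and> I \<in> D \<and> A I = T s z -\<^sub>X C z"
      using S_integral G_S by (intro exI[of _ "S s z"]) (simp add: G_iff)
  qed
  show "C_existence_family M X C A D (\<lambda>s. restrict (T s) D)"
    unfolding C_existence_family_def
  proof (intro conjI ballI allI impI)
    show "locally_as_bounded M (graph\<^sub>X A D) (\<lambda>s. restrict (T s) D)"
    proof (rule locally_as_boundedI)
      show *: "\<exists>\<xi>. \<forall>s\<in>{0..l}. \<xi> \<in> L0_bounds M (graph\<^sub>X A D) (graph\<^sub>X A D) (restrict (T s) D)"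
        if "0 < l" for l
        using locally_as_boundedD[OF bounded that] graph_bounds by (metis atLeastAtMost_iff)
      fix s :: real assume s: "0 \<le> s"
      then show "restrict (T s) D \<in> bounded_ops M (graph\<^sub>X A D) (graph\<^sub>X A D)"
        using graph_linear[OF s] *[of "s + 1"] unfolding bounded_ops_def by auto
    qed
    fix z assume z: "z \<in> D"
    show "continuous_on_halfline M (graph\<^sub>X A D) (\<lambda>s. restrict (T s) D z)"
      unfolding restrict_apply'[OF z]
    \<comment> \<open>Continuity in the graph norm asks for continuity of the orbit and of its image
      under \<open>A\<close>, which is the orbit of \<open>A z\<close>.\<close>
    proof (rule graph_continuous[OF D_subgroup A_closed A_diff])
      show "cont\<^sub>X (\<lambda>s. A (T s z))"
        unfolding continuous_on_halfline_iff
      proof (intro allI impI)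
        fix s :: real assume s: "0 \<le> s"
        have "eventually (\<lambda>u. T u (A z) = A (T u z)) (at s within {0..})"
          unfolding eventually_at_filter by (rule always_eventually) (use z A_T in auto)
        with T_lim[OF s A_V[OF z]] show "xlim (\<lambda>u. A (T u z)) (A (T s z)) (at s within {0..})"
          unfolding A_T(2)[OF z s] by (rule limitin_transform_eventually[rotated])
      qed
    qed (use z A_T D_V T_continuous in auto)
    fix s :: real assume s: "0 \<le> s"
    have "has_rint (\<lambda>u. T u (A z)) (S s (A z)) 0 s"
      using S_integral[OF A_V[OF z] s] .
    then have "has_rint (\<lambda>u. T u (A z)) (T s z -\<^sub>X C z) 0 s"
      using S_G[of z "A z" s] z s by (simp add: G_iff)
    then have "has_rint (\<lambda>u. A (T u z)) (T s z -\<^sub>X C z) 0 s"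
      by (rule has_riemann_integral_cong) (simp add: A_T z T_closed A_V)
    then show "has_rint (\<lambda>u. A (restrict (T u) D z)) (restrict (T s) D z -\<^sub>X C z) 0 s"
      unfolding restrict_apply'[OF z] .
  qed
qed


section \<open>Uniqueness for the abstract Cauchy problem\<close>

text \<open>The term \<open>C z\<close> of \<open>S_G\<close> cancels. Orbits of vectors in the
  domain are thus L0-Lipschitz, with a constant governed by the norm of \<open>y\<close>.\<close>

lemma T_diff_S:
  assumes "G z y" "0 \<le> a" "0 \<le> b" shows "T a z -\<^sub>X T b z = S a y -\<^sub>X S b y"
proof -
  have "z \<in> V" using assms by (simp add: G_def)
  then show ?thesis using assms T_closed C_closed by (simp add: S_G diff_diff_cancel)
qed

text \<open>The Lipschitz constant bounds all difference quotients, and such a bound passes to the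
  limit. This yields one bound for all the vectors \<open>A (U u)\<close>.\<close>

lemma nrm_derivative_le:
  assumes "has_deriv U y u" "0 < u" "u < l" "weight M a" "\<And>t. 0 \<le> t \<Longrightarrow> U t \<in> V"
    and lip: "\<And>s t. s \<in> {0..l} \<Longrightarrow> t \<in> {0..l} \<Longrightarrow> AE w in M. N (U s -\<^sub>X U t) w \<le> a w * \<bar>s - t\<bar>"
  shows "AE w in M. N y w \<le> a w"
proof (rule nrm_lim_le)
  show "xlim (\<lambda>t. (1 / (t - u)) *\<^sub>X (U t -\<^sub>X U u)) y (at u)"
    using assms(1,2) by (simp add: has_derivative_halfline_def at_within_halfline)
  show "a \<in> borel_measurable M" using assms(4) by (rule weight_measurable)
  have "eventually (\<lambda>t. t \<in> {0<..<l} \<and> t \<noteq> u) (at u)"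
    by (intro eventually_conj eventually_at_in_open' eventually_neq_at_within) (use assms in auto)
  then show "eventually (\<lambda>t. AE w in M. N ((1 / (t - u)) *\<^sub>X (U t -\<^sub>X U u)) w \<le> a w) (at u)"
  proof eventually_elim
    case (elim t)
    have V: "U t -\<^sub>X U u \<in> V" using elim assms(2,5) by auto
    have "AE w in M. N (U t -\<^sub>X U u) w \<le> a w * \<bar>t - u\<bar>" using elim assms(2,3) by (intro lip) auto
    with nrm_rscale[OF V, of "1 / (t - u)"] show ?case
      by eventually_elim (use elim in \<open>simp add: divide_le_eq abs_divide\<close>)
  qed
qed simp

text \<open>Strong continuity handles the fixed vector \<open>y\<close>, and the bound that is
  uniform on \<open>[0,l]\<close> handles the error \<open>q i -\<^sub>X y\<close>.\<close>

lemma T_lim_joint: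
  assumes q: "xlim q y F" and r: "filterlim r (at \<sigma> within {0..}) F" "0 \<le> \<sigma>"
    and l: "0 \<le> l" "eventually (\<lambda>i. r i \<in> {0..l}) F"
  shows "xlim (\<lambda>i. T (r i) (q i)) (T \<sigma> y) F"
proof -
  note y = limD(1)[OF q] and ev = limD(2)[OF q]
  obtain b where b: "weight M b" "\<And>s z. s \<in> {0..l} \<Longrightarrow> z \<in> V \<Longrightarrow> AE w in M. N (T s z) w \<le> b w * N z w"
    using T_bound[OF l(1)] by metis
  have "xlim (\<lambda>i. q i -\<^sub>X y) 0\<^sub>X F" using q lim_shift[OF y ev] by simp
  then have "xlim (\<lambda>i. T (r i) (q i -\<^sub>X y)) 0\<^sub>X F"
  proof (rule lim_dominated[OF _ b(1)])
    show "eventually (\<lambda>i. T (r i) (q i -\<^sub>X y) \<in> V \<and>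
        (AE w in M. N (T (r i) (q i -\<^sub>X y)) w \<le> b w * N (q i -\<^sub>X y) w)) F"
      using ev l(2) by eventually_elim (use y b(2) T_closed in auto)
  qed
  moreover have "xlim (\<lambda>i. T (r i) y) (T \<sigma> y) F"
    by (rule limitin_compose_filter[OF T_lim[OF r(2) y] r(1)])
  ultimately have "xlim (\<lambda>i. T (r i) (q i -\<^sub>X y) +\<^sub>X T (r i) y) (0\<^sub>X +\<^sub>X T \<sigma> y) F" by (rule lim_add)
  then have "xlim (\<lambda>i. T (r i) (q i -\<^sub>X y) +\<^sub>X T (r i) y) (T \<sigma> y) F" using T_closed[OF r(2) y] by simp
  then show ?thesis
  proof (rule limitin_transform_eventually[rotated])
    show "eventually (\<lambda>i. T (r i) (q i -\<^sub>X y) +\<^sub>X T (r i) y = T (r i) (q i)) F"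
      using ev l(2) by eventually_elim (use y T_closed in \<open>simp add: op_diff[OF T_op] diff_add_cancel\<close>)
  qed
qed

theorem cauchy_zero:
  assumes U: "loc_lip U" "U 0 = 0\<^sub>X" and G: "\<And>u. 0 < u \<Longrightarrow> G (U u) (Y u)"
    and der: "\<And>u. 0 < u \<Longrightarrow> has_deriv U (Y u) u" and s: "0 \<le> s"
  shows "U s = 0\<^sub>X"
proof -
  note UV = loc_lip_closed[OF U(1)]
  obtain b where b: "weight M b" "\<And>r z. r \<in> {0..s} \<Longrightarrow> z \<in> V \<Longrightarrow> AE w in M. N (T r z) w \<le> b w * N z w"
    using T_bound[OF s] by metis
  \<comment> \<open>The margin makes \<open>u = s\<close> an interior point for
    \<open>nrm_derivative_le\<close>.\<close>
  have s1: "0 \<le> s + 1" using s by simp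
  obtain a where a: "weight M a" "\<And>u t. u \<in> {0..s + 1} \<Longrightarrow> t \<in> {0..s + 1} \<Longrightarrow>
      AE w in M. N (U u -\<^sub>X U t) w \<le> a w * \<bar>u - t\<bar>" using loc_lipE[OF U(1) s1] by metis
  have Y: "Y u \<in> V" "AE w in M. N (Y u) w \<le> a w" if "0 < u" "u \<le> s" for u
    using G[OF that(1)] nrm_derivative_le[where l="s + 1", OF der[OF that(1)] that(1) _ a(1) UV a(2)] that by (auto simp: G_def)
  have TV: "T (s - u) (U v) \<in> V" if "u \<in> {0..s}" "v \<in> {0..s}" for u v
    using that T_closed UV by auto
  have lip2: "AE w in M. N (T (s - u) (U v) -\<^sub>X T (s - v) (U v)) w \<le> (b w * a w) * \<bar>u - v\<bar>"
    if uv: "u \<in> {0..s}" "v \<in> {0..s}" for u v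
  \<comment> \<open>At \<open>v = 0\<close> membership in the domain is not assumed, but there
    \<open>U\<close> vanishes.\<close>
  proof (cases "v = 0")
    case True
    have "N 0\<^sub>X w \<le> (b w * a w) * \<bar>u - v\<bar>" if "N 0\<^sub>X w = 0" for w
      using that weight_pos[OF weight_mult[OF b(1) a(1)], of w] by simp
    then show ?thesis using True nrm_zero U(2) uv s by (auto simp: op_zero T_op diff_self elim!: AE_mp)
  next
    case False
    then have v: "0 < v" "v \<le> s" using uv by auto
    note [measurable] = weight_measurable[OF b(1)] weight_measurable[OF a(1)]
    have "AE w in M. N (S (s - u) (Y v) -\<^sub>X S (s - v) (Y v)) w \<le> (b w * a w) * \<bar>(s - u) - (s - v)\<bar>"
    proof (rule S_lipschitz[OF Y(1)[OF v], where l=s])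
      fix r assume "r \<in> {0..s}"
      from b(2)[OF this Y(1)[OF v]] Y(2)[OF v] show "AE w in M. N (T r (Y v)) w \<le> b w * a w"
      proof eventually_elim
        case (elim w)
        have "b w * N (Y v) w \<le> b w * a w" using elim(2) weight_pos[OF b(1), of w] by (intro mult_left_mono) auto
        then show ?case using elim(1) by simp
      qed
    qed (use uv in auto)
    then show ?thesis using T_diff_S[OF G[OF v(1)], of "s - u" "s - v"] uv by (simp add: abs_minus_commute)
  qed
  \<comment> \<open>The left end of this equation is \<open>T 0 (U s) = C (U s)\<close>, the right
    end is zero. The Lipschitz constant has two terms, one for changing the vector and one for
    changing the time.\<close>
  have "T (s - s) (U s) = T (s - 0) (U 0)"
  proof (rule zero_derivative_const[OF s])
    show "weight M (\<lambda>w. b w * a w + b w * a w)" by (intro weight_add weight_mult a b)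
    fix u v assume uv: "u \<in> {0..s}" "v \<in> {0..s}"
    have V: "U u \<in> V" "U v \<in> V" "T (s - u) (U u) \<in> V" "T (s - u) (U v) \<in> V" "T (s - v) (U v) \<in> V"
      using uv UV TV by auto
    have "AE w in M. N (T (s - u) (U u) -\<^sub>X T (s - u) (U v)) w \<le> b w * N (U u -\<^sub>X U v) w"
      using b(2)[of "s - u" "U u -\<^sub>X U v"] uv V by (simp add: op_diff T_op)
    moreover have "AE w in M. N (T (s - u) (U u) -\<^sub>X T (s - v) (U v)) w \<le>
        N (T (s - u) (U u) -\<^sub>X T (s - u) (U v)) w + N (T (s - u) (U v) -\<^sub>X T (s - v) (U v)) w"
      using nrm_triangle[OF vminus_closed[OF V(3,4)] vminus_closed[OF V(4,5)]]
      unfolding diff_trans[OF V(3,4,5), symmetric] .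
    moreover have "AE w in M. N (U u -\<^sub>X U v) w \<le> a w * \<bar>u - v\<bar>" using uv by (intro a(2)) auto
    ultimately show "AE w in M. N (T (s - u) (U u) -\<^sub>X T (s - v) (U v)) w \<le> (b w * a w + b w * a w) * \<bar>u - v\<bar>"
      using lip2[OF uv]
    proof eventually_elim
      case (elim w)
      have "b w * N (U u -\<^sub>X U v) w \<le> b w * (a w * \<bar>u - v\<bar>)"
        using elim(3) weight_pos[OF b(1), of w] by (intro mult_left_mono) auto
      then show ?case using elim by (simp add: algebra_simps)
    qed
  next
    fix u :: real assume u: "0 < u" "u < s"
    let ?q = "\<lambda>t. (1 / (t - u)) *\<^sub>X (U t -\<^sub>X U u)"
    have Yu: "Y u \<in> V" using Y u by simp
    have ev: "eventually (\<lambda>t. t \<in> {0<..<s} \<and> t \<noteq> u) (at u)"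
      by (intro eventually_conj eventually_at_in_open' eventually_neq_at_within) (use u in auto)
    have r: "filterlim (\<lambda>t. s - t) (at (s - u) within {0..}) (at u)"
      unfolding filterlim_at
    proof
      show "eventually (\<lambda>t. s - t \<in> {0..} \<and> s - t \<noteq> s - u) (at u)" using ev by eventually_elim auto
    qed (intro tendsto_intros)
    have "xlim ?q (Y u) (at u)"
      using der[OF u(1)] u by (simp add: has_derivative_halfline_def at_within_halfline)
    then have 1: "xlim (\<lambda>t. T (s - t) (?q t)) (T (s - u) (Y u)) (at u)"
      by (rule T_lim_joint[OF _ r _ s]) (use u ev in \<open>auto elim!: eventually_mono\<close>)
    have 2: "xlim (\<lambda>t. (1 / ((s - t) - (s - u))) *\<^sub>X (S (s - t) (Y u) -\<^sub>X S (s - u) (Y u))) (T (s - u) (Y u)) (at u)"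
      using limitin_compose_filter[OF S_derivative[OF Yu, unfolded has_derivative_halfline_def] r] u by simp
    \<comment> \<open>The product rule: the contributions of \<open>U\<close> and of the semigroup
      both tend to \<open>T (s - u) (Y u)\<close>. The quotient of the semigroup is taken in the
      reversed time \<open>s - t\<close>, so it enters with a minus sign and the two limits
      cancel.\<close>
    have "xlim (\<lambda>t. T (s - t) (?q t) -\<^sub>X
        (1 / ((s - t) - (s - u))) *\<^sub>X (S (s - t) (Y u) -\<^sub>X S (s - u) (Y u)))
        (T (s - u) (Y u) -\<^sub>X T (s - u) (Y u)) (at u)"
      by (rule lim_diff[OF 1 2])
    then have "xlim (\<lambda>t. T (s - t) (?q t) -\<^sub>X
        (1 / ((s - t) - (s - u))) *\<^sub>X (S (s - t) (Y u) -\<^sub>X S (s - u) (Y u))) 0\<^sub>X (at u)"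
      using T_closed Yu u by (simp add: diff_self)
    then show "xlim (\<lambda>t. (1 / (t - u)) *\<^sub>X (T (s - t) (U t) -\<^sub>X T (s - u) (U u))) 0\<^sub>X (at u)"
    proof (rule limitin_transform_eventually[rotated])
      show "eventually (\<lambda>t. T (s - t) (?q t) -\<^sub>X
          (1 / ((s - t) - (s - u))) *\<^sub>X (S (s - t) (Y u) -\<^sub>X S (s - u) (Y u)) =
          (1 / (t - u)) *\<^sub>X (T (s - t) (U t) -\<^sub>X T (s - u) (U u))) (at u)"
        using ev
      proof eventually_elim
        case (elim t)
        have V: "U t \<in> V" "U u \<in> V" "T (s - t) (U t) \<in> V" "T (s - t) (U u) \<in> V" "T (s - u) (U u) \<in> V"
          using elim u UV TV by auto
        have st: "0 \<le> s - t" using elim by simp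
        have "(1 / ((s - t) - (s - u))) *\<^sub>X (S (s - t) (Y u) -\<^sub>X S (s - u) (Y u)) =
            (- (1 / (t - u))) *\<^sub>X (T (s - t) (U u) -\<^sub>X T (s - u) (U u))"
          using elim u T_diff_S[OF G[OF u(1)], of "s - t" "s - u"]
          by (simp add: minus_divide_right)
        also have "\<dots> = \<ominus>\<^bsub>X\<^esub> ((1 / (t - u)) *\<^sub>X (T (s - t) (U u) -\<^sub>X T (s - u) (U u)))"
          using V by (simp add: rscale_uminus_left)
        finally have 3: "(1 / ((s - t) - (s - u))) *\<^sub>X (S (s - t) (Y u) -\<^sub>X S (s - u) (Y u)) =
            \<ominus>\<^bsub>X\<^esub> ((1 / (t - u)) *\<^sub>X (T (s - t) (U u) -\<^sub>X T (s - u) (U u)))" .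
        have 4: "T (s - t) (?q t) = (1 / (t - u)) *\<^sub>X (T (s - t) (U t) -\<^sub>X T (s - t) (U u))"
          using V by (simp add: op_rscale[OF T_op[OF st]] op_diff[OF T_op[OF st]])
        show ?case
          unfolding 3 4 diff_trans[OF V(3,4,5)] using V
          by (simp add: a_minus_def rscale_add)
      qed
    qed
  qed (use TV in auto)
  then have "C (U s) = C 0\<^sub>X" using U(2) UV[OF s] s by (simp add: T_0 op_zero[OF T_op] op_zero[OF C_op])
  then show ?thesis using C_cancel UV[OF s] by simp
qed

end

section \<open>Lipschitz solutions for restrictions of the generator\<close>

lemma (in RN_module) loc_lip_if_locally_L0_lipschitz:
  assumes "locally_L0_lipschitz M X g" shows "loc_lip g"
  unfolding loc_lip_def
proof (intro conjI allI impI)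
  show V: "g s \<in> V" if "0 \<le> s" for s using assms that by (auto simp: locally_L0_lipschitz_def)
  fix l :: real assume l: "0 \<le> l"
  then have "0 < l + 1" by simp
  then obtain \<xi> where \<xi>: "\<xi> \<in> L0_plus M" "\<And>s t. s \<in> {0..l + 1} \<Longrightarrow> t \<in> {0..l + 1} \<Longrightarrow>
      L0_le M (lnorm X (g s -\<^sub>X g t)) (\<xi> \<otimes>\<^bsub>L0 M\<^esub> L0_const M \<bar>s - t\<bar>)"
    using assms unfolding locally_L0_lipschitz_def by blast
  have \<xi>L: "\<xi> \<in> L0_set M" using \<xi>(1) by (rule L0_plus_L0_set)
  show "\<exists>b. weight M b \<and> (\<forall>s\<in>{0..l}. \<forall>t\<in>{0..l}. AE w in M. N (g s -\<^sub>X g t) w \<le> b w * \<bar>s - t\<bar>)"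
  proof (intro exI[of _ "\<lambda>w. 1 + \<bar>rep \<xi> w\<bar>"] conjI ballI)
    show "weight M (\<lambda>w. 1 + \<bar>rep \<xi> w\<bar>)" by (intro weight_abs rep_measurable \<xi>L)
    fix s t assume st: "s \<in> {0..l}" "t \<in> {0..l}"
    have c: "L0_const M \<bar>s - t\<bar> \<in> L0_set M" using L0_const_closed[of M "\<bar>s - t\<bar>"] by (simp add: L0_def)
    have "AE w in M. N (g s -\<^sub>X g t) w \<le> rep (\<xi> \<otimes>\<^bsub>L0 M\<^esub> L0_const M \<bar>s - t\<bar>) w"
      using \<xi>(2)[of s t] st by (simp add: L0_le_def nrm_def)
    with rep_L0_mult[OF \<xi>L c] rep_L0_const[of M "\<bar>s - t\<bar>"]
    show "AE w in M. N (g s -\<^sub>X g t) w \<le> (1 + \<bar>rep \<xi> w\<bar>) * \<bar>s - t\<bar>"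
    proof eventually_elim
      case (elim w)
      have "rep \<xi> w * \<bar>s - t\<bar> \<le> (1 + \<bar>rep \<xi> w\<bar>) * \<bar>s - t\<bar>" by (intro mult_right_mono) auto
      then show ?case using elim by simp
    qed
  qed
qed

lemma (in RN_module) loc_bounded_if_loc_lip:
  assumes "loc_lip g" shows "loc_bounded g"
  unfolding loc_bounded_def
proof (intro allI impI)
  fix l :: real assume l: "0 \<le> l"
  obtain a where a: "weight M a" "\<And>u t. u \<in> {0..l} \<Longrightarrow> t \<in> {0..l} \<Longrightarrow>
      AE w in M. N (g u -\<^sub>X g t) w \<le> a w * \<bar>u - t\<bar>" using loc_lipE[OF assms l] by metis
  note V = loc_lip_closed[OF assms]
  show "\<exists>b. weight M b \<and> (\<forall>u\<in>{0..l}. AE w in M. N (g u) w \<le> b w)"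
  proof (intro exI[of _ "\<lambda>w. a w * (1 + \<bar>l\<bar>) + (1 + \<bar>N (g 0) w\<bar>)"] conjI ballI)
    show "weight M (\<lambda>w. a w * (1 + \<bar>l\<bar>) + (1 + \<bar>N (g 0) w\<bar>))"
      by (intro weight_add weight_mult weight_abs a nrm_measurable V) auto
    fix u assume u: "u \<in> {0..l}"
    have gV: "g u \<in> V" "g 0 \<in> V" using V u by auto
    have "AE w in M. N (g u) w \<le> N (g u -\<^sub>X g 0) w + N (g 0) w"
      using nrm_triangle[OF vminus_closed[OF gV] gV(2)] gV by (simp add: diff_add_cancel)
    moreover have "AE w in M. N (g u -\<^sub>X g 0) w \<le> a w * \<bar>u - 0\<bar>" using u l by (intro a(2)) auto
    ultimately show "AE w in M. N (g u) w \<le> a w * (1 + \<bar>l\<bar>) + (1 + \<bar>N (g 0) w\<bar>)"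
    proof eventually_elim
      case (elim w)
      have "a w * \<bar>u - 0\<bar> \<le> a w * (1 + \<bar>l\<bar>)" using u weight_pos[OF a(1), of w] by (intro mult_left_mono) auto
      then show ?case using elim by simp
    qed
  qed
qed

context bounded_C_semigroup
begin

context
  fixes A' D'
  assumes ext: "D' \<subseteq> D" "\<And>z. z \<in> D' \<Longrightarrow> A z = A' z"
begin

lemma restriction_G: "z \<in> D' \<Longrightarrow> G z (A' z)"
  using ext by (auto simp: G_iff)

lemma restriction_closed: "A' \<in> D' \<rightarrow> V" "D' \<subseteq> V"
  using restriction_G by (auto simp: G_def)

lemma acp_solution_unique:
  assumes W1: "acp_solution M X A' D' z W1" "locally_L0_lipschitz M X W1"
    and W2: "acp_solution M X A' D' z W2" "locally_L0_lipschitz M X W2" and s: "0 \<le> s"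
  shows "W1 s = W2 s"
proof -
  note L1 = loc_lip_if_locally_L0_lipschitz[OF W1(2)] and L2 = loc_lip_if_locally_L0_lipschitz[OF W2(2)]
  note V1 = loc_lip_closed[OF L1] and V2 = loc_lip_closed[OF L2]
  have D': "W1 u \<in> D'" "W2 u \<in> D'" if "0 \<le> u" for u
    using that W1(1) W2(1) continuous_graph_closed[OF restriction_closed] unfolding acp_solution_def by auto
  have "W1 s -\<^sub>X W2 s = 0\<^sub>X"
  proof (rule cauchy_zero[OF loc_lip_diff[OF L1 L2] _ _ _ s])
    show "W1 0 -\<^sub>X W2 0 = 0\<^sub>X" using W1(1) W2(1) V1[of 0] by (simp add: acp_solution_def diff_self)
    fix u :: real assume u: "0 < u"
    show "G (W1 u -\<^sub>X W2 u) (A' (W1 u) -\<^sub>X A' (W2 u))" using u by (intro G_diff restriction_G D') auto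
    show "has_deriv (\<lambda>s. W1 s -\<^sub>X W2 s) (A' (W1 u) -\<^sub>X A' (W2 u)) u"
      using u W1(1) W2(1) V1 V2 by (intro derivative_diff) (auto simp: acp_solution_def)
  qed
  then show ?thesis using diff_eq_zero_iff V1[OF s] V2[OF s] by simp
qed

text \<open>The integrals in the definition of a mild solution exist for each upper limit
  separately. As Riemann integrals are unique, they are the values of one Lipschitz primitive, which
  can be differentiated.\<close>

lemma mild_solution_primitive:
  assumes W: "mild_solution M X A' D' z W" "locally_L0_lipschitz M X W"
  obtains P where "primitive W P" "\<And>s. 0 \<le> s \<Longrightarrow> P s \<in> D' \<and> W s = A' (P s) +\<^sub>X z"
proof -
  have "cont\<^sub>X W" using W(1) by (simp add: mild_solution_def)
  from primitive_exists[OF complete this loc_bounded_if_loc_lip[OF loc_lip_if_locally_L0_lipschitz[OF W(2)]]]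
  obtain P where P: "primitive W P" "\<And>s. 0 \<le> s \<Longrightarrow> has_rint W (P s) 0 s" by blast
  have "P s \<in> D' \<and> W s = A' (P s) +\<^sub>X z" if s: "0 \<le> s" for s
  proof -
    obtain I where I: "has_rint W I 0 s" "I \<in> D'" "W s = A' I +\<^sub>X z"
      using W(1) s unfolding mild_solution_def by blast
    have "I = P s"
      using I(1) P(2)[OF s] unfolding has_riemann_integral_def by (rule lim_unique) (rule riemann_filter_neq_bot)
    then show ?thesis using I by simp
  qed
  then show ?thesis using that P(1) by blast
qed

text \<open>In the difference the initial value \<open>z\<close> cancels, so
  \<open>P1 -\<^sub>X P2\<close> solves the homogeneous problem: its derivative
  \<open>W1 -\<^sub>X W2\<close> is also its image under the generator.\<close>

lemma mild_solution_unique: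
  assumes z: "z \<in> V"
    and W1: "mild_solution M X A' D' z W1" "locally_L0_lipschitz M X W1"
    and W2: "mild_solution M X A' D' z W2" "locally_L0_lipschitz M X W2" and s: "0 \<le> s"
  shows "W1 s = W2 s"
proof -
  obtain P1 where P1: "primitive W1 P1" "\<And>s. 0 \<le> s \<Longrightarrow> P1 s \<in> D' \<and> W1 s = A' (P1 s) +\<^sub>X z"
    using mild_solution_primitive[OF W1] by metis
  obtain P2 where P2: "primitive W2 P2" "\<And>s. 0 \<le> s \<Longrightarrow> P2 s \<in> D' \<and> W2 s = A' (P2 s) +\<^sub>X z"
    using mild_solution_primitive[OF W2] by metis
  note P = primitive_diff[OF P1(1) P2(1)]
  have G: "G (P1 u -\<^sub>X P2 u) (W1 u -\<^sub>X W2 u)" if u: "0 \<le> u" for u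
  proof -
    have D': "P1 u \<in> D'" "P2 u \<in> D'" using P1(2)[OF u] P2(2)[OF u] by auto
    then have "A' (P1 u) \<in> V" "A' (P2 u) \<in> V" using restriction_closed by auto
    then have "W1 u -\<^sub>X W2 u = A' (P1 u) -\<^sub>X A' (P2 u)"
      using P1(2)[OF u] P2(2)[OF u] z by (simp add: add_diff_add diff_self)
    then show ?thesis using G_diff[OF restriction_G restriction_G, OF D'] by simp
  qed
  have "P1 s -\<^sub>X P2 s = 0\<^sub>X"
    by (rule cauchy_zero[OF _ _ G _ s]) (use P in \<open>auto simp: primitive_def\<close>)
  \<comment> \<open>The difference of the solutions is the image under the generator of the vector
    zero, hence zero.\<close>
  then have "W1 s -\<^sub>X W2 s = 0\<^sub>X" using G[OF s] G_zero G_unique by metis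
  then show ?thesis
    using diff_eq_zero_iff[of "W1 s" "W2 s"] s
      loc_lip_closed[OF loc_lip_if_locally_L0_lipschitz[OF W1(2)]]
      loc_lip_closed[OF loc_lip_if_locally_L0_lipschitz[OF W2(2)]] by simp
qed

end

end

theorem theorem5p2:
  fixes M :: "'w measure"
    and X :: "('w, 'k::{real_normed_field,second_countable_topology}, 'x) rn_module"
  assumes "RN_module M X" and "el_complete M X"
  shows
    "(\<forall>C V. C_semigroup M X C V \<and> locally_as_bounded M X V \<longrightarrow>
        strong_C_existence_family M X C (generator M X C V) (generator_dom M X C V) V)
     \<and>
     (\<forall>A D. module_hom_on M X D A \<and>
        (\<exists>C V. C_semigroup M X C V \<and> locally_as_bounded M X V \<and>
           D \<subseteq> generator_dom M X C V \<and> (\<forall>z\<in>D. generator M X C V z = A z)) \<longrightarrow>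
        (\<forall>z\<in>carrier X.
           (\<forall>W1 W2. acp_solution M X A D z W1 \<and> locally_L0_lipschitz M X W1 \<and>
              acp_solution M X A D z W2 \<and> locally_L0_lipschitz M X W2 \<longrightarrow>
              (\<forall>s\<ge>0. W1 s = W2 s)) \<and>
           (\<forall>W1 W2. mild_solution M X A D z W1 \<and> locally_L0_lipschitz M X W1 \<and>
              mild_solution M X A D z W2 \<and> locally_L0_lipschitz M X W2 \<longrightarrow>
              (\<forall>s\<ge>0. W1 s = W2 s))))"
proof (intro conjI allI impI ballI; elim conjE exE)
  fix C V assume "C_semigroup M X C V" "locally_as_bounded M X V"
  then interpret bounded_C_semigroup M X C V
    using assms by (intro bounded_C_semigroup.intro bounded_C_semigroup_axioms.intro)
  show "strong_C_existence_family M X C (generator M X C V) (generator_dom M X C V) V"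
    by (rule strong_C_existence)
next
  fix A D z W1 W2 C V and s :: real
  assume "C_semigroup M X C V" "locally_as_bounded M X V"
  then interpret bounded_C_semigroup M X C V
    using assms by (intro bounded_C_semigroup.intro bounded_C_semigroup_axioms.intro)
  assume "D \<subseteq> generator_dom M X C V" "\<forall>z\<in>D. generator M X C V z = A z"
    "acp_solution M X A D z W1" "locally_L0_lipschitz M X W1"
    "acp_solution M X A D z W2" "locally_L0_lipschitz M X W2" "0 \<le> s"
  then show "W1 s = W2 s" using acp_solution_unique[of D A z W1 W2 s] by blast
next
  fix A D z W1 W2 C V and s :: real
  assume "C_semigroup M X C V" "locally_as_bounded M X V"
  then interpret bounded_C_semigroup M X C V
    using assms by (intro bounded_C_semigroup.intro bounded_C_semigroup_axioms.intro)
  assume "z \<in> carrier X" "D \<subseteq> generator_dom M X C V" "\<forall>z\<in>D. generator M X C V z = A z"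
    "mild_solution M X A D z W1" "locally_L0_lipschitz M X W1"
    "mild_solution M X A D z W2" "locally_L0_lipschitz M X W2" "0 \<le> s"
  then show "W1 s = W2 s" using mild_solution_unique[of D A z W1 W2 s] by blast
qed

end
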